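(* Let $(E,\mathcal L,\mathcal B)$ be a normal labelled space and $K$ a field. For every nonzero element $\alpha\in L_K(E,\mathcal L,\mathcal B)$, there exist $a,b\in L_K(E,\mathcal L,\mathcal B)$ such that either: (1) $0\neq a\alpha b=kp_A$ for some $k\in K\setminus\{0\}$ and some nonempty $A\in\mathcal B$; or (2) $0\neq a\alpha b=\sum_{i=0}^n k_i s_c^i p_A$, where $n\in\mathbb N$ (with $0\in\mathbb N$), $k_i\in K$, $(c,A)$ is a cycle without exit, and $s_c^0:=p_A$.
   Context: Graphs and labels. A directed graph $E=(E^0,E^1,r,s)$ has a nonempty vertex set $E^0$, an edge set $E^1$, and range and source maps $r,s:E^1\to E^0$. A path of length $n\ge1$ is a sequence $\lambda=\lambda_1\cdots\lambda_n$ of edges with $r(\lambda_i)=s(\lambda_{i+1})$; its source is $s(\lambda_1)$ and its range is $r(\lambda_n)$; $E^n$ is the set of paths of length $n$. A labelled graph $(E,\mathcal L)$ is a directed graph with a surjective map $\mathcal L:E^1\to\mathcal A$ onto a nonempty set $\mathcal A$ (the alphabet), extended to paths by $\mathcal L(\lambda_1\cdots\lambda_n)=\mathcal L(\lambda_1)\cdots\mathcal L(\lambda_n)$. Put $\mathcal L^n=\mathcal L(E^n)$ for $n\geq 1$, $\mathcal L^{\ge1}=\bigcup_{n\ge1}\mathcal L^n$ and $\mathcal L^*=\mathcal L^{\ge1}\cup\{\omega\}$, with $\omega$ the empty word; $|\alpha|$ is the length of the word $\alpha$. For $\alpha=\alpha_1\cdots\alpha_n$ (letters $\alpha_i$), $\alpha_{1,k}=\alpha_1\cdots\alpha_k$,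 with $\alpha_{1,0}=\omega$. For $A\subseteq E^0$ and $\alpha\in\mathcal L^{\ge1}$, $r(A,\alpha)=\{r(\lambda)\mid \lambda \text{ a path},\ \mathcal L(\lambda)=\alpha,\ s(\lambda)\in A\}$; $r(A,\omega)=A$; $r(\alpha)=r(E^0,\alpha)$; $\mathcal L(AE^1)=\{\mathcal L(e)\mid e\in E^1,\ s(e)\in A\}$. Labelled spaces. A labelled space $(E,\mathcal L,\mathcal B)$ is a labelled graph with a family $\mathcal B$ of subsets of $E^0$ closed under finite intersections and finite unions, containing $r(\alpha)$ for all $\alpha\in\mathcal L^{\ge1}$, and such that $r(A,\alpha)\in\mathcal B$ for all $A\in\mathcal B$, $\alpha\in\mathcal L^*$. It is normal if it is weakly left-resolving, i.e. $r(A\cap B,\alpha)=r(A,\alpha)\cap r(B,\alpha)$ for all $A,B\in\mathcal B$, $\alpha\in\mathcal L^{\ge1}$, and $\mathcal B$ is closed under relative complements. A nonempty $A\in\mathcal B$ is regular if $0<|\mathcal L(BE^1)|<\infty$ for every nonempty $B\in\mathcal B$ with $B\subseteq A$; $\mathcal B_{\mathrm{reg}}$ is the set of regular elements together with $\emptyset$. For $\alpha\in\mathcal L^*$, $\mathcal B_\alpha=\{A\in\mathcal B\mid A\subseteq r(\alpha)\}$. The algebra. $L_K(E,\mathcal L,\mathcal B)$ (Leavitt labelled path algebra) is the universal (associative, not necessarily unital) $K$-algebra with generators $\{p_A\mid A\in\mathcal B\}$ and $\{s_a,s_a^*\mid a\in\mathcal A\}$ and relations: (i) $p_{A\cap B}=p_Ap_B$,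 $p_{A\cup B}=p_A+p_B-p_{A\cap B}$, $p_\emptyset=0$ for $A,B\in\mathcal B$; (ii) $p_As_a=s_ap_{r(A,a)}$ and $s_a^*p_A=p_{r(A,a)}s_a^*$ for $A\in\mathcal B$, $a\in\mathcal A$; (iii) $s_a^*s_a=p_{r(a)}$, and $s_b^*s_a=0$ if $b\ne a$; (iv) $s_as_a^*s_a=s_a$ and $s_a^*s_as_a^*=s_a^*$; (v) $p_A=\sum_{a\in\mathcal L(AE^1)}s_ap_{r(A,a)}s_a^*$ for every $A\in\mathcal B_{\mathrm{reg}}$. For $\alpha=a_1\cdots a_n\in\mathcal L^{\ge1}$, $s_\alpha=s_{a_1}\cdots s_{a_n}$ and $s_\alpha^i=(s_\alpha)^i$. Cycles. A pair $(\alpha,A)$ with $\alpha\in\mathcal L^{\ge1}$ and $A\in\mathcal B_\alpha$ is a cycle if $B\subseteq r(B,\alpha)$ for every $B\in\mathcal B_\alpha$ with $B\subseteq A$. A cycle $(\alpha,A)$ has an exit if there exist $0\le k\le|\alpha|$ and a nonempty $B\in\mathcal B$ such that $B\subseteq r(A,\alpha_{1,k})$ and $\mathcal L(BE^1)\ne\{\alpha_{k+1}\}$, where $\alpha_{|\alpha|+1}:=\alpha_1$. *)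

theory Defs
  imports "Graph_Theory.Arc_Walk" "HOL-Algebra.Module" "HOL-Library.Poly_Mapping"
begin

section \<open>Labelled spaces\<close>

text \<open>A directed graph is a \<^locale>\<open>wf_digraph\<close>, with source map \<^const>\<open>tail\<close> and range map
  \<^const>\<open>head\<close>. A path of length at least 1 with source \<open>u\<close> and range \<open>v\<close> is a nonempty \<open>p\<close> with
  \<open>pre_digraph.awalk E u p v\<close>; words are lists of letters, and \<open>\<omega>\<close> is \<open>[]\<close>. The labelling is required to
  be surjective onto its alphabet, so the alphabet is the set of labels of edges.\<close>

definition alphabet :: "('v, 'e) pre_digraph \<Rightarrow> ('e \<Rightarrow> 'l) \<Rightarrow> 'l set" where
  "alphabet E lab = lab ` arcs E"

definition labelled_words :: "('v, 'e) pre_digraph \<Rightarrow> ('e \<Rightarrow> 'l) \<Rightarrow> 'l list set" where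
  "labelled_words E lab = {map lab p | u p v. pre_digraph.awalk E u p v \<and> p \<noteq> []}"

definition rel_range :: "('v, 'e) pre_digraph \<Rightarrow> ('e \<Rightarrow> 'l) \<Rightarrow> 'v set \<Rightarrow> 'l list \<Rightarrow> 'v set" where
  "rel_range E lab A \<alpha> =
    (if \<alpha> = [] then A else {v. \<exists>u\<in>A. \<exists>p. pre_digraph.awalk E u p v \<and> map lab p = \<alpha>})"

definition word_range :: "('v, 'e) pre_digraph \<Rightarrow> ('e \<Rightarrow> 'l) \<Rightarrow> 'l list \<Rightarrow> 'v set" where
  "word_range E lab \<alpha> = rel_range E lab (verts E) \<alpha>"

definition out_labels :: "('v, 'e) pre_digraph \<Rightarrow> ('e \<Rightarrow> 'l) \<Rightarrow> 'v set \<Rightarrow> 'l set" where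
  "out_labels E lab A = {lab e | e. e \<in> arcs E \<and> tail E e \<in> A}"

locale labelled_graph = wf_digraph E for E :: "('v, 'e) pre_digraph" +
  fixes lab :: "'e \<Rightarrow> 'l"
  assumes verts_nonempty: "verts E \<noteq> {}"
    and alphabet_nonempty: "alphabet E lab \<noteq> {}"

locale labelled_space = labelled_graph E lab
  for E :: "('v, 'e) pre_digraph" and lab :: "'e \<Rightarrow> 'l" +
  fixes \<B> :: "'v set set"
  assumes family_subset: "\<And>A. A \<in> \<B> \<Longrightarrow> A \<subseteq> verts E"
    and family_Int: "\<And>A B. A \<in> \<B> \<Longrightarrow> B \<in> \<B> \<Longrightarrow> A \<inter> B \<in> \<B>"
    and family_Un: "\<And>A B. A \<in> \<B> \<Longrightarrow> B \<in> \<B> \<Longrightarrow> A \<union> B \<in> \<B>"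
    and family_word_range: "\<And>\<alpha>. \<alpha> \<in> labelled_words E lab \<Longrightarrow> word_range E lab \<alpha> \<in> \<B>"
    and family_rel_range:
      "\<And>A \<alpha>. A \<in> \<B> \<Longrightarrow> \<alpha> \<in> insert [] (labelled_words E lab) \<Longrightarrow> rel_range E lab A \<alpha> \<in> \<B>"

text \<open>Closure under relative complements puts \<open>{}\<close> into the family, which is nonempty because the
  alphabet is.\<close>

locale normal_labelled_space = labelled_space E lab \<B>
  for E :: "('v, 'e) pre_digraph" and lab :: "'e \<Rightarrow> 'l" and \<B> :: "'v set set" +
  assumes weakly_left_resolving:
      "\<And>A B \<alpha>. A \<in> \<B> \<Longrightarrow> B \<in> \<B> \<Longrightarrow> \<alpha> \<in> labelled_words E lab \<Longrightarrow>
        rel_range E lab (A \<inter> B) \<alpha> = rel_range E lab A \<alpha> \<inter> rel_range E lab B \<alpha>"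
    and family_Diff: "\<And>A B. A \<in> \<B> \<Longrightarrow> B \<in> \<B> \<Longrightarrow> A - B \<in> \<B>"

definition regular_set ::
    "('v, 'e) pre_digraph \<Rightarrow> ('e \<Rightarrow> 'l) \<Rightarrow> 'v set set \<Rightarrow> 'v set \<Rightarrow> bool" where
  "regular_set E lab \<B> A \<longleftrightarrow> A \<in> \<B> \<and> A \<noteq> {} \<and>
    (\<forall>B\<in>\<B>. B \<noteq> {} \<and> B \<subseteq> A \<longrightarrow> finite (out_labels E lab B) \<and> 0 < card (out_labels E lab B))"

definition regular_sets ::
    "('v, 'e) pre_digraph \<Rightarrow> ('e \<Rightarrow> 'l) \<Rightarrow> 'v set set \<Rightarrow> 'v set set" where
  "regular_sets E lab \<B> = insert {} {A. regular_set E lab \<B> A}"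

definition family_below ::
    "('v, 'e) pre_digraph \<Rightarrow> ('e \<Rightarrow> 'l) \<Rightarrow> 'v set set \<Rightarrow> 'l list \<Rightarrow> 'v set set" where
  "family_below E lab \<B> \<alpha> = {A \<in> \<B>. A \<subseteq> word_range E lab \<alpha>}"

definition labelled_cycle ::
    "('v, 'e) pre_digraph \<Rightarrow> ('e \<Rightarrow> 'l) \<Rightarrow> 'v set set \<Rightarrow> 'l list \<Rightarrow> 'v set \<Rightarrow> bool" where
  "labelled_cycle E lab \<B> \<alpha> A \<longleftrightarrow>
    \<alpha> \<in> labelled_words E lab \<and> A \<in> family_below E lab \<B> \<alpha> \<and>
    (\<forall>B \<in> family_below E lab \<B> \<alpha>. B \<subseteq> A \<longrightarrow> B \<subseteq> rel_range E lab B \<alpha>)"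

text \<open>List positions count from 0, so \<open>(\<alpha> @ [hd \<alpha>]) ! k\<close> is the letter \<open>\<alpha>\<^bsub>k+1\<^esub>\<close>, with the
  convention \<open>\<alpha>\<^bsub>|\<alpha>|+1\<^esub> = \<alpha>\<^sub>1\<close>.\<close>

definition has_exit ::
    "('v, 'e) pre_digraph \<Rightarrow> ('e \<Rightarrow> 'l) \<Rightarrow> 'v set set \<Rightarrow> 'l list \<Rightarrow> 'v set \<Rightarrow> bool" where
  "has_exit E lab \<B> \<alpha> A \<longleftrightarrow>
    (\<exists>k \<le> length \<alpha>. \<exists>B \<in> \<B>. B \<noteq> {} \<and> B \<subseteq> rel_range E lab A (take k \<alpha>) \<and>
      out_labels E lab B \<noteq> {(\<alpha> @ [hd \<alpha>]) ! k})"


section \<open>The free associative algebra\<close>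

text \<open>Words under concatenation, wrapped in a type of their own so that finitely supported functions
  on them carry the multiplication of \<^theory>\<open>HOL-Library.Poly_Mapping\<close>: the type
  \<open>'g free_word \<Rightarrow>\<^sub>0 'k\<close> is the free unital algebra on \<open>'g\<close>.\<close>

datatype 'g free_word = Word (letters: "'g list")

instantiation free_word :: (type) monoid_add
begin

definition zero_free_word :: "'a free_word" where
  "0 = Word []"

definition plus_free_word :: "'a free_word \<Rightarrow> 'a free_word \<Rightarrow> 'a free_word" where
  "v + w = Word (letters v @ letters w)"

instance
  by standard (simp_all add: zero_free_word_def plus_free_word_def)

end

definition scalar :: "'k::field \<Rightarrow> ('g free_word \<Rightarrow>\<^sub>0 'k) \<Rightarrow> ('g free_word \<Rightarrow>\<^sub>0 'k)" where
  "scalar k x = Poly_Mapping.single 0 k * x"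

definition generator :: "'g \<Rightarrow> ('g free_word \<Rightarrow>\<^sub>0 'k::field)" where
  "generator g = Poly_Mapping.single (Word [g]) 1"

text \<open>The free associative algebra without unit on a set \<open>G\<close> of generators: the empty word does not
  occur.\<close>

definition free_algebra :: "'g set \<Rightarrow> ('g free_word \<Rightarrow>\<^sub>0 'k::field) set" where
  "free_algebra G = {x. \<forall>w \<in> Poly_Mapping.keys x. letters w \<noteq> [] \<and> set (letters w) \<subseteq> G}"

text \<open>The two-sided ideal of \<^term>\<open>free_algebra G\<close>, as an algebra without unit, generated by a
  subset \<open>R\<close> of it.\<close>

inductive_set algebra_ideal ::
    "'g set \<Rightarrow> ('g free_word \<Rightarrow>\<^sub>0 'k::field) set \<Rightarrow> ('g free_word \<Rightarrow>\<^sub>0 'k) set"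
  for G :: "'g set" and R :: "('g free_word \<Rightarrow>\<^sub>0 'k) set" where
  zero: "0 \<in> algebra_ideal G R"
| incl: "x \<in> R \<Longrightarrow> x \<in> algebra_ideal G R"
| add: "x \<in> algebra_ideal G R \<Longrightarrow> y \<in> algebra_ideal G R \<Longrightarrow> x + y \<in> algebra_ideal G R"
| scale: "x \<in> algebra_ideal G R \<Longrightarrow> scalar k x \<in> algebra_ideal G R"
| mult_left: "x \<in> algebra_ideal G R \<Longrightarrow> y \<in> free_algebra G \<Longrightarrow> y * x \<in> algebra_ideal G R"
| mult_right: "x \<in> algebra_ideal G R \<Longrightarrow> y \<in> free_algebra G \<Longrightarrow> x * y \<in> algebra_ideal G R"

definition algebra_coset ::
    "'g set \<Rightarrow> ('g free_word \<Rightarrow>\<^sub>0 'k::field) set \<Rightarrow> ('g free_word \<Rightarrow>\<^sub>0 'k) \<Rightarrow> ('g free_word \<Rightarrow>\<^sub>0 'k) set" where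
  "algebra_coset G R x = {x + y | y. y \<in> algebra_ideal G R}"

text \<open>The \<open>K\<close>-algebra without unit presented by generators \<open>G\<close> and relators \<open>R\<close>: the quotient of
  the free algebra by the ideal, whose elements are cosets. The record type has a field for a unit;
  the algebra need not have one, so that field is left unspecified and must not be used (in
  particular, not through the power operation of HOL-Algebra).\<close>

definition presented_algebra ::
    "'g set \<Rightarrow> ('g free_word \<Rightarrow>\<^sub>0 'k::field) set \<Rightarrow> ('k, ('g free_word \<Rightarrow>\<^sub>0 'k) set) module" where
  "presented_algebra G R =
    \<lparr>carrier = algebra_coset G R ` free_algebra G,
     monoid.mult = (\<lambda>X Y. \<Union>x\<in>X. \<Union>y\<in>Y. algebra_coset G R (x * y)),
     one = undefined,
     ring.zero = algebra_coset G R 0,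
     add = (\<lambda>X Y. \<Union>x\<in>X. \<Union>y\<in>Y. algebra_coset G R (x + y)),
     smult = (\<lambda>k X. \<Union>x\<in>X. algebra_coset G R (scalar k x))\<rparr>"


section \<open>Leavitt labelled path algebras\<close>

datatype ('v, 'l) lpa_gen = Proj "'v set" | Edge 'l | Ghost 'l

definition lpa_gens ::
    "('v, 'e) pre_digraph \<Rightarrow> ('e \<Rightarrow> 'l) \<Rightarrow> 'v set set \<Rightarrow> ('v, 'l) lpa_gen set" where
  "lpa_gens E lab \<B> = Proj ` \<B> \<union> Edge ` alphabet E lab \<union> Ghost ` alphabet E lab"

text \<open>A relation \<open>x = y\<close> is recorded as the relator \<open>x - y\<close>; here \<open>p A\<close>, \<open>s a\<close>, \<open>t a\<close> are the free
  generators \<open>p\<^sub>A\<close>, \<open>s\<^sub>a\<close>, \<open>s\<^sub>a\<^sup>*\<close>.\<close>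

definition lpa_relators ::
    "('v, 'e) pre_digraph \<Rightarrow> ('e \<Rightarrow> 'l) \<Rightarrow> 'v set set \<Rightarrow> (('v, 'l) lpa_gen free_word \<Rightarrow>\<^sub>0 'k::field) set" where
  "lpa_relators E lab \<B> =
    (let p = (\<lambda>A. generator (Proj A)); s = (\<lambda>a. generator (Edge a)); t = (\<lambda>a. generator (Ghost a));
         r = (\<lambda>A a. rel_range E lab A [a]) in
      {p (A \<inter> B) - p A * p B | A B. A \<in> \<B> \<and> B \<in> \<B>}
    \<union> {p (A \<union> B) - (p A + p B - p (A \<inter> B)) | A B. A \<in> \<B> \<and> B \<in> \<B>}
    \<union> {p {}}
    \<union> {p A * s a - s a * p (r A a) | A a. A \<in> \<B> \<and> a \<in> alphabet E lab}
    \<union> {t a * p A - p (r A a) * t a | A a. A \<in> \<B> \<and> a \<in> alphabet E lab}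
    \<union> {t a * s a - p (word_range E lab [a]) | a. a \<in> alphabet E lab}
    \<union> {t b * s a | a b. a \<in> alphabet E lab \<and> b \<in> alphabet E lab \<and> b \<noteq> a}
    \<union> {s a * t a * s a - s a | a. a \<in> alphabet E lab}
    \<union> {t a * s a * t a - t a | a. a \<in> alphabet E lab}
    \<union> {p A - (\<Sum>a\<in>out_labels E lab A. s a * p (r A a) * t a) | A. A \<in> regular_sets E lab \<B>})"

definition leavitt_labelled_path_algebra ::
    "('v, 'e) pre_digraph \<Rightarrow> ('e \<Rightarrow> 'l) \<Rightarrow> 'v set set \<Rightarrow>
      ('k::field, (('v, 'l) lpa_gen free_word \<Rightarrow>\<^sub>0 'k) set) module" where
  "leavitt_labelled_path_algebra E lab \<B> =
    presented_algebra (lpa_gens E lab \<B>) (lpa_relators E lab \<B>)"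

definition lpa_elem ::
    "('v, 'e) pre_digraph \<Rightarrow> ('e \<Rightarrow> 'l) \<Rightarrow> 'v set set \<Rightarrow> ('v, 'l) lpa_gen \<Rightarrow>
      (('v, 'l) lpa_gen free_word \<Rightarrow>\<^sub>0 'k::field) set" where
  "lpa_elem E lab \<B> g =
    algebra_coset (lpa_gens E lab \<B>) (lpa_relators E lab \<B>) (generator g)"

abbreviation lpa_proj ::
    "('v, 'e) pre_digraph \<Rightarrow> ('e \<Rightarrow> 'l) \<Rightarrow> 'v set set \<Rightarrow> 'v set \<Rightarrow>
      (('v, 'l) lpa_gen free_word \<Rightarrow>\<^sub>0 'k::field) set" where
  "lpa_proj E lab \<B> A \<equiv> lpa_elem E lab \<B> (Proj A)"

text \<open>\<open>s\<^sub>\<alpha>\<close> for a nonempty word \<open>\<alpha>\<close>; there is no value at the empty word.\<close>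

fun lpa_word ::
    "('v, 'e) pre_digraph \<Rightarrow> ('e \<Rightarrow> 'l) \<Rightarrow> 'v set set \<Rightarrow> 'l list \<Rightarrow>
      (('v, 'l) lpa_gen free_word \<Rightarrow>\<^sub>0 'k::field) set" where
  "lpa_word E lab \<B> [a] = lpa_elem E lab \<B> (Edge a)"
| "lpa_word E lab \<B> (a # b # \<alpha>) =
    lpa_elem E lab \<B> (Edge a) \<otimes>\<^bsub>leavitt_labelled_path_algebra E lab \<B>\<^esub> lpa_word E lab \<B> (b # \<alpha>)"

text \<open>The power \<open>s\<^sub>c\<^sup>i\<close> as it is to be read next to \<open>p\<^sub>A\<close>, with \<open>s\<^sub>c\<^sup>0 = p\<^sub>A\<close>.\<close>

fun lpa_word_power ::
    "('v, 'e) pre_digraph \<Rightarrow> ('e \<Rightarrow> 'l) \<Rightarrow> 'v set set \<Rightarrow> 'l list \<Rightarrow> 'v set \<Rightarrow> nat \<Rightarrow>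
      (('v, 'l) lpa_gen free_word \<Rightarrow>\<^sub>0 'k::field) set" where
  "lpa_word_power E lab \<B> c A 0 = lpa_proj E lab \<B> A"
| "lpa_word_power E lab \<B> c A (Suc 0) = lpa_word E lab \<B> c"
| "lpa_word_power E lab \<B> c A (Suc (Suc i)) =
    lpa_word_power E lab \<B> c A (Suc i) \<otimes>\<^bsub>leavitt_labelled_path_algebra E lab \<B>\<^esub> lpa_word E lab \<B> c"

end

theory Submission
  imports Defs "HOL-Library.Sublist"
begin

text \<open>Write \<open>p\<^sub>A\<close>, \<open>s\<^sub>\<alpha>\<close>, \<open>s\<^sub>\<alpha>\<^sup>*\<close> for the generators and their products, and \<open>r(A,\<alpha>)\<close> for relative
  ranges. Every element of the algebra is a combination of monomials \<open>s\<^sub>\<alpha> p\<^sub>A s\<^sub>\<beta>\<^sup>*\<close>, and the proof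
  multiplies a nonzero \<open>x\<close> from both sides until one of the two shapes is left.

  First the ghosts \<open>s\<^sub>\<beta>\<^sup>*\<close> are removed (\<open>ghost_removal\<close>). As long as some \<open>x s\<^sub>a\<close> is nonzero, pass to it:
  this shortens the ghosts. If all \<open>x s\<^sub>a\<close> vanish, let \<open>x\<^sub>0\<close> be the ghost-free part of \<open>x\<close> and \<open>F\<close> the
  finite set of first letters of the ghosts. Then \<open>x = x\<^sub>0 (1 - \<Sum>\<^bsub>a\<in>F\<^esub> s\<^sub>a s\<^sub>a\<^sup>*)\<close>. On a suitable small
  \<open>B\<close> with \<open>x p\<^sub>B \<noteq> 0\<close> all edges leaving \<open>B\<close> have labels in \<open>F\<close>. If \<open>B\<close> were regular, the last
  defining relation would give \<open>x p\<^sub>B = 0\<close>; so some nonempty \<open>C \<subseteq> B\<close> emits no edge, and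
  \<open>x p\<^sub>C = x\<^sub>0 p\<^sub>C\<close> has no ghosts.

  Next, multiplying by \<open>s\<^sub>\<alpha>\<^sup>*\<close> for a shortest word \<open>\<alpha>\<close> that occurs yields a corner
  \<open>\<Sum>\<^bsub>\<beta>\<in>W\<^esub> \<kappa>\<^sub>\<beta> p\<^sub>B s\<^sub>\<beta> p\<^sub>B\<close> whose constant coefficient is nonzero. Among all corners that can be reached
  from \<open>x\<close> take one with the fewest terms. For nonempty \<open>C \<subseteq> r(B,u)\<close>, the compression
  \<open>y \<mapsto> p\<^sub>C s\<^sub>u\<^sup>* y s\<^sub>u p\<^sub>C\<close> turns the term of \<open>\<beta>\<close> into that of \<open>\<beta>'\<close> if \<open>\<beta>u = u\<beta>'\<close>, and kills it
  if there is no such \<open>\<beta>'\<close> or if \<open>C\<close> does not meet \<open>r(C,\<beta>')\<close>. Minimality forbids that anything is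
  killed (\<open>minimal_corner_rigid\<close>). With \<open>u\<close> empty this makes \<open>(\<beta>,B)\<close> a cycle for each nonempty \<open>\<beta>\<close>; with \<open>u\<close> a
  power of some \<open>\<beta>\<close> it says that the words in \<open>W\<close> commute, so they are powers of one word
  \<open>c\<close>; and with \<open>u\<close> running into a supposed exit it gives a contradiction. So the corner is a multiple of
  \<open>p\<^sub>B\<close> or a polynomial in a cycle without exit (\<open>rigid_family_cycle\<close>).

  What has to come from outside these computations is that corners are nonzero, in particular that
  \<open>p\<^sub>B \<noteq> 0\<close> for nonempty \<open>B\<close>. This is read off from a representation (\<open>corner_not_in_ideal\<close>).\<close>

section \<open>Free algebras and presented algebras\<close>

abbreviation const_poly :: "'k \<Rightarrow> ('g free_word \<Rightarrow>\<^sub>0 'k::field)" where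
  "const_poly k \<equiv> Poly_Mapping.single 0 k"

lemma poly_mapping_as_sum:
  "x = (\<Sum>w\<in>Poly_Mapping.keys x. Poly_Mapping.single w (Poly_Mapping.lookup x w))"
proof (rule poly_mapping_eqI)
  fix v
  have "Poly_Mapping.lookup (\<Sum>w\<in>Poly_Mapping.keys x. Poly_Mapping.single w (Poly_Mapping.lookup x w)) v
      = (\<Sum>w\<in>Poly_Mapping.keys x. if w = v then Poly_Mapping.lookup x v else 0)"
    by (auto simp: lookup_sum lookup_single when_def intro: sum.cong)
  also have "\<dots> = Poly_Mapping.lookup x v"
    by (auto simp: in_keys_iff)
  finally show "Poly_Mapping.lookup x v = Poly_Mapping.lookup
      (\<Sum>w\<in>Poly_Mapping.keys x. Poly_Mapping.single w (Poly_Mapping.lookup x w)) v" ..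
qed

lemma additive_sum:
  fixes \<phi> :: "'a::comm_monoid_add \<Rightarrow> 'b::ab_group_add"
  assumes "\<And>x y. \<phi> (x + y) = \<phi> x + \<phi> y"
  shows "\<phi> (sum f A) = (\<Sum>a\<in>A. \<phi> (f a))"
proof -
  have "\<phi> 0 + \<phi> 0 = \<phi> 0"
    using assms[of 0 0] by simp
  then have "\<phi> 0 = 0"
    by simp
  then show ?thesis
    by (induction A rule: infinite_finite_induct) (simp_all add: assms)
qed

text \<open>An additive map is determined by its values on multiples of words. Applied to each factor in turn,
  this reduces identities between products to products of words.\<close>

lemma additive_eqI:
  fixes \<phi> \<psi> :: "('a \<Rightarrow>\<^sub>0 'b::comm_monoid_add) \<Rightarrow> 'c::ab_group_add"
  assumes "\<And>x y. \<phi> (x + y) = \<phi> x + \<phi> y" and "\<And>x y. \<psi> (x + y) = \<psi> x + \<psi> y"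
    and "\<And>w k. \<phi> (Poly_Mapping.single w k) = \<psi> (Poly_Mapping.single w k)"
  shows "\<phi> x = \<psi> x"
  by (subst (1 2) poly_mapping_as_sum)
    (simp add: additive_sum[of \<phi>, OF assms(1)] additive_sum[of \<psi>, OF assms(2)] assms(3))

lemma const_poly_commute: "const_poly k * x = x * const_poly k"
  by (rule additive_eqI[of "\<lambda>x. const_poly k * x" "\<lambda>x. x * const_poly k"])
    (simp_all add: algebra_simps mult_single mult.commute)

text \<open>The retraction onto the subalgebra generated by \<open>G\<close> and the unit, killing the words with a
  letter outside \<open>G\<close>. It is a ring homomorphism, since a product of two words is a word over \<open>G\<close> iff
  both factors are.\<close>

definition restrict_gens :: "'g set \<Rightarrow> ('g free_word \<Rightarrow>\<^sub>0 'k::field) \<Rightarrow> ('g free_word \<Rightarrow>\<^sub>0 'k)" where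
  "restrict_gens G = Poly_Mapping.mapp (\<lambda>w k. if set (letters w) \<subseteq> G then k else 0)"

lemma lookup_restrict_gens:
  "Poly_Mapping.lookup (restrict_gens G x) w =
    (if set (letters w) \<subseteq> G then Poly_Mapping.lookup x w else 0)"
  by (auto simp: restrict_gens_def lookup_mapp in_keys_iff when_def)

lemma restrict_gens_simps [simp]:
  "restrict_gens G 0 = 0"
  "restrict_gens G (x + y) = restrict_gens G x + restrict_gens G y"
  "restrict_gens G (x - y) = restrict_gens G x - restrict_gens G y"
  "restrict_gens G (- x) = - restrict_gens G x"
  by (rule poly_mapping_eqI, simp add: lookup_restrict_gens lookup_add lookup_minus)+

lemma restrict_gens_single:
  "restrict_gens G (Poly_Mapping.single w k) =
    (if set (letters w) \<subseteq> G then Poly_Mapping.single w k else 0)"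
  by (rule poly_mapping_eqI) (auto simp: lookup_restrict_gens lookup_single when_def)

lemma restrict_gens_mult [simp]: "restrict_gens G (x * y) = restrict_gens G x * restrict_gens G y"
proof (rule additive_eqI[of "\<lambda>x. restrict_gens G (x * y)" "\<lambda>x. restrict_gens G x * restrict_gens G y"])
  fix w k
  show "restrict_gens G (Poly_Mapping.single w k * y) =
      restrict_gens G (Poly_Mapping.single w k) * restrict_gens G y"
    by (rule additive_eqI[of "\<lambda>y. restrict_gens G (Poly_Mapping.single w k * y)"
          "\<lambda>y. restrict_gens G (Poly_Mapping.single w k) * restrict_gens G y"])
      (simp_all add: algebra_simps mult_single restrict_gens_single plus_free_word_def)
qed (simp_all add: algebra_simps)

lemma keys_subset_restrict_gens:
  assumes "\<And>w. w \<in> Poly_Mapping.keys x \<Longrightarrow> set (letters w) \<subseteq> G"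
  shows "restrict_gens G x = x"
  by (rule poly_mapping_eqI) (use assms in \<open>auto simp: lookup_restrict_gens in_keys_iff\<close>)

lemma restrict_gens_free_algebra: "x \<in> free_algebra G \<Longrightarrow> restrict_gens G x = x"
  by (rule keys_subset_restrict_gens) (auto simp: free_algebra_def)

text \<open>The ideal is closed under products with \<^term>\<open>free_algebra G\<close> and under scalars. Every element
  in the image of the retraction is a sum of one of each, so the ideal absorbs it as well.\<close>

lemma restrict_gens_split:
  obtains k y where "restrict_gens G x = const_poly k + y" "y \<in> free_algebra G"
proof
  let ?k = "Poly_Mapping.lookup x 0"
  show "restrict_gens G x = const_poly ?k + (restrict_gens G x - const_poly ?k)"
    by simp
  show "restrict_gens G x - const_poly ?k \<in> free_algebra G"
    unfolding free_algebra_def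
  proof (intro CollectI ballI conjI)
    fix w assume w: "w \<in> Poly_Mapping.keys (restrict_gens G x - const_poly ?k)"
    then show "set (letters w) \<subseteq> G" "letters w \<noteq> []"
      by (cases w; auto simp: in_keys_iff lookup_minus lookup_restrict_gens lookup_single when_def
          zero_free_word_def split: if_splits)+
  qed
qed

lemma free_algebra_zero [simp]: "0 \<in> free_algebra G"
  by (simp add: free_algebra_def)

lemma free_algebra_add: "x \<in> free_algebra G \<Longrightarrow> y \<in> free_algebra G \<Longrightarrow> x + y \<in> free_algebra G"
  using keys_add[of x y] unfolding free_algebra_def by blast

lemma free_algebra_uminus: "x \<in> free_algebra G \<Longrightarrow> - x \<in> free_algebra G"
  unfolding free_algebra_def by (simp add: in_keys_iff)

lemma free_algebra_diff: "x \<in> free_algebra G \<Longrightarrow> y \<in> free_algebra G \<Longrightarrow> x - y \<in> free_algebra G"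
  using free_algebra_add[of x G "- y"] by (simp add: free_algebra_uminus)

lemma free_algebra_mult:
  assumes "x \<in> free_algebra G" "y \<in> free_algebra G"
  shows "x * y \<in> free_algebra G"
  unfolding free_algebra_def
proof (intro CollectI ballI)
  fix w assume "w \<in> Poly_Mapping.keys (x * y)"
  with keys_mult[of x y] obtain u v where "w = u + v" "u \<in> Poly_Mapping.keys x" "v \<in> Poly_Mapping.keys y"
    by blast
  with assms show "letters w \<noteq> [] \<and> set (letters w) \<subseteq> G"
    by (auto simp: free_algebra_def plus_free_word_def)
qed

lemma free_algebra_scalar:
  assumes "x \<in> free_algebra G"
  shows "scalar k x \<in> free_algebra G"
  unfolding free_algebra_def
proof (intro CollectI ballI)
  fix w assume "w \<in> Poly_Mapping.keys (scalar k x)"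
  then have "w \<in> Poly_Mapping.keys x"
    using keys_mult[of "const_poly k" x] by (auto simp: scalar_def split: if_splits)
  with assms show "letters w \<noteq> [] \<and> set (letters w) \<subseteq> G"
    by (auto simp: free_algebra_def)
qed

lemma free_algebra_sum: "(\<And>i. i \<in> I \<Longrightarrow> f i \<in> free_algebra G) \<Longrightarrow> sum f I \<in> free_algebra G"
  by (induction I rule: infinite_finite_induct) (auto intro: free_algebra_add)

lemma free_algebra_generator [simp]: "generator g \<in> free_algebra G \<longleftrightarrow> g \<in> G"
  by (simp add: free_algebra_def generator_def)

lemma ideal_subset_free_algebra:
  assumes "R \<subseteq> free_algebra G" "x \<in> algebra_ideal G R"
  shows "x \<in> free_algebra G"
  using assms(2) by induction
    (use assms(1) in \<open>auto intro: free_algebra_add free_algebra_mult free_algebra_scalar\<close>)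

lemma ideal_uminus:
  assumes "x \<in> algebra_ideal G R" shows "- x \<in> algebra_ideal G R"
proof -
  have "scalar (- 1) x = - x"
    by (simp add: scalar_def single_uminus)
  then show ?thesis
    using algebra_ideal.scale[OF assms, of "- 1"] by simp
qed

lemma ideal_diff: "x \<in> algebra_ideal G R \<Longrightarrow> y \<in> algebra_ideal G R \<Longrightarrow> x - y \<in> algebra_ideal G R"
  using algebra_ideal.add[of x G R "- y"] by (simp add: ideal_uminus)

lemma ideal_restrict_mult:
  assumes "x \<in> algebra_ideal G R"
  shows "restrict_gens G y * x \<in> algebra_ideal G R" "x * restrict_gens G y \<in> algebra_ideal G R"
proof -
  obtain k z where "restrict_gens G y = const_poly k + z" "z \<in> free_algebra G"
    using restrict_gens_split by blast
  moreover have "const_poly k * x \<in> algebra_ideal G R"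
    using algebra_ideal.scale[OF assms] by (simp add: scalar_def)
  ultimately show "restrict_gens G y * x \<in> algebra_ideal G R" "x * restrict_gens G y \<in> algebra_ideal G R"
    using assms by (auto simp: distrib_left distrib_right const_poly_commute[symmetric]
        intro: algebra_ideal.intros)
qed

text \<open>Congruence modulo the presentation, extended to the whole free unital algebra along the retraction
  so that it is compatible with all products, not only with those in \<^term>\<open>free_algebra G\<close>.\<close>

definition pres_cong :: "'g set \<Rightarrow> ('g free_word \<Rightarrow>\<^sub>0 'k::field) set \<Rightarrow>
    ('g free_word \<Rightarrow>\<^sub>0 'k) \<Rightarrow> ('g free_word \<Rightarrow>\<^sub>0 'k) \<Rightarrow> bool" where
  "pres_cong G R x y \<longleftrightarrow> restrict_gens G (x - y) \<in> algebra_ideal G R"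

lemma pres_cong_refl [simp]: "pres_cong G R x x"
  by (simp add: pres_cong_def algebra_ideal.zero)

lemma pres_cong_sym: "pres_cong G R x y \<Longrightarrow> pres_cong G R y x"
  using ideal_uminus unfolding pres_cong_def by (metis minus_diff_eq restrict_gens_simps(4))

lemma pres_cong_trans: "pres_cong G R x y \<Longrightarrow> pres_cong G R y z \<Longrightarrow> pres_cong G R x z"
  using algebra_ideal.add unfolding pres_cong_def by fastforce

lemma pres_cong_add:
  assumes "pres_cong G R x x'" "pres_cong G R y y'"
  shows "pres_cong G R (x + y) (x' + y')"
  using algebra_ideal.add[OF assms[unfolded pres_cong_def]] unfolding pres_cong_def
  by (simp add: algebra_simps)

lemma pres_cong_diff:
  assumes "pres_cong G R x x'" "pres_cong G R y y'"
  shows "pres_cong G R (x - y) (x' - y')"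
  using ideal_diff[OF assms[unfolded pres_cong_def]] unfolding pres_cong_def
  by (simp add: algebra_simps)

lemma pres_cong_sum: "(\<And>i. i \<in> I \<Longrightarrow> pres_cong G R (f i) (g i)) \<Longrightarrow> pres_cong G R (sum f I) (sum g I)"
  by (induction I rule: infinite_finite_induct) (auto intro: pres_cong_add)

lemma pres_cong_mult:
  assumes "pres_cong G R x x'" "pres_cong G R y y'"
  shows "pres_cong G R (x * y) (x' * y')"
proof -
  have "pres_cong G R (x * y) (x' * y)"
    using ideal_restrict_mult(2)[OF assms(1)[unfolded pres_cong_def], of y]
    by (simp add: pres_cong_def algebra_simps)
  moreover have "pres_cong G R (x' * y) (x' * y')"
    using ideal_restrict_mult(1)[OF assms(2)[unfolded pres_cong_def], of x']
    by (simp add: pres_cong_def algebra_simps)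
  ultimately show ?thesis
    by (rule pres_cong_trans)
qed

lemma pres_cong_relator:
  assumes "x - y \<in> R" "R \<subseteq> free_algebra G"
  shows "pres_cong G R x y"
  unfolding pres_cong_def using assms
  by (subst restrict_gens_free_algebra) (auto intro: algebra_ideal.incl)

lemma coset_eq_iff:
  assumes "x \<in> free_algebra G" "y \<in> free_algebra G"
  shows "algebra_coset G R x = algebra_coset G R y \<longleftrightarrow> pres_cong G R x y"
proof -
  have rxy: "restrict_gens G (x - y) = x - y"
    by (intro restrict_gens_free_algebra free_algebra_diff assms)
  show ?thesis
  proof
    assume "algebra_coset G R x = algebra_coset G R y"
    moreover have "x \<in> algebra_coset G R x"
      unfolding algebra_coset_def using algebra_ideal.zero by force
    ultimately show "pres_cong G R x y"
      by (auto simp: algebra_coset_def pres_cong_def rxy simp del: restrict_gens_simps)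
  next
    assume "pres_cong G R x y"
    then have i: "x - y \<in> algebra_ideal G R"
      by (simp add: pres_cong_def rxy del: restrict_gens_simps)
    show "algebra_coset G R x = algebra_coset G R y"
    proof (intro subset_antisym subsetI)
      fix u assume "u \<in> algebra_coset G R x"
      then obtain z where z: "u = x + z" "z \<in> algebra_ideal G R"
        by (auto simp: algebra_coset_def)
      have "u = y + (x - y + z)" "x - y + z \<in> algebra_ideal G R"
        using z algebra_ideal.add[OF i z(2)] by simp_all
      then show "u \<in> algebra_coset G R y"
        unfolding algebra_coset_def by blast
    next
      fix u assume "u \<in> algebra_coset G R y"
      then obtain z where z: "u = y + z" "z \<in> algebra_ideal G R"
        by (auto simp: algebra_coset_def)
      have "u = x + (z - (x - y))" "z - (x - y) \<in> algebra_ideal G R"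
        using z ideal_diff[OF z(2) i] by simp_all
      then show "u \<in> algebra_coset G R x"
        unfolding algebra_coset_def by blast
    qed
  qed
qed

locale presentation =
  fixes G :: "'g set" and R :: "('g free_word \<Rightarrow>\<^sub>0 'k::field) set"
  assumes relators: "R \<subseteq> free_algebra G"
begin

abbreviation "Q \<equiv> presented_algebra G R"

abbreviation "cl \<equiv> algebra_coset G R"

lemma coset_memD:
  assumes "y \<in> cl x" "x \<in> free_algebra G"
  shows "y \<in> free_algebra G" "pres_cong G R y x"
  using assms ideal_subset_free_algebra[OF relators]
  by (auto simp: algebra_coset_def pres_cong_def restrict_gens_free_algebra intro: free_algebra_add)

lemma coset_self: "x \<in> cl x"
  unfolding algebra_coset_def using algebra_ideal.zero by force

lemma carrier_presented: "carrier Q = cl ` free_algebra G"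
  by (simp add: presented_algebra_def)

lemma zero_presented: "\<zero>\<^bsub>Q\<^esub> = cl 0"
  by (simp add: presented_algebra_def)

text \<open>The operations of the presented algebra are unions over all representatives. They are well defined,
  so the union has one member.\<close>

lemma Union_cosets:
  assumes "x \<in> free_algebra G" and "\<And>x'. x' \<in> cl x \<Longrightarrow> x' \<in> free_algebra G \<Longrightarrow> pres_cong G R x' x \<Longrightarrow> h x' = C"
  shows "(\<Union>x'\<in>cl x. h x') = C"
proof -
  have "h x' = C" if "x' \<in> cl x" for x'
    using assms(2) coset_memD[OF that assms(1)] that by blast
  then show ?thesis
    using coset_self by blast
qed

lemma mult_presented:
  assumes "x \<in> free_algebra G" "y \<in> free_algebra G"
  shows "cl x \<otimes>\<^bsub>Q\<^esub> cl y = cl (x * y)"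
proof -
  have "(\<Union>x'\<in>cl x. \<Union>y'\<in>cl y. cl (x' * y')) = cl (x * y)"
    using assms by (intro Union_cosets) (simp_all add: coset_eq_iff free_algebra_mult pres_cong_mult)
  then show ?thesis
    by (simp add: presented_algebra_def)
qed

lemma add_presented:
  assumes "x \<in> free_algebra G" "y \<in> free_algebra G"
  shows "cl x \<oplus>\<^bsub>Q\<^esub> cl y = cl (x + y)"
proof -
  have "(\<Union>x'\<in>cl x. \<Union>y'\<in>cl y. cl (x' + y')) = cl (x + y)"
    using assms by (intro Union_cosets) (simp_all add: coset_eq_iff free_algebra_add pres_cong_add)
  then show ?thesis
    by (simp add: presented_algebra_def)
qed

lemma smult_presented:
  assumes "x \<in> free_algebra G"
  shows "k \<odot>\<^bsub>Q\<^esub> cl x = cl (const_poly k * x)"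
proof -
  have "pres_cong G R (scalar k x') (scalar k x)" if "pres_cong G R x' x" for x'
    unfolding scalar_def by (intro pres_cong_mult that pres_cong_refl)
  then have "(\<Union>x'\<in>cl x. cl (scalar k x')) = cl (scalar k x)"
    using assms by (intro Union_cosets) (auto simp: coset_eq_iff free_algebra_scalar)
  then show ?thesis
    by (simp add: presented_algebra_def scalar_def)
qed

lemma abelian_monoid_presented: "abelian_monoid Q"
proof (rule abelian_monoidI)
  show "x \<oplus>\<^bsub>Q\<^esub> y = y \<oplus>\<^bsub>Q\<^esub> x" if "x \<in> carrier Q" "y \<in> carrier Q" for x y
    using that by (auto simp: carrier_presented add_presented add.commute[where 'a = "'g free_word \<Rightarrow>\<^sub>0 'k"])
qed (auto simp: carrier_presented zero_presented add_presented free_algebra_add add.assoc)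

lemma finsum_presented:
  assumes "\<And>i. f i \<in> free_algebra G"
  shows "(\<Oplus>\<^bsub>Q\<^esub>i\<in>{0..n::nat}. cl (f i)) = cl (\<Sum>i=0..n. f i)"
proof -
  interpret abelian_monoid Q
    by (rule abelian_monoid_presented)
  have "(\<Oplus>\<^bsub>Q\<^esub>i\<in>{..n}. cl (f i)) = cl (\<Sum>i\<le>n. f i)"
    using assms by (induction n)
      (auto simp: carrier_presented finsum_Suc add_presented free_algebra_sum add.commute)
  then show ?thesis
    by (simp add: atLeast0AtMost)
qed

end

section \<open>Words commuting with a given word\<close>

lemma commute_power: "x @ y = y @ x \<Longrightarrow> x @ concat (replicate n y) = concat (replicate n y) @ x"
  by (induction n) (simp_all, metis append_assoc)

lemma length_concat_replicate: "length (concat (replicate n y)) = n * length y"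
  by (induction n) simp_all

text \<open>Words commuting with \<open>y\<close> are suffixes of large powers of \<open>y\<close>, hence of each other. Splitting off the
  shorter one is the Euclidean step which shows that all of them are powers of the shortest.\<close>

lemma commuting_suffix:
  assumes "x @ y = y @ x" "x' @ y = y @ x'" "y \<noteq> []" "length x \<le> length x'"
  obtains z where "x' = z @ x" "z @ y = y @ z"
proof -
  define v where "v = concat (replicate (length x') y)"
  have "length x' * 1 \<le> length x' * length y"
    using assms(3) by (intro mult_le_mono) (auto simp: Suc_le_eq)
  then have len: "length x' \<le> length v"
    by (simp add: v_def length_concat_replicate)
  have "suffix w v" if "w @ y = y @ w" "length w \<le> length v" for w
    using suffix_length_suffix[of w "v @ w" v] commute_power[OF that(1), of "length x'"] that(2)
    by (metis suffixI v_def)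
  then have "suffix x v" "suffix x' v"
    using assms len by auto
  then obtain z where z: "x' = z @ x"
    using suffix_length_suffix[OF _ _ assms(4)] by (auto simp: suffix_def)
  have "z @ y @ x = y @ z @ x"
    using assms(1,2) by (simp add: z)
  then have "z @ y = y @ z"
    by (metis append_assoc append_same_eq)
  with z show thesis
    by (rule that)
qed

text \<open>If \<open>x y\<^sup>n\<close> begins with \<open>y\<^sup>n\<close> for large \<open>n\<close>, then \<open>x\<close> is a prefix of a power of \<open>y\<close>; so \<open>x y\<close> and
  \<open>y x\<close> are prefixes of the same word, of the same length.\<close>

lemma commute_if_shift_powers:
  assumes "\<And>n. \<exists>x'. x @ concat (replicate n y) = concat (replicate n y) @ x'" "y \<noteq> []"
  shows "x @ y = y @ x"
proof -
  define v where "v = concat (replicate (length x) y)"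
  have "length x * 1 \<le> length x * length y"
    using assms(2) by (intro mult_le_mono) (auto simp: Suc_le_eq)
  then have len: "length x \<le> length v"
    by (simp add: v_def length_concat_replicate)
  have yv: "y @ v = v @ y"
    unfolding v_def by (rule commute_power) simp
  obtain x' where x': "x @ y @ v = y @ v @ x'"
    using assms(1)[of "Suc (length x)"] by (auto simp: v_def)
  then have "x @ (y @ v) = v @ (y @ x')"
    using yv by (metis append_assoc)
  then have "take (length x) (x @ (y @ v)) = take (length x) (v @ (y @ x'))"
    by simp
  then have "x = take (length x) v"
    using len by simp
  then obtain v' where v': "v = x @ v'"
    by (metis append_take_drop_id)
  have "(x @ y) @ v = (y @ x) @ (v' @ x')"
    using x' by (simp add: v')
  then show ?thesis
    by (metis add.commute append_eq_append_conv length_append)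
qed

section \<open>Relative ranges in labelled spaces\<close>

context labelled_graph
begin

abbreviation rel :: "'v set \<Rightarrow> 'l list \<Rightarrow> 'v set" where
  "rel \<equiv> rel_range E lab"

abbreviation ran :: "'l list \<Rightarrow> 'v set" where
  "ran \<equiv> word_range E lab"

abbreviation over_alphabet :: "'l list \<Rightarrow> bool" where
  "over_alphabet \<alpha> \<equiv> set \<alpha> \<subseteq> alphabet E lab"

lemma rel_Nil [simp]: "rel A [] = A"
  by (simp add: rel_range_def)

lemma ran_Nil [simp]: "ran [] = verts E"
  by (simp add: word_range_def)

lemma rel_eq:
  "A \<subseteq> verts E \<Longrightarrow> rel A \<alpha> = {v. \<exists>u\<in>A. \<exists>p. awalk u p v \<and> map lab p = \<alpha>}"
  by (auto simp: rel_range_def awalk_Nil_iff)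

lemma rel_subset_verts: "A \<subseteq> verts E \<Longrightarrow> rel A \<alpha> \<subseteq> verts E"
  by (auto simp: rel_eq dest: awalk_last_in_verts)

lemma rel_append:
  assumes "A \<subseteq> verts E"
  shows "rel A (\<alpha> @ \<beta>) = rel (rel A \<alpha>) \<beta>"
proof -
  have "awalk u (p @ q) v \<longleftrightarrow> (\<exists>w. awalk u p w \<and> awalk w q v)" for u p q v
    by (auto simp: awalk_append_iff)
  then have "(\<exists>p. awalk u p v \<and> map lab p = \<alpha> @ \<beta>) \<longleftrightarrow>
      (\<exists>w. (\<exists>p. awalk u p w \<and> map lab p = \<alpha>) \<and> (\<exists>q. awalk w q v \<and> map lab q = \<beta>))" for u v
    unfolding map_eq_append_conv by blast
  then show ?thesis
    by (subst (1 2) rel_eq) (auto simp: rel_eq[OF assms] rel_subset_verts[OF assms] assms)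
qed

lemma rel_Cons: "A \<subseteq> verts E \<Longrightarrow> rel A (a # \<beta>) = rel (rel A [a]) \<beta>"
  using rel_append[of A "[a]" \<beta>] by simp

lemma ran_append: "ran (\<alpha> @ \<beta>) = rel (ran \<alpha>) \<beta>"
  by (simp add: word_range_def rel_append)

lemma ran_Cons: "ran (a # \<beta>) = rel (ran [a]) \<beta>"
  using ran_append[of "[a]" \<beta>] by simp

lemma rel_empty [simp]: "rel {} \<alpha> = {}"
  by (simp add: rel_range_def)

lemma rel_Un: "rel (A \<union> B) \<alpha> = rel A \<alpha> \<union> rel B \<alpha>"
  by (auto simp: rel_range_def)

lemma rel_mono: "A \<subseteq> B \<Longrightarrow> rel A \<alpha> \<subseteq> rel B \<alpha>"
  by (auto simp: rel_range_def)

lemma rel_subset_ran: "A \<subseteq> verts E \<Longrightarrow> rel A \<alpha> \<subseteq> ran \<alpha>"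
  unfolding word_range_def by (rule rel_mono)

lemma ran_append_subset: "ran (\<alpha> @ \<beta>) \<subseteq> ran \<beta>"
  unfolding ran_append word_range_def[of _ _ \<beta>]
  by (rule rel_mono) (simp add: word_range_def rel_subset_verts)

lemma rel_nonempty_word: "rel A \<alpha> \<noteq> {} \<Longrightarrow> \<alpha> \<noteq> [] \<Longrightarrow> \<alpha> \<in> labelled_words E lab"
  by (auto simp: rel_range_def labelled_words_def)

lemma rel_nonempty_over: "rel A \<alpha> \<noteq> {} \<Longrightarrow> over_alphabet \<alpha>"
  by (cases "\<alpha> = []") (fastforce simp: rel_range_def alphabet_def awalk_def)+

lemma out_labels_iff: "a \<in> out_labels E lab A \<longleftrightarrow> rel A [a] \<noteq> {}"
proof
  assume "a \<in> out_labels E lab A"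
  then obtain e where "e \<in> arcs E" "tail E e \<in> A" "lab e = a"
    by (auto simp: out_labels_def)
  then have "awalk (tail E e) [e] (head E e)" "map lab [e] = [a]"
    by (simp_all add: awalk_def)
  then show "rel A [a] \<noteq> {}"
    using \<open>tail E e \<in> A\<close> \<open>lab e = a\<close>
    by (auto simp: rel_range_def intro!: exI[of _ "head E e"] bexI[of _ "tail E e"] exI[of _ "[e]"])
next
  assume "rel A [a] \<noteq> {}"
  then show "a \<in> out_labels E lab A"
    by (auto simp: rel_range_def out_labels_def awalk_def map_eq_Cons_conv)
qed

lemma out_labels_mono: "A \<subseteq> B \<Longrightarrow> out_labels E lab A \<subseteq> out_labels E lab B"
  by (auto simp: out_labels_def)

lemma out_labels_subset_alphabet: "out_labels E lab A \<subseteq> alphabet E lab"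
  by (auto simp: out_labels_def alphabet_def)

end

context normal_labelled_space
begin

lemma family_empty [simp]: "{} \<in> \<B>"
proof -
  obtain e where "e \<in> arcs E"
    using alphabet_nonempty by (auto simp: alphabet_def)
  then have "head E e \<in> ran [lab e]"
    using rel_eq[of "verts E" "[lab e]"]
    by (auto simp: word_range_def awalk_def intro!: bexI[of _ "tail E e"] exI[of _ "[e]"])
  then have "[lab e] \<in> labelled_words E lab"
    using rel_nonempty_word[of "verts E" "[lab e]"] by (auto simp: word_range_def)
  from family_Diff[OF family_word_range[OF this] family_word_range[OF this]] show ?thesis
    by simp
qed

text \<open>A word that labels no path has empty relative ranges, and those belong to the family too.\<close>

lemma rel_family [simp]: "A \<in> \<B> \<Longrightarrow> rel A \<alpha> \<in> \<B>"
proof (cases "\<alpha> = [] \<or> rel A \<alpha> = {}")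
  case False
  then show ?thesis if "A \<in> \<B>"
    using that rel_nonempty_word family_rel_range by blast
qed auto

lemma ran_family [simp]: "\<alpha> \<noteq> [] \<Longrightarrow> ran \<alpha> \<in> \<B>"
  using rel_nonempty_word[of "verts E" \<alpha>] family_word_range[of \<alpha>]
  by (cases "ran \<alpha> = {}") (auto simp: word_range_def)

lemma Int_ran_family [simp]: "A \<in> \<B> \<Longrightarrow> A \<inter> ran \<alpha> \<in> \<B>"
  using family_subset[of A] by (cases "\<alpha> = []") (auto intro: family_Int simp: Int_absorb2)

lemma rel_Int:
  assumes "A \<in> \<B>" "B \<in> \<B>"
  shows "rel (A \<inter> B) \<alpha> = rel A \<alpha> \<inter> rel B \<alpha>"
proof (cases "\<alpha> \<in> labelled_words E lab")
  case True
  then show ?thesis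
    by (rule weakly_left_resolving[OF assms])
next
  case False
  then show ?thesis
    using rel_nonempty_word by (cases "\<alpha> = []") auto
qed

lemma regular_sets_family: "A \<in> regular_sets E lab \<B> \<Longrightarrow> A \<in> \<B>"
  by (auto simp: regular_sets_def regular_set_def)

lemma regular_sets_iff:
  "A \<in> regular_sets E lab \<B> \<longleftrightarrow> A \<in> \<B> \<and>
    (\<forall>B\<in>\<B>. B \<noteq> {} \<and> B \<subseteq> A \<longrightarrow> finite (out_labels E lab B) \<and> out_labels E lab B \<noteq> {})"
  by (auto simp: regular_sets_def regular_set_def card_gt_0_iff)

lemma regular_sets_subset:
  "A \<in> regular_sets E lab \<B> \<Longrightarrow> B \<in> \<B> \<Longrightarrow> B \<subseteq> A \<Longrightarrow> B \<in> regular_sets E lab \<B>"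
  unfolding regular_sets_iff by blast

lemma regular_sets_Un:
  assumes "A \<in> regular_sets E lab \<B>" "B \<in> regular_sets E lab \<B>"
  shows "A \<union> B \<in> regular_sets E lab \<B>"
  unfolding regular_sets_iff
proof (intro conjI ballI impI)
  show "A \<union> B \<in> \<B>"
    using assms by (simp add: family_Un regular_sets_family)
  fix C assume C: "C \<in> \<B>" "C \<noteq> {} \<and> C \<subseteq> A \<union> B"
  have CA: "C \<inter> A \<in> \<B>" "C \<inter> B \<in> \<B>"
    using C assms by (simp_all add: family_Int regular_sets_family)
  have fin: "finite (out_labels E lab (C \<inter> D))" "out_labels E lab (C \<inter> D) \<noteq> {} \<or> C \<inter> D = {}"
    if "D \<in> regular_sets E lab \<B>" "C \<inter> D \<in> \<B>" for D
  proof -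
    have "C \<inter> D = {} \<or> finite (out_labels E lab (C \<inter> D)) \<and> out_labels E lab (C \<inter> D) \<noteq> {}"
      using bspec[OF conjunct2[OF that(1)[unfolded regular_sets_iff]] that(2)] by blast
    then show "finite (out_labels E lab (C \<inter> D))" "out_labels E lab (C \<inter> D) \<noteq> {} \<or> C \<inter> D = {}"
      by (cases "C \<inter> D = {}"; simp add: out_labels_def)+
  qed
  have "out_labels E lab C = out_labels E lab (C \<inter> A) \<union> out_labels E lab (C \<inter> B)"
    using C by (auto simp: out_labels_def)
  then show "finite (out_labels E lab C)" "out_labels E lab C \<noteq> {}"
    using fin[OF assms(1)] fin[OF assms(2)] CA C by auto
qed

lemma regular_sets_Union:
  assumes "finite I" "\<And>i. i \<in> I \<Longrightarrow> \<exists>R \<in> regular_sets E lab \<B>. S i \<subseteq> R"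
  shows "\<exists>R \<in> regular_sets E lab \<B>. (\<Union>i\<in>I. S i) \<subseteq> R"
  using assms
proof (induction I)
  case empty
  then show ?case
    by (auto simp: regular_sets_def)
next
  case (insert i I)
  then obtain R R' where "R \<in> regular_sets E lab \<B>" "S i \<subseteq> R" "R' \<in> regular_sets E lab \<B>" "(\<Union>i\<in>I. S i) \<subseteq> R'"
    by auto metis
  then show ?case
    using regular_sets_Un[of R R'] by (intro bexI[of _ "R \<union> R'"]) auto
qed

end

section \<open>A representation in which projections survive\<close>

fun value_at :: "('q \<Rightarrow> 'k::field) \<Rightarrow> 'q option \<Rightarrow> 'k" where
  "value_at f None = 0"
| "value_at f (Some q) = f q"

fun word_move :: "('g \<Rightarrow> 'q \<Rightarrow> 'q option) \<Rightarrow> 'g list \<Rightarrow> 'q \<Rightarrow> 'q option" where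
  "word_move \<tau> [] q = Some q"
| "word_move \<tau> (g # w) q = Option.bind (\<tau> g q) (word_move \<tau> w)"

text \<open>The free algebra acts on functions on a set of points when each generator moves points by a partial
  map: the generator sends \<open>f\<close> to its composition with that map, extended by 0. The first letter of
  a word is the outermost operator and therefore moves the point first.\<close>

definition act :: "('g \<Rightarrow> 'q \<Rightarrow> 'q option) \<Rightarrow> ('g free_word \<Rightarrow>\<^sub>0 'k::field) \<Rightarrow> ('q \<Rightarrow> 'k) \<Rightarrow> 'q \<Rightarrow> 'k" where
  "act \<tau> x f q = (\<Sum>w\<in>Poly_Mapping.keys x. Poly_Mapping.lookup x w * value_at f (word_move \<tau> (letters w) q))"

lemma act_superset:
  assumes "finite W" "Poly_Mapping.keys x \<subseteq> W"
  shows "act \<tau> x f q = (\<Sum>w\<in>W. Poly_Mapping.lookup x w * value_at f (word_move \<tau> (letters w) q))"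
  unfolding act_def by (rule sum.mono_neutral_left) (use assms in \<open>auto simp: in_keys_iff\<close>)

lemma act_add: "act \<tau> (x + y) f q = act \<tau> x f q + act \<tau> y f q"
proof -
  let ?W = "Poly_Mapping.keys x \<union> Poly_Mapping.keys y"
  have "finite ?W" "Poly_Mapping.keys (x + y) \<subseteq> ?W"
    using keys_add[of x y] by auto
  then show ?thesis
    by (simp add: act_superset[of ?W] lookup_add distrib_right sum.distrib)
qed

lemma act_zero [simp]: "act \<tau> 0 f q = 0"
  by (simp add: act_def)

lemma act_uminus: "act \<tau> (- x) f q = - act \<tau> x f q"
  using act_add[of \<tau> x "- x" f q] by (simp add: add_eq_0_iff)

lemma act_diff: "act \<tau> (x - y) f q = act \<tau> x f q - act \<tau> y f q"
  using act_add[of \<tau> x "- y" f q] by (simp add: act_uminus)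

lemma act_sum: "act \<tau> (sum h I) f q = (\<Sum>i\<in>I. act \<tau> (h i) f q)"
  by (rule additive_sum[of "\<lambda>x. act \<tau> x f q"]) (rule act_add)

lemma act_single: "act \<tau> (Poly_Mapping.single w k) f q = k * value_at f (word_move \<tau> (letters w) q)"
  by (simp add: act_def)

lemma act_one [simp]: "act \<tau> 1 f = f"
proof
  fix q
  have "act \<tau> (Poly_Mapping.single 0 1) f q = f q"
    by (subst act_single) (simp add: zero_free_word_def)
  then show "act \<tau> 1 f q = f q"
    by simp
qed

lemma act_generator: "act \<tau> (generator g) f q = value_at f (\<tau> g q)"
  by (cases "\<tau> g q") (simp_all add: generator_def act_single)

lemma word_move_append: "word_move \<tau> (u @ v) q = Option.bind (word_move \<tau> u q) (word_move \<tau> v)"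
  by (induction u arbitrary: q) (auto split: bind_split)

lemma act_mult: "act \<tau> (x * y) f q = act \<tau> x (act \<tau> y f) q"
proof (rule additive_eqI[of "\<lambda>x. act \<tau> (x * y) f q" "\<lambda>x. act \<tau> x (act \<tau> y f) q"])
  fix w k
  show "act \<tau> (Poly_Mapping.single w k * y) f q = act \<tau> (Poly_Mapping.single w k) (act \<tau> y f) q"
  proof (rule additive_eqI[of "\<lambda>y. act \<tau> (Poly_Mapping.single w k * y) f q"
        "\<lambda>y. act \<tau> (Poly_Mapping.single w k) (act \<tau> y f) q"])
    fix y z
    show "act \<tau> (Poly_Mapping.single w k * (y + z)) f q =
        act \<tau> (Poly_Mapping.single w k * y) f q + act \<tau> (Poly_Mapping.single w k * z) f q"
      by (simp add: distrib_left act_add)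
    show "act \<tau> (Poly_Mapping.single w k) (act \<tau> (y + z) f) q =
        act \<tau> (Poly_Mapping.single w k) (act \<tau> y f) q + act \<tau> (Poly_Mapping.single w k) (act \<tau> z f) q"
      by (cases "word_move \<tau> (letters w) q") (simp_all add: act_single act_add distrib_left)
  next
    fix v l
    show "act \<tau> (Poly_Mapping.single w k * Poly_Mapping.single v l) f q =
        act \<tau> (Poly_Mapping.single w k) (act \<tau> (Poly_Mapping.single v l) f) q"
      by (cases "word_move \<tau> (letters w) q")
        (simp_all add: mult_single act_single plus_free_word_def word_move_append)
  qed
qed (simp_all add: distrib_right act_add)

lemma act_const: "act \<tau> (const_poly k) f q = k * f q"
  by (simp add: act_single zero_free_word_def)

text \<open>The parameter \<open>K\<close> carries no data. It fixes the type of scalars, so that formulas in which no scalar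
  occurs still refer to one and the same algebra.\<close>

locale leavitt_calculus = normal_labelled_space E lab \<B>
  for E :: "('v, 'e) pre_digraph" and lab :: "'e \<Rightarrow> 'l" and \<B> :: "'v set set" +
  fixes K :: "'k::field itself"
begin

text \<open>A function of the points \<open>(n, \<alpha>, v)\<close> assigns to each word \<open>\<alpha>\<close> a function on vertices. The operator
  \<open>s\<^sub>a\<close> moves the value at \<open>\<alpha>\<close> to \<open>a\<alpha>\<close>, cut down to \<open>r(a\<alpha>)\<close>; \<open>s\<^sub>a\<^sup>*\<close> moves it back; \<open>p\<^sub>A\<close> cuts the value at
  \<open>\<alpha>\<close> down to \<open>r(A,\<alpha>)\<close>. The integer \<open>n\<close> records the degree, in which \<open>s\<^sub>a\<close> has weight 1 and \<open>s\<^sub>a\<^sup>*\<close>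
  weight -1. All relations hold except the last one, which fails exactly at the empty word: there
  the difference of its two sides cuts a function down to the regular set \<open>A\<close>.\<close>

fun move :: "('v, 'l) lpa_gen \<Rightarrow> int \<times> 'l list \<times> 'v \<Rightarrow> (int \<times> 'l list \<times> 'v) option" where
  "move (Proj A) (n, \<alpha>, v) = (if v \<in> rel A \<alpha> then Some (n, \<alpha>, v) else None)"
| "move (Edge a) (n, [], v) = None"
| "move (Edge a) (n, b # \<beta>, v) = (if b = a \<and> v \<in> ran (a # \<beta>) then Some (n - 1, \<beta>, v) else None)"
| "move (Ghost a) (n, \<alpha>, v) = (if v \<in> ran (a # \<alpha>) then Some (n + 1, a # \<alpha>, v) else None)"

text \<open>The functions to divide out in order to repair the last relation. They contain everything that is
  supported at the empty word on a regular set, and the operators preserve them; but the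
  bound on the length of words keeps them from swallowing \<open>p\<^sub>B\<close> for a nonempty \<open>B\<close>, even if every
  \<open>r(B,\<gamma>)\<close> is regular.\<close>

definition negligible :: "(int \<times> 'l list \<times> 'v \<Rightarrow> 'k) \<Rightarrow> bool" where
  "negligible f \<longleftrightarrow> (\<exists>N. \<forall>n \<alpha> v. f (n, \<alpha>, v) \<noteq> 0 \<longrightarrow> length \<alpha> < N) \<and>
    (\<forall>n \<alpha>. \<exists>R \<in> regular_sets E lab \<B>. {v. f (n, \<alpha>, v) \<noteq> 0} \<subseteq> R)"

lemma empty_regular [simp]: "{} \<in> regular_sets E lab \<B>"
  by (simp add: regular_sets_def)

lemma negligible_zero:
  assumes "\<And>q. f q = 0"
  shows "negligible f"
proof -
  have "\<exists>R \<in> regular_sets E lab \<B>. {v. f (n, \<alpha>, v) \<noteq> 0} \<subseteq> R" for n \<alpha>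
    by (rule bexI[OF _ empty_regular]) (simp add: assms)
  then show ?thesis
    by (simp add: negligible_def assms)
qed

lemma negligible_sum:
  assumes "finite I" "\<And>i. i \<in> I \<Longrightarrow> negligible (f i)"
  shows "negligible (\<lambda>q. \<Sum>i\<in>I. f i q)"
proof -
  have nz: "\<exists>i\<in>I. f i q \<noteq> 0" if "(\<Sum>i\<in>I. f i q) \<noteq> 0" for q
    using that by (meson sum.neutral)
  obtain N where N: "\<And>i n \<alpha> v. i \<in> I \<Longrightarrow> f i (n, \<alpha>, v) \<noteq> 0 \<Longrightarrow> length \<alpha> < N i"
    using assms(2) unfolding negligible_def by metis
  show ?thesis
    unfolding negligible_def
  proof (intro conjI allI)
    have "length \<alpha> < Suc (\<Sum>i\<in>I. N i)" if "i \<in> I" "f i (n, \<alpha>, v) \<noteq> 0" for i n \<alpha> v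
      using N[OF that] member_le_sum[of i I N] assms(1) that(1) by simp
    then show "\<exists>N. \<forall>n \<alpha> v. (\<Sum>i\<in>I. f i (n, \<alpha>, v)) \<noteq> 0 \<longrightarrow> length \<alpha> < N"
      using nz by blast
    fix n \<alpha>
    have "\<exists>R\<in>regular_sets E lab \<B>. (\<Union>i\<in>I. {v. f i (n, \<alpha>, v) \<noteq> 0}) \<subseteq> R"
      using assms by (intro regular_sets_Union) (simp_all add: negligible_def)
    moreover have "{v. (\<Sum>i\<in>I. f i (n, \<alpha>, v)) \<noteq> 0} \<subseteq> (\<Union>i\<in>I. {v. f i (n, \<alpha>, v) \<noteq> 0})"
      using nz by blast
    ultimately show "\<exists>R\<in>regular_sets E lab \<B>. {v. (\<Sum>i\<in>I. f i (n, \<alpha>, v)) \<noteq> 0} \<subseteq> R"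
      by (meson subset_trans)
  qed
qed

lemma negligible_add: "negligible f \<Longrightarrow> negligible g \<Longrightarrow> negligible (\<lambda>q. f q + g q)"
  using negligible_sum[of "UNIV :: bool set" "\<lambda>b. if b then f else g"] by (simp add: UNIV_bool add.commute)

lemma negligible_scale: "negligible f \<Longrightarrow> negligible (\<lambda>q. k * f q)"
  by (cases "k = 0") (simp_all add: negligible_zero, simp add: negligible_def)

lemma negligible_move:
  assumes "negligible f"
  shows "negligible (\<lambda>q. value_at f (move g q))"
proof -
  obtain N where N: "\<And>n \<alpha> v. f (n, \<alpha>, v) \<noteq> 0 \<Longrightarrow> length \<alpha> < N"
    using assms unfolding negligible_def by blast
  have R: "\<exists>R \<in> regular_sets E lab \<B>. {v. f (n, \<alpha>, v) \<noteq> 0} \<subseteq> R" for n \<alpha>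
    using assms unfolding negligible_def by blast
  show ?thesis
    unfolding negligible_def
  proof (intro conjI exI allI impI)
    fix n \<alpha> v assume "value_at f (move g (n, \<alpha>, v)) \<noteq> 0"
    then show "length \<alpha> < Suc N"
      by (cases "(g, n, \<alpha>, v)" rule: move.cases) (auto split: if_splits dest: N)
  next
    fix n \<alpha>
    have "{v. value_at f (move g (n, \<alpha>, v)) \<noteq> 0} \<subseteq>
        {v. f (case g of Proj A \<Rightarrow> (n, \<alpha>, v) | Edge a \<Rightarrow> (n - 1, tl \<alpha>, v) | Ghost a \<Rightarrow> (n + 1, a # \<alpha>, v)) \<noteq> 0}"
      by (cases g; cases \<alpha>) auto
    moreover have "\<exists>R\<in>regular_sets E lab \<B>.
        {v. f (case g of Proj A \<Rightarrow> (n, \<alpha>, v) | Edge a \<Rightarrow> (n - 1, tl \<alpha>, v) | Ghost a \<Rightarrow> (n + 1, a # \<alpha>, v)) \<noteq> 0} \<subseteq> R"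
      by (cases g) (simp_all add: R)
    ultimately show "\<exists>R\<in>regular_sets E lab \<B>. {v. value_at f (move g (n, \<alpha>, v)) \<noteq> 0} \<subseteq> R"
      by (meson subset_trans)
  qed
qed

lemma negligible_act:
  assumes "negligible f"
  shows "negligible (act move x f)"
proof -
  have w: "negligible (\<lambda>q. value_at f (word_move move w q))" for w
  proof (induction w)
    case Nil
    then show ?case using assms by simp
  next
    case (Cons g w)
    have "value_at f (word_move move (g # w) q) = value_at (\<lambda>q. value_at f (word_move move w q)) (move g q)" for q
      by (cases "move g q") simp_all
    then show ?case
      using negligible_move[OF Cons] by simp
  qed
  have "negligible (\<lambda>q. \<Sum>w\<in>Poly_Mapping.keys x. Poly_Mapping.lookup x w * value_at f (word_move move (letters w) q))"
    by (intro negligible_sum negligible_scale w) simp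
  then show ?thesis
    by (simp add: act_def[abs_def])
qed

lemma act_generators [simp]:
  "act move (generator (Proj A)) f (n, \<alpha>, v) = (if v \<in> rel A \<alpha> then f (n, \<alpha>, v) else 0)"
  "act move (generator (Edge a)) f (n, [], v) = 0"
  "act move (generator (Edge a)) f (n, b # \<beta>, v) = (if b = a \<and> v \<in> ran (a # \<beta>) then f (n - 1, \<beta>, v) else 0)"
  "act move (generator (Ghost a)) f (n, \<alpha>, v) = (if v \<in> ran (a # \<alpha>) then f (n + 1, a # \<alpha>, v) else 0)"
  by (simp_all add: act_generator)

text \<open>The operators of all relators but the last kind are zero. For a regular \<open>A\<close>, the last kind vanishes at
  nonempty words, because \<open>r(A,b\<beta>)\<close> is nonempty only if \<open>b\<close> labels an edge leaving \<open>A\<close>; at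
  the empty word its values are supported on \<open>A\<close>.\<close>

lemma negligible_relators:
  assumes "x \<in> lpa_relators E lab \<B>"
  shows "negligible (act move x f)"
proof -
  have fam: "A \<subseteq> verts E" if "A \<in> \<B>" for A
    using that by (rule family_subset)
  note [simp] = act_diff act_add act_mult act_sum
  have rA: "v \<in> rel A (a # \<beta>) \<longleftrightarrow> v \<in> rel (rel A [a]) \<beta>" if "A \<in> \<B>" for A a \<beta> v
    using rel_Cons[OF fam[OF that], of a \<beta>] by simp
  have wA: "v \<in> ran (a # \<beta>) \<longleftrightarrow> v \<in> rel (ran [a]) \<beta>" for a \<beta> v
    using ran_Cons[of a \<beta>] by simp
  have zeroI: "negligible (act move x f)" if "\<And>n \<alpha> v. act move x f (n, \<alpha>, v) = 0"
    by (rule negligible_zero) (metis prod_cases3 that)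
  show ?thesis
    using assms unfolding lpa_relators_def Let_def
  proof (elim UnE)
    assume "x \<in> {generator (Proj (A \<inter> B)) - generator (Proj A) * generator (Proj B) | A B. A \<in> \<B> \<and> B \<in> \<B>}"
    then have "act move x f (n, \<alpha>, v) = 0" for n \<alpha> v
      by (auto simp: rel_Int)
    then show ?thesis by (rule zeroI)
  next
    assume "x \<in> {generator (Proj (A \<union> B)) - (generator (Proj A) + generator (Proj B) - generator (Proj (A \<inter> B))) | A B. A \<in> \<B> \<and> B \<in> \<B>}"
    then have "act move x f (n, \<alpha>, v) = 0" for n \<alpha> v
      by (auto simp: rel_Int rel_Un)
    then show ?thesis by (rule zeroI)
  next
    assume "x \<in> {generator (Proj {})}"
    then have "act move x f (n, \<alpha>, v) = 0" for n \<alpha> v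
      by (auto)
    then show ?thesis by (rule zeroI)
  next
    assume "x \<in> {generator (Proj A) * generator (Edge a) - generator (Edge a) * generator (Proj (rel A [a])) | A a. A \<in> \<B> \<and> a \<in> alphabet E lab}"
    then have "act move x f (n, \<alpha>, v) = 0" for n \<alpha> v
      by (cases \<alpha>) (auto simp: rA)
    then show ?thesis by (rule zeroI)
  next
    assume "x \<in> {generator (Ghost a) * generator (Proj A) - generator (Proj (rel A [a])) * generator (Ghost a) | A a. A \<in> \<B> \<and> a \<in> alphabet E lab}"
    then have "act move x f (n, \<alpha>, v) = 0" for n \<alpha> v
      by (auto simp: rA)
    then show ?thesis by (rule zeroI)
  next
    assume "x \<in> {generator (Ghost a) * generator (Edge a) - generator (Proj (ran [a])) | a. a \<in> alphabet E lab}"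
    then have "act move x f (n, \<alpha>, v) = 0" for n \<alpha> v
      by (auto simp: wA)
    then show ?thesis by (rule zeroI)
  next
    assume "x \<in> {generator (Ghost b) * generator (Edge a) | a b. a \<in> alphabet E lab \<and> b \<in> alphabet E lab \<and> b \<noteq> a}"
    then have "act move x f (n, \<alpha>, v) = 0" for n \<alpha> v
      by (auto)
    then show ?thesis by (rule zeroI)
  next
    assume "x \<in> {generator (Edge a) * generator (Ghost a) * generator (Edge a) - generator (Edge a) | a. a \<in> alphabet E lab}"
    then have "act move x f (n, \<alpha>, v) = 0" for n \<alpha> v
      by (cases \<alpha>) (auto)
    then show ?thesis by (rule zeroI)
  next
    assume "x \<in> {generator (Ghost a) * generator (Edge a) * generator (Ghost a) - generator (Ghost a) | a. a \<in> alphabet E lab}"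
    then have "act move x f (n, \<alpha>, v) = 0" for n \<alpha> v
      by (auto)
    then show ?thesis by (rule zeroI)
  next
    assume "x \<in> {generator (Proj A) - (\<Sum>a\<in>out_labels E lab A.
        generator (Edge a) * generator (Proj (rel A [a])) * generator (Ghost a)) | A. A \<in> regular_sets E lab \<B>}"
    then obtain A where A10: "x = generator (Proj A) - (\<Sum>a\<in>out_labels E lab A.
        generator (Edge a) * generator (Proj (rel A [a])) * generator (Ghost a))" "A \<in> regular_sets E lab \<B>"
      by auto
    have A: "A \<in> \<B>"
      using A10 regular_sets_family by blast
    have fin: "finite (out_labels E lab A)"
      using A10(2) by (cases "A = {}") (auto simp: regular_sets_iff out_labels_def)
    have Nil: "act move x f (n, [], v) = (if v \<in> A then f (n, [], v) else 0)" for n v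
      using A10 by simp
    have Cons: "act move x f (n, b # \<beta>, v) = 0" for n b \<beta> v
    proof -
      have "act move (generator (Edge a) * generator (Proj (rel A [a])) * generator (Ghost a)) f (n, b # \<beta>, v) =
          (if a = b then if v \<in> rel A (b # \<beta>) then f (n, b # \<beta>, v) else 0 else 0)" for a
        using rel_subset_ran[OF fam[OF A], of "b # \<beta>"] by (auto simp: rA[OF A])
      then have "(\<Sum>a\<in>out_labels E lab A. act move
          (generator (Edge a) * generator (Proj (rel A [a])) * generator (Ghost a)) f (n, b # \<beta>, v)) =
          (if b \<in> out_labels E lab A \<and> v \<in> rel A (b # \<beta>) then f (n, b # \<beta>, v) else 0)"
        using fin by (simp add: sum.delta' del: act_mult)
      moreover have "b \<in> out_labels E lab A" if "v \<in> rel A (b # \<beta>)"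
        using that rA[OF A] by (auto simp: out_labels_iff)
      ultimately show ?thesis
        unfolding A10(1) by (auto simp del: act_mult)
    qed
    have "{v. act move x f (n, \<alpha>, v) \<noteq> 0} \<subseteq> A" for n \<alpha>
      by (cases \<alpha>) (auto simp: Nil Cons split: if_splits)
    moreover have "length \<alpha> < 1" if "act move x f (n, \<alpha>, v) \<noteq> 0" for n \<alpha> v
      using that by (cases \<alpha>) (auto simp: Cons)
    ultimately show ?thesis
      unfolding negligible_def using A10(2) by blast
  qed
qed

lemma negligible_ideal:
  assumes "x \<in> algebra_ideal (lpa_gens E lab \<B>) (lpa_relators E lab \<B>)"
  shows "negligible (act move x f)"
  using assms
proof (induction arbitrary: f)
  case zero
  then show ?case by (simp add: negligible_zero)
next
  case (incl x)
  then show ?case by (rule negligible_relators)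
next
  case (add x y)
  then show ?case
    using negligible_add[of "act move x f" "act move y f"] by (simp add: act_add[abs_def])
next
  case (scale x k)
  then show ?case
    using negligible_scale[of "act move x f" k] by (simp add: scalar_def act_mult[abs_def] act_const[abs_def])
next
  case (mult_left x y)
  then show ?case
    using negligible_act[of "act move x f" y] by (simp add: act_mult[abs_def])
next
  case (mult_right x y)
  then show ?case
    by (simp add: act_mult[abs_def])
qed

text \<open>If the indicator function of the sets \<open>r(B,\<gamma>)\<close> were negligible, every \<open>r(B,\<gamma>)\<close> would lie in a regular
  set and so, when nonempty, emit an edge. Following these edges makes \<open>\<gamma>\<close> arbitrarily long with
  \<open>r(B,\<gamma>)\<close> nonempty, against the bound on the length.\<close>

lemma not_negligible_if_nonempty:
  assumes "B \<in> \<B>" "B \<noteq> {}" "f = (\<lambda>(n, \<gamma>, v). if n = 0 \<and> v \<in> rel B \<gamma> then 1 else (0::'k))"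
    "k \<noteq> 0" and g: "\<And>\<gamma> v. g (0, \<gamma>, v) = k * f (0, \<gamma>, v)"
  shows "\<not> negligible g"
proof
  assume neg: "negligible g"
  have g0: "g (0, \<gamma>, v) \<noteq> 0 \<longleftrightarrow> v \<in> rel B \<gamma>" for \<gamma> v
    using assms by simp
  obtain N where N: "\<And>\<gamma> v. v \<in> rel B \<gamma> \<Longrightarrow> length \<gamma> < N"
    using neg unfolding negligible_def g0[symmetric] by blast
  have reg: "rel B \<gamma> \<in> regular_sets E lab \<B>" for \<gamma>
  proof -
    have "\<exists>R\<in>regular_sets E lab \<B>. {v. g (0, \<gamma>, v) \<noteq> 0} \<subseteq> R"
      using neg unfolding negligible_def by blast
    then show ?thesis
      using assms(1) by (auto simp: g0 intro: regular_sets_subset)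
  qed
  have "\<exists>\<gamma>. length \<gamma> = m \<and> rel B \<gamma> \<noteq> {}" for m
  proof (induction m)
    case 0
    then show ?case using assms(2) by auto
  next
    case (Suc m)
    then obtain \<gamma> where \<gamma>: "length \<gamma> = m" "rel B \<gamma> \<noteq> {}"
      by blast
    then have "out_labels E lab (rel B \<gamma>) \<noteq> {}"
      using reg[of \<gamma>] assms(1) unfolding regular_sets_iff by (meson order_refl)
    then obtain a where "rel (rel B \<gamma>) [a] \<noteq> {}"
      using out_labels_iff by blast
    then have "rel B (\<gamma> @ [a]) \<noteq> {}"
      using family_subset[OF assms(1)] by (simp add: rel_append)
    then show ?case
      using \<gamma>(1) by (intro exI[of _ "\<gamma> @ [a]"]) auto
  qed
  then show False
    using N by (metis equals0I less_irrefl)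
qed

definition edges :: "'l list \<Rightarrow> ('v, 'l) lpa_gen free_word \<Rightarrow>\<^sub>0 'k" where
  "edges \<alpha> = prod_list (map (\<lambda>a. generator (Edge a)) \<alpha>)"

lemma act_edges_shift:
  assumes "\<And>n \<gamma> v. n \<noteq> 0 \<Longrightarrow> f (n, \<gamma>, v) = 0" "n \<noteq> int (length \<alpha>)"
  shows "act move (edges \<alpha>) f (n, \<gamma>, v) = 0"
  using assms(2)
proof (induction \<alpha> arbitrary: n \<gamma>)
  case Nil
  then show ?case
    using assms(1) by (simp add: edges_def)
next
  case (Cons a \<alpha>)
  then have "act move (edges \<alpha>) f (n - 1, \<gamma>, v) = 0" for \<gamma>
    by (intro Cons.IH) auto
  then show ?case
    by (cases \<gamma>) (simp_all add: edges_def act_mult)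
qed

abbreviation proj :: "'v set \<Rightarrow> ('v, 'l) lpa_gen free_word \<Rightarrow>\<^sub>0 'k" where
  "proj A \<equiv> generator (Proj A)"

text \<open>These elements lie in the corner cut out by the idempotent \<open>p\<^sub>B\<close>. Having the projection on both sides
  makes their shape stable under compression, with no conditions on the words.\<close>

definition corner :: "'l list set \<Rightarrow> ('l list \<Rightarrow> 'k) \<Rightarrow> 'v set \<Rightarrow> ('v, 'l) lpa_gen free_word \<Rightarrow>\<^sub>0 'k" where
  "corner W \<kappa> B = (\<Sum>\<beta>\<in>W. const_poly (\<kappa> \<beta>) * (proj B * edges \<beta> * proj B))"

text \<open>Test the corner on a function concentrated in degree 0 and look at degree 0 of the result: the terms
  of nonempty words have moved to positive degrees, and only the constant term is left.\<close>

lemma corner_not_in_ideal: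
  assumes "B \<in> \<B>" "B \<noteq> {}" "finite W" "[] \<in> W" "\<kappa> [] \<noteq> 0"
  shows "corner W \<kappa> B \<notin> algebra_ideal (lpa_gens E lab \<B>) (lpa_relators E lab \<B>)"
proof
  define f :: "int \<times> 'l list \<times> 'v \<Rightarrow> 'k" where
    "f = (\<lambda>(n, \<gamma>, v). if n = 0 \<and> v \<in> rel B \<gamma> then 1 else 0)"
  have monomial: "act move (proj B * edges \<beta> * proj B) f (0, \<gamma>, v) = (if \<beta> = [] then f (0, \<gamma>, v) else 0)" for \<beta> \<gamma> v
  proof (cases "\<beta> = []")
    case False
    have "act move (proj B) f (n, \<gamma>, v) = 0" if "n \<noteq> 0" for n \<gamma> v
      using that by (simp add: f_def)
    then have "act move (edges \<beta>) (act move (proj B) f) (0, \<gamma>, v) = 0"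
      using False by (intro act_edges_shift) auto
    then show ?thesis
      using False by (simp add: act_mult)
  qed (simp add: act_mult edges_def f_def)
  have "act move (corner W \<kappa> B) f (0, \<gamma>, v) = (\<Sum>\<beta>\<in>W. if \<beta> = [] then \<kappa> [] * f (0, \<gamma>, v) else 0)" for \<gamma> v
    unfolding corner_def act_sum by (intro sum.cong refl) (simp only: act_mult[of move "const_poly k" for k] act_const monomial, simp)
  then have "act move (corner W \<kappa> B) f (0, \<gamma>, v) = \<kappa> [] * f (0, \<gamma>, v)" for \<gamma> v
    using assms(3,4) by simp
  then have "\<not> negligible (act move (corner W \<kappa> B) f)"
    by (rule not_negligible_if_nonempty[OF assms(1,2) f_def assms(5)])
  moreover assume "corner W \<kappa> B \<in> algebra_ideal (lpa_gens E lab \<B>) (lpa_relators E lab \<B>)"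
  ultimately show False
    using negligible_ideal by blast
qed

section \<open>Computing with edges and ghosts\<close>

abbreviation lcong :: "(('v, 'l) lpa_gen free_word \<Rightarrow>\<^sub>0 'k) \<Rightarrow> (('v, 'l) lpa_gen free_word \<Rightarrow>\<^sub>0 'k) \<Rightarrow> bool"
    (infix "\<approx>" 50) where
  "lcong \<equiv> pres_cong (lpa_gens E lab \<B>) (lpa_relators E lab \<B>)"

abbreviation edge :: "'l \<Rightarrow> ('v, 'l) lpa_gen free_word \<Rightarrow>\<^sub>0 'k" where
  "edge a \<equiv> generator (Edge a)"

abbreviation ghost :: "'l \<Rightarrow> ('v, 'l) lpa_gen free_word \<Rightarrow>\<^sub>0 'k" where
  "ghost a \<equiv> generator (Ghost a)"

text \<open>This is \<open>s\<^sub>\<alpha>\<^sup>*\<close>: taking adjoints reverses the order of the letters.\<close>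

definition ghosts :: "'l list \<Rightarrow> ('v, 'l) lpa_gen free_word \<Rightarrow>\<^sub>0 'k" where
  "ghosts \<alpha> = prod_list (map (\<lambda>a. generator (Ghost a)) (rev \<alpha>))"

lemma edges_simps [simp]:
  "edges [] = 1" "edges (a # \<alpha>) = edge a * edges \<alpha>" "edges (\<alpha> @ \<beta>) = edges \<alpha> * edges \<beta>"
  by (simp_all add: edges_def)

lemma ghosts_simps [simp]:
  "ghosts [] = 1" "ghosts (a # \<alpha>) = ghosts \<alpha> * ghost a" "ghosts (\<alpha> @ \<beta>) = ghosts \<beta> * ghosts \<alpha>"
  by (simp_all add: ghosts_def)

lemma lpa_gens_simps [simp]:
  "Proj A \<in> lpa_gens E lab \<B> \<longleftrightarrow> A \<in> \<B>"
  "Edge a \<in> lpa_gens E lab \<B> \<longleftrightarrow> a \<in> alphabet E lab"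
  "Ghost a \<in> lpa_gens E lab \<B> \<longleftrightarrow> a \<in> alphabet E lab"
  by (auto simp: lpa_gens_def)

abbreviation relators :: "(('v, 'l) lpa_gen free_word \<Rightarrow>\<^sub>0 'k) set" where
  "relators \<equiv> lpa_relators E lab \<B>"

lemma relators_free: "relators \<subseteq> free_algebra (lpa_gens E lab \<B>)"
proof -
  have "a \<in> alphabet E lab" if "a \<in> out_labels E lab A" for a A
    using that out_labels_subset_alphabet by blast
  then show ?thesis
    unfolding lpa_relators_def Let_def
    by (auto intro!: free_algebra_diff free_algebra_add free_algebra_mult free_algebra_sum family_Int family_Un
        simp: regular_sets_family)
qed

lemmas cong_trans [trans] = pres_cong_trans[of "lpa_gens E lab \<B>" relators]

lemma cong_mult_zero: "x \<approx> 0 \<Longrightarrow> x * y \<approx> 0" "y \<approx> 0 \<Longrightarrow> x * y \<approx> 0"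
  using pres_cong_mult[of _ _ x 0 y y] pres_cong_mult[of _ _ x x y 0] by auto

lemma cong_mult_left: "y \<approx> y' \<Longrightarrow> x * y \<approx> x * y'"
  by (simp add: pres_cong_mult)

lemma cong_mult_right: "x \<approx> x' \<Longrightarrow> x * y \<approx> x' * y"
  by (simp add: pres_cong_mult)

lemma cong_mult_mid: "y \<approx> y' \<Longrightarrow> x * y * z \<approx> x * y' * z"
  by (simp add: pres_cong_mult)

lemma cong_relator: "x - y \<in> relators \<Longrightarrow> x \<approx> y"
  by (rule pres_cong_relator[OF _ relators_free])

lemma proj_mult: "A \<in> \<B> \<Longrightarrow> B \<in> \<B> \<Longrightarrow> proj A * proj B \<approx> proj (A \<inter> B)"
  by (rule pres_cong_sym, rule cong_relator) (auto simp: lpa_relators_def)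

lemma proj_empty: "proj {} \<approx> 0"
  by (rule cong_relator) (simp add: lpa_relators_def)

lemma proj_Un: "A \<in> \<B> \<Longrightarrow> B \<in> \<B> \<Longrightarrow> proj (A \<union> B) \<approx> proj A + proj B - proj (A \<inter> B)"
  by (rule cong_relator) (unfold lpa_relators_def Let_def, blast)

lemma proj_edge: "A \<in> \<B> \<Longrightarrow> a \<in> alphabet E lab \<Longrightarrow> proj A * edge a \<approx> edge a * proj (rel A [a])"
  by (rule cong_relator) (unfold lpa_relators_def Let_def, blast)

lemma ghost_proj: "A \<in> \<B> \<Longrightarrow> a \<in> alphabet E lab \<Longrightarrow> ghost a * proj A \<approx> proj (rel A [a]) * ghost a"
  by (rule cong_relator) (unfold lpa_relators_def Let_def, blast)

lemma ghost_edge_same: "a \<in> alphabet E lab \<Longrightarrow> ghost a * edge a \<approx> proj (ran [a])"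
  by (rule cong_relator) (unfold lpa_relators_def Let_def, blast)

lemma ghost_edge_diff:
  "a \<in> alphabet E lab \<Longrightarrow> b \<in> alphabet E lab \<Longrightarrow> b \<noteq> a \<Longrightarrow> ghost b * edge a \<approx> 0"
  by (rule cong_relator) (unfold lpa_relators_def Let_def diff_0_right, blast)

lemma edge_ghost_edge: "a \<in> alphabet E lab \<Longrightarrow> edge a * ghost a * edge a \<approx> edge a"
  by (rule cong_relator) (unfold lpa_relators_def Let_def, blast)

lemma ghost_edge_ghost: "a \<in> alphabet E lab \<Longrightarrow> ghost a * edge a * ghost a \<approx> ghost a"
  by (rule cong_relator) (unfold lpa_relators_def Let_def, blast)

lemma proj_regular:
  "A \<in> regular_sets E lab \<B> \<Longrightarrow>
    proj A \<approx> (\<Sum>a\<in>out_labels E lab A. edge a * proj (rel A [a]) * ghost a)"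
  by (rule cong_relator) (unfold lpa_relators_def Let_def, blast)

lemma proj_split:
  assumes "A \<in> \<B>" "B \<in> \<B>"
  shows "proj A \<approx> proj (A \<inter> B) + proj (A - B)"
proof -
  have "proj ((A \<inter> B) \<union> (A - B)) \<approx> proj (A \<inter> B) + proj (A - B) - proj ((A \<inter> B) \<inter> (A - B))"
    using assms by (intro proj_Un family_Int family_Diff)
  also have "(A \<inter> B) \<union> (A - B) = A"
    by blast
  also have "(A \<inter> B) \<inter> (A - B) = {}"
    by blast
  also have "proj (A \<inter> B) + proj (A - B) - proj {} \<approx> proj (A \<inter> B) + proj (A - B) - 0"
    by (intro pres_cong_diff pres_cong_refl proj_empty)
  finally show ?thesis
    by simp
qed

lemma edge_ran: "a \<in> alphabet E lab \<Longrightarrow> edge a * proj (ran [a]) \<approx> edge a"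
  using pres_cong_trans[OF cong_mult_left[OF pres_cong_sym[OF ghost_edge_same]] edge_ghost_edge[unfolded mult.assoc]] .

lemma ran_ghost: "a \<in> alphabet E lab \<Longrightarrow> proj (ran [a]) * ghost a \<approx> ghost a"
  using pres_cong_trans[OF cong_mult_right[OF pres_cong_sym[OF ghost_edge_same]] ghost_edge_ghost] .

lemma proj_edges:
  "A \<in> \<B> \<Longrightarrow> over_alphabet \<alpha> \<Longrightarrow> proj A * edges \<alpha> \<approx> edges \<alpha> * proj (rel A \<alpha>)"
proof (induction \<alpha> arbitrary: A)
  case (Cons a \<alpha>)
  have "proj A * edges (a # \<alpha>) = (proj A * edge a) * edges \<alpha>"
    by (simp add: mult.assoc)
  also have "\<dots> \<approx> (edge a * proj (rel A [a])) * edges \<alpha>"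
    using Cons.prems by (intro cong_mult_right proj_edge) auto
  also have "\<dots> = edge a * (proj (rel A [a]) * edges \<alpha>)"
    by (simp add: mult.assoc)
  also have "\<dots> \<approx> edge a * (edges \<alpha> * proj (rel (rel A [a]) \<alpha>))"
    using Cons.prems by (intro cong_mult_left Cons.IH) auto
  also have "\<dots> = edges (a # \<alpha>) * proj (rel A (a # \<alpha>))"
    using rel_Cons[OF family_subset[OF Cons.prems(1)], of a \<alpha>] by (simp add: mult.assoc)
  finally show ?case .
qed simp

lemma ghosts_proj:
  "A \<in> \<B> \<Longrightarrow> over_alphabet \<alpha> \<Longrightarrow> ghosts \<alpha> * proj A \<approx> proj (rel A \<alpha>) * ghosts \<alpha>"
proof (induction \<alpha> arbitrary: A)
  case (Cons a \<alpha>)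
  have "ghosts (a # \<alpha>) * proj A = ghosts \<alpha> * (ghost a * proj A)"
    by (simp add: mult.assoc)
  also have "\<dots> \<approx> ghosts \<alpha> * (proj (rel A [a]) * ghost a)"
    using Cons.prems by (intro cong_mult_left ghost_proj) auto
  also have "\<dots> = (ghosts \<alpha> * proj (rel A [a])) * ghost a"
    by (simp add: mult.assoc)
  also have "\<dots> \<approx> (proj (rel (rel A [a]) \<alpha>) * ghosts \<alpha>) * ghost a"
    using Cons.prems by (intro cong_mult_right Cons.IH) auto
  also have "\<dots> = proj (rel A (a # \<alpha>)) * ghosts (a # \<alpha>)"
    using rel_Cons[OF family_subset[OF Cons.prems(1)], of a \<alpha>] by (simp add: mult.assoc)
  finally show ?case .
qed simp

lemma edges_ran:
  assumes "over_alphabet \<alpha>" "\<alpha> \<noteq> []"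
  shows "edges \<alpha> * proj (ran \<alpha>) \<approx> edges \<alpha>"
proof -
  obtain a \<beta> where \<alpha>: "\<alpha> = a # \<beta>"
    using assms(2) by (cases \<alpha>) auto
  have "edges \<alpha> * proj (ran \<alpha>) = edge a * (edges \<beta> * proj (rel (ran [a]) \<beta>))"
    by (simp add: \<alpha> mult.assoc ran_Cons[of a \<beta>])
  also have "\<dots> \<approx> edge a * (proj (ran [a]) * edges \<beta>)"
    using assms by (intro cong_mult_left pres_cong_sym[OF proj_edges]) (auto simp: \<alpha>)
  also have "\<dots> = (edge a * proj (ran [a])) * edges \<beta>"
    by (simp add: mult.assoc)
  also have "\<dots> \<approx> edge a * edges \<beta>"
    using assms by (intro cong_mult_right edge_ran) (auto simp: \<alpha>)
  finally show ?thesis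
    by (simp add: \<alpha>)
qed

lemma Int_verts [simp]: "A \<in> \<B> \<Longrightarrow> A \<inter> verts E = A"
  using family_subset by blast

lemma edges_proj_ran:
  assumes "A \<in> \<B>" "over_alphabet \<alpha>"
  shows "edges \<alpha> * proj A \<approx> edges \<alpha> * proj (A \<inter> ran \<alpha>)"
proof (cases "\<alpha> = []")
  case False
  have "edges \<alpha> * proj A \<approx> (edges \<alpha> * proj (ran \<alpha>)) * proj A"
    using assms False by (intro cong_mult_right pres_cong_sym[OF edges_ran])
  also have "\<dots> = edges \<alpha> * (proj (ran \<alpha>) * proj A)"
    by (simp add: mult.assoc)
  also have "\<dots> \<approx> edges \<alpha> * proj (ran \<alpha> \<inter> A)"
    using assms False by (intro cong_mult_left proj_mult) auto
  finally show ?thesis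
    by (simp add: Int_commute)
qed (use assms in simp)

text \<open>For nonempty \<open>\<alpha>\<close> this is \<open>s\<^sub>\<alpha>\<^sup>* s\<^sub>\<alpha> = p\<^bsub>r(\<alpha>)\<^esub>\<close>. The factor \<open>p\<^sub>C\<close> allows \<open>\<alpha>\<close> to be empty, where there
  need not be a projection \<open>p\<^bsub>r(\<alpha>)\<^esub>\<close>, since the set of all vertices may lie outside the family.\<close>

lemma ghosts_edges_same:
  "C \<in> \<B> \<Longrightarrow> over_alphabet \<alpha> \<Longrightarrow> proj C * (ghosts \<alpha> * edges \<alpha>) \<approx> proj (C \<inter> ran \<alpha>)"
proof (induction \<alpha>)
  case (Cons a \<alpha>)
  have "proj C * (ghosts (a # \<alpha>) * edges (a # \<alpha>)) = proj C * ghosts \<alpha> * (ghost a * edge a) * edges \<alpha>"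
    by (simp add: mult.assoc)
  also have "\<dots> \<approx> proj C * ghosts \<alpha> * proj (ran [a]) * edges \<alpha>"
    using Cons.prems by (intro cong_mult_mid ghost_edge_same) auto
  also have "\<dots> = proj C * ghosts \<alpha> * (proj (ran [a]) * edges \<alpha>)"
    by (simp add: mult.assoc)
  also have "\<dots> \<approx> proj C * ghosts \<alpha> * (edges \<alpha> * proj (rel (ran [a]) \<alpha>))"
    using Cons.prems by (intro cong_mult_left proj_edges) auto
  also have "\<dots> = (proj C * (ghosts \<alpha> * edges \<alpha>)) * proj (ran (a # \<alpha>))"
    by (simp add: mult.assoc ran_Cons[of a \<alpha>])
  also have "\<dots> \<approx> proj (C \<inter> ran \<alpha>) * proj (ran (a # \<alpha>))"
    using Cons.prems by (intro cong_mult_right Cons.IH) auto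
  also have "\<dots> \<approx> proj (C \<inter> ran \<alpha> \<inter> ran (a # \<alpha>))"
    using Cons.prems by (intro proj_mult) auto
  also have "C \<inter> ran \<alpha> \<inter> ran (a # \<alpha>) = C \<inter> ran (a # \<alpha>)"
    using ran_append_subset[of "[a]" \<alpha>] by auto
  finally show ?case .
qed simp

lemma ghosts_edges_diff:
  "over_alphabet u \<Longrightarrow> over_alphabet \<gamma> \<Longrightarrow> length u \<le> length \<gamma> \<Longrightarrow> take (length u) \<gamma> \<noteq> u \<Longrightarrow>
    ghosts u * edges \<gamma> \<approx> 0"
proof (induction u arbitrary: \<gamma>)
  case (Cons a u)
  then obtain b \<delta> where \<gamma>: "\<gamma> = b # \<delta>"
    by (cases \<gamma>) auto
  have eq: "ghosts (a # u) * edges \<gamma> = ghosts u * (ghost a * edge b) * edges \<delta>"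
    by (simp add: \<gamma> mult.assoc)
  show ?case
  proof (cases "a = b")
    case False
    then have "ghost a * edge b \<approx> 0"
      using Cons.prems by (intro ghost_edge_diff) (auto simp: \<gamma>)
    then show ?thesis
      unfolding eq by (intro cong_mult_zero(1)[OF cong_mult_zero(2)])
  next
    case True
    have "ghosts u * (ghost a * edge b) * edges \<delta> \<approx> ghosts u * proj (ran [a]) * edges \<delta>"
      unfolding True using Cons.prems by (intro cong_mult_mid ghost_edge_same) (auto simp: \<gamma>)
    also have "\<dots> = ghosts u * (proj (ran [a]) * edges \<delta>)"
      by (simp add: mult.assoc)
    also have "\<dots> \<approx> ghosts u * (edges \<delta> * proj (rel (ran [a]) \<delta>))"
      using Cons.prems by (intro cong_mult_left proj_edges) (auto simp: \<gamma>)
    also have "\<dots> = (ghosts u * edges \<delta>) * proj (rel (ran [a]) \<delta>)"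
      by (simp add: mult.assoc)
    also have "\<dots> \<approx> 0"
      using Cons.prems True by (intro cong_mult_zero(1) Cons.IH) (auto simp: \<gamma>)
    finally show ?thesis
      unfolding eq .
  qed
qed simp

lemma proj_absorb:
  assumes "A \<in> \<B>" "B \<in> \<B>" "A \<subseteq> B"
  shows "proj A * proj B \<approx> proj A" "proj B * proj A \<approx> proj A"
  using proj_mult[OF assms(1,2)] proj_mult[OF assms(2,1)] assms(3)
  by (simp_all add: Int_absorb1 Int_absorb2)

lemma corner_strip:
  assumes "C \<in> \<B>" "C \<subseteq> ran u" "over_alphabet u" "over_alphabet \<gamma>"
  shows "proj C * ghosts u * edges (u @ \<gamma>) \<approx> proj C * edges \<gamma>"
proof -
  have "proj C * ghosts u * edges (u @ \<gamma>) = (proj C * (ghosts u * edges u)) * edges \<gamma>"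
    by (simp add: mult.assoc)
  also have "\<dots> \<approx> proj (C \<inter> ran u) * edges \<gamma>"
    using assms by (intro cong_mult_right ghosts_edges_same)
  finally show ?thesis
    using assms(2) by (simp add: Int_absorb2)
qed

text \<open>Both inner projections disappear: moved across \<open>s\<^sub>u\<^sup>*\<close> and \<open>s\<^sub>u\<close> they become \<open>p\<^bsub>r(B,u)\<^esub>\<close>, and that
  is absorbed by \<open>p\<^sub>C\<close>.\<close>

lemma compress_step:
  assumes "B \<in> \<B>" "C \<in> \<B>" "C \<subseteq> rel B u" "over_alphabet u"
  shows "(proj C * ghosts u) * (proj B * edges \<beta> * proj B) * (edges u * proj C) \<approx>
    proj C * ghosts u * edges (\<beta> @ u) * proj C"
proof -
  have left: "proj C * ghosts u * proj B \<approx> proj C * ghosts u"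
  proof -
    have "proj C * ghosts u * proj B = proj C * (ghosts u * proj B)"
      by (simp add: mult.assoc)
    also have "\<dots> \<approx> proj C * (proj (rel B u) * ghosts u)"
      using assms by (intro cong_mult_left ghosts_proj)
    also have "\<dots> = (proj C * proj (rel B u)) * ghosts u"
      by (simp add: mult.assoc)
    also have "\<dots> \<approx> proj C * ghosts u"
      using assms by (intro cong_mult_right proj_absorb) auto
    finally show ?thesis .
  qed
  have right: "proj B * (edges u * proj C) \<approx> edges u * proj C"
  proof -
    have "proj B * (edges u * proj C) = (proj B * edges u) * proj C"
      by (simp add: mult.assoc)
    also have "\<dots> \<approx> (edges u * proj (rel B u)) * proj C"
      using assms by (intro cong_mult_right proj_edges)
    also have "\<dots> = edges u * (proj (rel B u) * proj C)"
      by (simp add: mult.assoc)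
    also have "\<dots> \<approx> edges u * proj C"
      using assms by (intro cong_mult_left proj_absorb) auto
    finally show ?thesis .
  qed
  have "(proj C * ghosts u) * (proj B * edges \<beta> * proj B) * (edges u * proj C) =
      (proj C * ghosts u * proj B) * edges \<beta> * (proj B * (edges u * proj C))"
    by (simp add: mult.assoc)
  also have "\<dots> \<approx> (proj C * ghosts u) * edges \<beta> * (edges u * proj C)"
    by (intro pres_cong_mult[OF pres_cong_mult] left right pres_cong_refl)
  also have "\<dots> = proj C * ghosts u * edges (\<beta> @ u) * proj C"
    by (simp add: mult.assoc)
  finally show ?thesis .
qed

lemma compress_eq:
  assumes "B \<in> \<B>" "C \<in> \<B>" "C \<subseteq> rel B u" "over_alphabet u" "over_alphabet \<beta>" "\<beta> @ u = u @ \<beta>'"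
  shows "(proj C * ghosts u) * (proj B * edges \<beta> * proj B) * (edges u * proj C) \<approx> proj C * edges \<beta>' * proj C"
proof -
  have "C \<subseteq> ran u"
    using assms(3) rel_subset_ran[OF family_subset[OF assms(1)]] by blast
  moreover have "over_alphabet \<beta>'"
    using arg_cong[OF assms(6), of set] assms(4,5) by auto
  ultimately show ?thesis
    using compress_step[OF assms(1-4), of \<beta>, unfolded assms(6)]
      cong_mult_right[OF corner_strip[of C u \<beta>'], of "proj C"] assms(2,4)
    by (blast intro: pres_cong_trans)
qed

lemma compress_zero:
  assumes "B \<in> \<B>" "C \<in> \<B>" "C \<subseteq> rel B u" "over_alphabet u" "over_alphabet \<beta>" "\<nexists>\<beta>'. \<beta> @ u = u @ \<beta>'"
  shows "(proj C * ghosts u) * (proj B * edges \<beta> * proj B) * (edges u * proj C) \<approx> 0"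
proof -
  have "take (length u) (\<beta> @ u) \<noteq> u"
    using assms(6) by (metis append_take_drop_id)
  then have "ghosts u * edges (\<beta> @ u) \<approx> 0"
    using assms by (intro ghosts_edges_diff) auto
  then have "proj C * (ghosts u * edges (\<beta> @ u)) * proj C \<approx> 0"
    by (intro cong_mult_zero(1)[OF cong_mult_zero(2)])
  then have "proj C * ghosts u * edges (\<beta> @ u) * proj C \<approx> 0"
    by (simp only: mult.assoc)
  with compress_step[OF assms(1-4), of \<beta>] show ?thesis
    by (rule pres_cong_trans)
qed

lemma corner_term_zero:
  assumes "C \<in> \<B>" "over_alphabet \<beta>" "C \<inter> rel C \<beta> = {}"
  shows "proj C * edges \<beta> * proj C \<approx> 0"
proof -
  have "proj C * edges \<beta> * proj C \<approx> edges \<beta> * proj (rel C \<beta>) * proj C"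
    using assms by (intro cong_mult_right proj_edges)
  also have "\<dots> = edges \<beta> * (proj (rel C \<beta>) * proj C)"
    by (simp add: mult.assoc)
  also have "\<dots> \<approx> edges \<beta> * proj (rel C \<beta> \<inter> C)"
    using assms by (intro cong_mult_left proj_mult) auto
  also have "rel C \<beta> \<inter> C = {}"
    using assms(3) by blast
  also have "edges \<beta> * proj {} \<approx> 0"
    by (intro cong_mult_zero(2) proj_empty)
  finally show ?thesis .
qed

section \<open>Elements without ghosts\<close>

abbreviation gens :: "('v, 'l) lpa_gen set" where
  "gens \<equiv> lpa_gens E lab \<B>"

lemma const_poly_left_commute: "x * (const_poly k * y) = const_poly k * (x * y)"
  by (metis const_poly_commute mult.assoc)

text \<open>The pattern behind both reductions below: multiplication sends each term of a sum to a term with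
  another word or to zero, and distinct surviving words stay distinct.\<close>

lemma cong_sum_transport:
  assumes "finite W" "V \<subseteq> W" "inj_on h V"
    and "\<And>\<gamma>. \<gamma> \<in> V \<Longrightarrow> f \<gamma> \<approx> g (h \<gamma>)" and "\<And>\<gamma>. \<gamma> \<in> W - V \<Longrightarrow> f \<gamma> \<approx> 0"
  shows "sum f W \<approx> sum g (h ` V)"
proof -
  have "sum f W \<approx> (\<Sum>\<gamma>\<in>W. if \<gamma> \<in> V then g (h \<gamma>) else 0)"
    using assms by (intro pres_cong_sum) auto
  also have "\<dots> = (\<Sum>\<gamma>\<in>V. g (h \<gamma>))"
    using assms by (simp add: sum.inter_restrict[symmetric] Int_absorb1)
  also have "\<dots> = sum g (h ` V)"
    using assms(3) by (simp add: sum.reindex)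
  finally show ?thesis .
qed

lemma free_mult_ghosts: "x \<in> free_algebra gens \<Longrightarrow> over_alphabet u \<Longrightarrow> x * ghosts u \<in> free_algebra gens"
proof (induction u)
  case (Cons a u)
  then show ?case
    using free_algebra_mult[of "x * ghosts u" gens "ghost a"] by (simp add: mult.assoc)
qed simp

lemma free_edges_mult: "x \<in> free_algebra gens \<Longrightarrow> over_alphabet u \<Longrightarrow> edges u * x \<in> free_algebra gens"
proof (induction u)
  case (Cons a u)
  then show ?case
    using free_algebra_mult[of "edge a" gens "edges u * x"] by (simp add: mult.assoc)
qed simp

definition corner_data :: "'l list set \<Rightarrow> ('l list \<Rightarrow> 'k) \<Rightarrow> 'v set \<Rightarrow> bool" where
  "corner_data W \<kappa> B \<longleftrightarrow> finite W \<and> [] \<in> W \<and> \<kappa> [] \<noteq> 0 \<and> B \<in> \<B> \<and> B \<noteq> {} \<and> (\<forall>\<beta>\<in>W. over_alphabet \<beta>)"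

lemma free_const_mult: "x \<in> free_algebra G \<Longrightarrow> const_poly k * x \<in> free_algebra G"
  using free_algebra_scalar[of x G k] by (simp add: scalar_def)

lemma corner_free: "corner_data W \<kappa> B \<Longrightarrow> corner W \<kappa> B \<in> free_algebra gens"
  unfolding corner_def mult.assoc
  by (intro free_algebra_sum free_const_mult free_algebra_mult free_edges_mult) (auto simp: corner_data_def)

lemma corner_nonzero: "corner_data W \<kappa> B \<Longrightarrow> \<not> corner W \<kappa> B \<approx> 0"
  using corner_not_in_ideal[of B W \<kappa>] corner_free[of W \<kappa> B]
  by (simp add: pres_cong_def restrict_gens_free_algebra corner_data_def)

text \<open>The data of a ghost-free element \<open>\<Sum>\<^bsub>\<alpha>\<in>W\<^esub> \<kappa>\<^sub>\<alpha> s\<^sub>\<alpha> p\<^sub>B\<close>. The condition \<open>B \<subseteq> r(\<alpha>)\<close> ensures that no term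
  degenerates: without it \<open>s\<^sub>\<alpha> p\<^sub>B\<close> could be zero or equal to \<open>s\<^sub>\<alpha>\<close> times a smaller projection.\<close>

definition real_data :: "'l list set \<Rightarrow> ('l list \<Rightarrow> 'k) \<Rightarrow> 'v set \<Rightarrow> bool" where
  "real_data W \<kappa> B \<longleftrightarrow> finite W \<and> W \<noteq> {} \<and> B \<in> \<B> \<and> B \<noteq> {} \<and>
    (\<forall>\<alpha>\<in>W. over_alphabet \<alpha> \<and> \<kappa> \<alpha> \<noteq> 0 \<and> B \<subseteq> ran \<alpha>)"

definition real_part :: "'l list set \<Rightarrow> ('l list \<Rightarrow> 'k) \<Rightarrow> ('v, 'l) lpa_gen free_word \<Rightarrow>\<^sub>0 'k" where
  "real_part W \<kappa> = (\<Sum>\<alpha>\<in>W. const_poly (\<kappa> \<alpha>) * edges \<alpha>)"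

text \<open>Multiply by \<open>p\<^sub>B s\<^sub>\<alpha>\<^sup>*\<close> for a shortest \<open>\<alpha>\<close> in \<open>W\<close>: the term of \<open>\<alpha>\<close> becomes the constant term, and the
  other terms either start with \<open>\<alpha>\<close> and lose this prefix, or vanish.\<close>

lemma real_data_to_corner:
  assumes "real_data W \<kappa> B"
  obtains a W' \<kappa>' where "a \<in> free_algebra gens" "corner_data W' \<kappa>' B"
    "a * (real_part W \<kappa> * proj B) \<approx> corner W' \<kappa>' B"
proof -
  obtain \<alpha> where \<alpha>: "\<alpha> \<in> W" and least: "\<And>\<gamma>. \<gamma> \<in> W \<Longrightarrow> length \<alpha> \<le> length \<gamma>"
    using assms ex_has_least_nat[of "\<lambda>\<gamma>. \<gamma> \<in> W" _ length] unfolding real_data_def by blast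
  define V where "V = {\<gamma> \<in> W. \<exists>\<delta>. \<gamma> = \<alpha> @ \<delta>}"
  define a where "a = proj B * ghosts \<alpha>"
  define \<kappa>' where "\<kappa>' \<delta> = \<kappa> (\<alpha> @ \<delta>)" for \<delta>
  have B: "B \<in> \<B>" "B \<subseteq> ran \<alpha>" and over: "\<And>\<gamma>. \<gamma> \<in> W \<Longrightarrow> over_alphabet \<gamma>"
    using assms \<alpha> by (auto simp: real_data_def)
  have eq: "a * (real_part W \<kappa> * proj B) =
      (\<Sum>\<gamma>\<in>W. const_poly (\<kappa> \<gamma>) * (proj B * (ghosts \<alpha> * edges \<gamma>) * proj B))"
    by (simp add: a_def real_part_def sum_distrib_left sum_distrib_right mult.assoc
        const_poly_left_commute)
  have "a * (real_part W \<kappa> * proj B) \<approx>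
      (\<Sum>\<beta>\<in>drop (length \<alpha>) ` V. const_poly (\<kappa>' \<beta>) * (proj B * edges \<beta> * proj B))"
    unfolding eq
  proof (rule cong_sum_transport)
    show "inj_on (drop (length \<alpha>)) V"
      by (auto simp: inj_on_def V_def)
    show "const_poly (\<kappa> \<gamma>) * (proj B * (ghosts \<alpha> * edges \<gamma>) * proj B) \<approx>
        const_poly (\<kappa>' (drop (length \<alpha>) \<gamma>)) * (proj B * edges (drop (length \<alpha>) \<gamma>) * proj B)" if "\<gamma> \<in> V" for \<gamma>
    proof -
      obtain \<delta> where \<delta>: "\<gamma> = \<alpha> @ \<delta>" "\<gamma> \<in> W"
        using \<open>\<gamma> \<in> V\<close> by (auto simp: V_def)
      have "proj B * ghosts \<alpha> * edges (\<alpha> @ \<delta>) * proj B \<approx> proj B * edges \<delta> * proj B"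
        using over[OF \<delta>(2)] B by (intro cong_mult_right corner_strip) (auto simp: \<delta>)
      then show ?thesis
        using cong_mult_left by (simp add: \<delta> \<kappa>'_def mult.assoc)
    qed
    show "const_poly (\<kappa> \<gamma>) * (proj B * (ghosts \<alpha> * edges \<gamma>) * proj B) \<approx> 0" if "\<gamma> \<in> W - V" for \<gamma>
    proof -
      have "take (length \<alpha>) \<gamma> \<noteq> \<alpha>"
      proof
        assume "take (length \<alpha>) \<gamma> = \<alpha>"
        then have "\<gamma> = \<alpha> @ drop (length \<alpha>) \<gamma>"
          by (metis append_take_drop_id)
        then show False
          using that unfolding V_def by blast
      qed
      then have "ghosts \<alpha> * edges \<gamma> \<approx> 0"
        using that least over \<alpha> by (intro ghosts_edges_diff) auto
      then show ?thesis
        by (rule cong_mult_zero(2)[OF cong_mult_zero(1)[OF cong_mult_zero(2)]])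
    qed
  qed (use assms in \<open>auto simp: real_data_def V_def\<close>)
  moreover have "corner_data (drop (length \<alpha>) ` V) \<kappa>' B"
    using assms \<alpha> by (auto simp: corner_data_def real_data_def V_def \<kappa>'_def image_iff
        dest: in_set_dropD)
  moreover have "a \<in> free_algebra gens"
    using B over \<alpha> unfolding a_def by (intro free_mult_ghosts) auto
  ultimately show thesis
    using that unfolding corner_def by blast
qed

lemma real_part_nonzero:
  assumes "real_data W \<kappa> B"
  shows "\<not> real_part W \<kappa> * proj B \<approx> 0"
proof
  assume "real_part W \<kappa> * proj B \<approx> 0"
  moreover obtain a W' \<kappa>' where "corner_data W' \<kappa>' B" "a * (real_part W \<kappa> * proj B) \<approx> corner W' \<kappa>' B"
    using real_data_to_corner[OF assms] by blast
  ultimately show False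
    using corner_nonzero pres_cong_trans pres_cong_sym cong_mult_zero(2) by blast
qed

text \<open>Refining \<open>A\<close> by one set \<open>F\<close> splits \<open>z p\<^sub>B\<close> into \<open>z p\<^bsub>B\<inter>F\<^esub> + z p\<^bsub>B-F\<^esub>\<close>, and one summand stays
  nonzero. In this way elements are brought to a set on which all projections that occur in them are
  constant, which spares a discussion of linear relations between the \<open>p\<^sub>A\<close>.\<close>

lemma localise:
  assumes "finite \<F>" "\<F> \<subseteq> \<B>" "A \<in> \<B>" "\<not> z * proj A \<approx> 0"
  obtains B where "B \<in> \<B>" "B \<subseteq> A" "\<not> z * proj B \<approx> 0" "\<And>F. F \<in> \<F> \<Longrightarrow> B \<subseteq> F \<or> B \<inter> F = {}"
proof -
  have "\<exists>B\<in>\<B>. B \<subseteq> A \<and> \<not> z * proj B \<approx> 0 \<and> (\<forall>F\<in>\<F>. B \<subseteq> F \<or> B \<inter> F = {})"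
    using assms(1,2)
  proof (induction \<F>)
    case empty
    then show ?case
      using assms(3,4) by auto
  next
    case (insert F \<F>)
    then obtain B where B: "B \<in> \<B>" "B \<subseteq> A" "\<not> z * proj B \<approx> 0" "\<forall>F\<in>\<F>. B \<subseteq> F \<or> B \<inter> F = {}"
      by auto
    have "z * proj B \<approx> z * (proj (B \<inter> F) + proj (B - F))"
      using B insert.prems by (intro cong_mult_left proj_split) auto
    then have "z * proj B \<approx> z * proj (B \<inter> F) + z * proj (B - F)"
      by (simp add: distrib_left)
    then consider "\<not> z * proj (B \<inter> F) \<approx> 0" | "\<not> z * proj (B - F) \<approx> 0"
      using B(3) pres_cong_add[of gens relators "z * proj (B \<inter> F)" 0 "z * proj (B - F)" 0] pres_cong_trans
      by fastforce
    then show ?case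
    proof cases
      case 1
      then show ?thesis
        using B insert.prems by (intro bexI[of _ "B \<inter> F"]) (auto simp: family_Int)
    next
      case 2
      then show ?thesis
        using B insert.prems by (intro bexI[of _ "B - F"]) (auto simp: family_Diff)
    qed
  qed
  then show thesis
    using that by blast
qed

text \<open>On a homogeneous \<open>B\<close> the term of \<open>i\<close> is either \<open>k\<^sub>i s\<^bsub>\<alpha>\<^sub>i\<^esub> p\<^sub>B\<close> or zero. Collecting equal words and
  dropping zero coefficients leaves real data, except that the set of words may be empty.\<close>

lemma real_sum_localised:
  assumes "finite I" "B \<in> \<B>"
    and valid: "\<And>i. i \<in> I \<Longrightarrow> over_alphabet (\<alpha> i) \<and> A i \<in> \<B>"
    and homogeneous: "\<And>i. i \<in> I \<Longrightarrow> B \<subseteq> A i \<inter> ran (\<alpha> i) \<or> B \<inter> (A i \<inter> ran (\<alpha> i)) = {}"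
  obtains W \<kappa> where "finite W" "\<And>\<gamma>. \<gamma> \<in> W \<Longrightarrow> over_alphabet \<gamma> \<and> \<kappa> \<gamma> \<noteq> 0 \<and> B \<subseteq> ran \<gamma>"
    "(\<Sum>i\<in>I. const_poly (k i) * (edges (\<alpha> i) * proj (A i))) * proj B \<approx> real_part W \<kappa> * proj B"
proof
  define J where "J = {i \<in> I. B \<subseteq> A i \<inter> ran (\<alpha> i)}"
  define \<kappa> where "\<kappa> \<gamma> = (\<Sum>i\<in>{i \<in> J. \<alpha> i = \<gamma>}. k i)" for \<gamma>
  define W where "W = {\<gamma> \<in> \<alpha> ` J. \<kappa> \<gamma> \<noteq> 0}"
  have fin: "finite J"
    using assms(1) by (simp add: J_def)
  show "finite W"
    using fin by (simp add: W_def)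
  show "over_alphabet \<gamma> \<and> \<kappa> \<gamma> \<noteq> 0 \<and> B \<subseteq> ran \<gamma>" if "\<gamma> \<in> W" for \<gamma>
    using that valid by (auto simp: W_def J_def)
  have summand: "edges (\<alpha> i) * proj (A i) * proj B \<approx> (if i \<in> J then edges (\<alpha> i) * proj B else 0)" if "i \<in> I" for i
  proof -
    have "edges (\<alpha> i) * proj (A i) * proj B \<approx> edges (\<alpha> i) * proj (A i \<inter> ran (\<alpha> i)) * proj B"
      using valid[OF that] by (intro cong_mult_right edges_proj_ran) auto
    also have "\<dots> = edges (\<alpha> i) * (proj (A i \<inter> ran (\<alpha> i)) * proj B)"
      by (simp add: mult.assoc)
    also have "\<dots> \<approx> edges (\<alpha> i) * proj (A i \<inter> ran (\<alpha> i) \<inter> B)"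
      using valid[OF that] assms(2) by (intro cong_mult_left proj_mult) auto
    also have "\<dots> \<approx> (if i \<in> J then edges (\<alpha> i) * proj B else 0)"
    proof (cases "i \<in> J")
      case True
      then have "A i \<inter> ran (\<alpha> i) \<inter> B = B"
        by (auto simp: J_def)
      then show ?thesis
        using True by simp
    next
      case False
      then have "A i \<inter> ran (\<alpha> i) \<inter> B = {}"
        using homogeneous[OF that] that by (auto simp: J_def)
      then show ?thesis
        using False cong_mult_zero(2)[OF proj_empty] by simp
    qed
    finally show ?thesis .
  qed
  have "(\<Sum>i\<in>I. const_poly (k i) * (edges (\<alpha> i) * proj (A i))) * proj B =
      (\<Sum>i\<in>I. const_poly (k i) * (edges (\<alpha> i) * proj (A i) * proj B))"
    by (simp add: sum_distrib_right mult.assoc)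
  also have "\<dots> \<approx> (\<Sum>i\<in>I. const_poly (k i) * (if i \<in> J then edges (\<alpha> i) * proj B else 0))"
    by (intro pres_cong_sum cong_mult_left summand)
  also have "\<dots> = (\<Sum>i\<in>I. if i \<in> J then const_poly (k i) * (edges (\<alpha> i) * proj B) else 0)"
    by (intro sum.cong) auto
  also have "\<dots> = (\<Sum>i\<in>J. const_poly (k i) * (edges (\<alpha> i) * proj B))"
    using assms(1) by (simp add: sum.inter_restrict[symmetric]) (auto simp: J_def intro: sum.cong)
  also have "\<dots> = (\<Sum>\<gamma>\<in>\<alpha> ` J. \<Sum>i\<in>{i \<in> J. \<alpha> i = \<gamma>}. const_poly (k i) * (edges (\<alpha> i) * proj B))"
    by (rule sum.image_gen[OF fin])
  also have "\<dots> = (\<Sum>\<gamma>\<in>\<alpha> ` J. const_poly (\<kappa> \<gamma>) * (edges \<gamma> * proj B))"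
  proof (rule sum.cong[OF refl])
    fix \<gamma>
    have "(\<Sum>i\<in>{i \<in> J. \<alpha> i = \<gamma>}. const_poly (k i) * (edges (\<alpha> i) * proj B)) =
        (\<Sum>i\<in>{i \<in> J. \<alpha> i = \<gamma>}. const_poly (k i)) * (edges \<gamma> * proj B)"
      unfolding sum_distrib_right by (intro sum.cong) auto
    also have "(\<Sum>i\<in>{i \<in> J. \<alpha> i = \<gamma>}. const_poly (k i)) = const_poly (\<kappa> \<gamma>)"
      unfolding \<kappa>_def by (rule additive_sum[symmetric]) (rule single_add)
    finally show "(\<Sum>i\<in>{i \<in> J. \<alpha> i = \<gamma>}. const_poly (k i) * (edges (\<alpha> i) * proj B)) =
        const_poly (\<kappa> \<gamma>) * (edges \<gamma> * proj B)" .
  qed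
  also have "\<dots> = (\<Sum>\<gamma>\<in>W. const_poly (\<kappa> \<gamma>) * (edges \<gamma> * proj B))"
    using fin by (intro sum.mono_neutral_right) (auto simp: W_def)
  finally show "(\<Sum>i\<in>I. const_poly (k i) * (edges (\<alpha> i) * proj (A i))) * proj B \<approx> real_part W \<kappa> * proj B"
    by (simp add: real_part_def sum_distrib_right mult.assoc)
qed

section \<open>Removing the ghosts\<close>

definition monomial :: "'l list \<times> 'v set \<times> 'l list \<Rightarrow> ('v, 'l) lpa_gen free_word \<Rightarrow>\<^sub>0 'k" where
  "monomial = (\<lambda>(\<alpha>, A, \<beta>). edges \<alpha> * proj A * ghosts \<beta>)"

definition monomial_data :: "('l list \<times> 'v set \<times> 'l list) set" where
  "monomial_data = {(\<alpha>, A, \<beta>). over_alphabet \<alpha> \<and> A \<in> \<B> \<and> over_alphabet \<beta>}"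

abbreviation ghost_length :: "'l list \<times> 'v set \<times> 'l list \<Rightarrow> nat" where
  "ghost_length m \<equiv> length (snd (snd m))"

text \<open>Zero is itself a monomial. So products of monomials with generators are again single monomials, and a
  combination of them keeps its index set under multiplication.\<close>

lemma monomial_zero: "([], {}, []) \<in> monomial_data" "monomial ([], {}, []) \<approx> 0"
  by (simp_all add: monomial_data_def monomial_def proj_empty)

lemma generator_monomial:
  assumes "g \<in> gens"
  shows "\<exists>m \<in> monomial_data. generator g \<approx> monomial m"
proof (cases g)
  case (Proj A)
  then show ?thesis
    using assms by (intro bexI[of _ "([], A, [])"]) (simp_all add: monomial_def monomial_data_def)
next
  case (Edge a)
  then show ?thesis
    using assms pres_cong_sym[OF edge_ran[of a]]
    by (intro bexI[of _ "([a], ran [a], [])"]) (simp_all add: monomial_def monomial_data_def)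
next
  case (Ghost a)
  then show ?thesis
    using assms pres_cong_sym[OF ran_ghost[of a]]
    by (intro bexI[of _ "([], ran [a], [a])"]) (simp_all add: monomial_def monomial_data_def)
qed

lemma generator_times_monomial:
  assumes "g \<in> gens" "m \<in> monomial_data"
  shows "\<exists>m' \<in> monomial_data. generator g * monomial m \<approx> monomial m'"
proof -
  obtain \<alpha> A \<beta> where m: "m = (\<alpha>, A, \<beta>)" "over_alphabet \<alpha>" "A \<in> \<B>" "over_alphabet \<beta>"
    using assms(2) by (auto simp: monomial_data_def)
  show ?thesis
  proof (cases g)
    case (Proj B)
    then have B: "B \<in> \<B>"
      using assms(1) by simp
    have "proj B * monomial m = (proj B * edges \<alpha>) * proj A * ghosts \<beta>"
      by (simp add: m monomial_def mult.assoc)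
    also have "\<dots> \<approx> (edges \<alpha> * proj (rel B \<alpha>)) * proj A * ghosts \<beta>"
      using B m by (intro cong_mult_right proj_edges)
    also have "\<dots> = edges \<alpha> * (proj (rel B \<alpha>) * proj A) * ghosts \<beta>"
      by (simp add: mult.assoc)
    also have "\<dots> \<approx> edges \<alpha> * proj (rel B \<alpha> \<inter> A) * ghosts \<beta>"
      using B m by (intro cong_mult_mid proj_mult) auto
    finally show ?thesis
      using B m unfolding Proj
      by (intro bexI[of _ "(\<alpha>, rel B \<alpha> \<inter> A, \<beta>)"]) (simp_all add: monomial_def monomial_data_def family_Int)
  next
    case (Edge a)
    then show ?thesis
      using assms(1) m
      by (intro bexI[of _ "(a # \<alpha>, A, \<beta>)"]) (simp_all add: monomial_def monomial_data_def mult.assoc)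
  next
    case (Ghost a)
    then have a: "a \<in> alphabet E lab"
      using assms(1) by simp
    show ?thesis
    proof (cases \<alpha>)
      case Nil
      have "ghost a * monomial m = (ghost a * proj A) * ghosts \<beta>"
        by (simp add: m Nil monomial_def mult.assoc)
      also have "\<dots> \<approx> (proj (rel A [a]) * ghost a) * ghosts \<beta>"
        using a m by (intro cong_mult_right ghost_proj)
      also have "\<dots> = monomial ([], rel A [a], \<beta> @ [a])"
        by (simp add: monomial_def mult.assoc)
      finally show ?thesis
        using a m unfolding Ghost
        by (intro bexI[of _ "([], rel A [a], \<beta> @ [a])"]) (simp_all add: monomial_data_def)
    next
      case (Cons b \<delta>)
      have eq: "ghost a * monomial m = (ghost a * edge b) * edges \<delta> * proj A * ghosts \<beta>"
        by (simp add: m Cons monomial_def mult.assoc)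
      show ?thesis
      proof (cases "a = b")
        case True
        have "(ghost a * edge b) * edges \<delta> * proj A * ghosts \<beta> \<approx> proj (ran [a]) * edges \<delta> * proj A * ghosts \<beta>"
          unfolding True[symmetric] using a by (intro cong_mult_right ghost_edge_same)
        also have "\<dots> \<approx> edges \<delta> * proj (rel (ran [a]) \<delta>) * proj A * ghosts \<beta>"
          using m by (intro cong_mult_right proj_edges) (auto simp: Cons)
        also have "\<dots> = edges \<delta> * (proj (rel (ran [a]) \<delta>) * proj A) * ghosts \<beta>"
          by (simp add: mult.assoc)
        also have "\<dots> \<approx> edges \<delta> * proj (rel (ran [a]) \<delta> \<inter> A) * ghosts \<beta>"
          using m by (intro cong_mult_mid proj_mult) auto
        finally show ?thesis
          using m unfolding Ghost eq[symmetric]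
          by (intro bexI[of _ "(\<delta>, rel (ran [a]) \<delta> \<inter> A, \<beta>)"])
            (simp_all add: monomial_def monomial_data_def family_Int Cons)
      next
        case False
        have "(ghost a * edge b) * edges \<delta> * proj A * ghosts \<beta> \<approx> 0"
          using a m False by (intro cong_mult_zero(1) ghost_edge_diff) (auto simp: Cons)
        then have "ghost a * monomial m \<approx> monomial ([], {}, [])"
          unfolding eq using pres_cong_sym[OF monomial_zero(2)] by (rule pres_cong_trans)
        then show ?thesis
          unfolding Ghost using monomial_zero(1) by blast
      qed
    qed
  qed
qed

lemma word_monomial:
  assumes "w \<noteq> []" "set w \<subseteq> gens"
  shows "\<exists>m \<in> monomial_data. Poly_Mapping.single (Word w) 1 \<approx> monomial m"
  using assms
proof (induction w rule: list_nonempty_induct)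
  case (single g)
  then show ?case
    using generator_monomial[of g] by (simp add: generator_def)
next
  case (cons g w)
  then obtain m where m: "m \<in> monomial_data" "Poly_Mapping.single (Word w) 1 \<approx> monomial m"
    by auto
  have "Poly_Mapping.single (Word (g # w)) 1 = generator g * Poly_Mapping.single (Word w) (1 :: 'k)"
    by (simp add: generator_def mult_single plus_free_word_def)
  also have "\<dots> \<approx> generator g * monomial m"
    by (intro cong_mult_left m)
  finally show ?case
    using generator_times_monomial[of g m] cons.prems m(1) pres_cong_trans by fastforce
qed

lemma free_algebra_monomials:
  assumes "x \<in> free_algebra gens"
  obtains k m where "\<And>w. w \<in> Poly_Mapping.keys x \<Longrightarrow> m w \<in> monomial_data"
    "x \<approx> (\<Sum>w\<in>Poly_Mapping.keys x. const_poly (k w) * monomial (m w))"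
proof -
  have "\<exists>m \<in> monomial_data. Poly_Mapping.single w 1 \<approx> monomial m" if "w \<in> Poly_Mapping.keys x" for w
    using that assms word_monomial[of "letters w"] by (auto simp: free_algebra_def)
  then obtain m where m: "\<And>w. w \<in> Poly_Mapping.keys x \<Longrightarrow> m w \<in> monomial_data"
      "\<And>w. w \<in> Poly_Mapping.keys x \<Longrightarrow> Poly_Mapping.single w 1 \<approx> monomial (m w)"
    by metis
  have "x = (\<Sum>w\<in>Poly_Mapping.keys x. Poly_Mapping.single w (Poly_Mapping.lookup x w))"
    by (rule poly_mapping_as_sum)
  also have "\<dots> = (\<Sum>w\<in>Poly_Mapping.keys x. const_poly (Poly_Mapping.lookup x w) * Poly_Mapping.single w 1)"
    by (simp add: mult_single)
  also have "\<dots> \<approx> (\<Sum>w\<in>Poly_Mapping.keys x. const_poly (Poly_Mapping.lookup x w) * monomial (m w))"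
    by (intro pres_cong_sum cong_mult_left m)
  finally show thesis
    using that m(1) by blast
qed

lemma monomial_times_edge_same:
  assumes "(\<alpha>, A, a # \<beta>) \<in> monomial_data"
  shows "monomial (\<alpha>, A, a # \<beta>) * edge a \<approx> monomial (\<alpha>, A \<inter> rel (ran [a]) \<beta>, \<beta>)"
proof -
  have "monomial (\<alpha>, A, a # \<beta>) * edge a = edges \<alpha> * proj A * (ghosts \<beta> * (ghost a * edge a))"
    by (simp add: monomial_def mult.assoc)
  also have "\<dots> \<approx> edges \<alpha> * proj A * (ghosts \<beta> * proj (ran [a]))"
    using assms by (intro cong_mult_left ghost_edge_same) (simp add: monomial_data_def)
  also have "\<dots> \<approx> edges \<alpha> * proj A * (proj (rel (ran [a]) \<beta>) * ghosts \<beta>)"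
    using assms by (intro cong_mult_left ghosts_proj) (simp_all add: monomial_data_def)
  also have "\<dots> = edges \<alpha> * (proj A * proj (rel (ran [a]) \<beta>)) * ghosts \<beta>"
    by (simp add: mult.assoc)
  also have "\<dots> \<approx> edges \<alpha> * proj (A \<inter> rel (ran [a]) \<beta>) * ghosts \<beta>"
    using assms by (intro cong_mult_mid proj_mult) (simp_all add: monomial_data_def)
  finally show ?thesis
    by (simp add: monomial_def)
qed

lemma monomial_times_edge_diff:
  assumes "(\<alpha>, A, b # \<beta>) \<in> monomial_data" "a \<in> alphabet E lab" "a \<noteq> b"
  shows "monomial (\<alpha>, A, b # \<beta>) * edge a \<approx> 0"
proof -
  have "monomial (\<alpha>, A, b # \<beta>) * edge a = edges \<alpha> * proj A * ghosts \<beta> * (ghost b * edge a)"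
    by (simp add: monomial_def mult.assoc)
  also have "\<dots> \<approx> 0"
    using assms by (intro cong_mult_zero(2) ghost_edge_diff) (auto simp: monomial_data_def)
  finally show ?thesis .
qed

lemma monomial_times_edge_Nil:
  assumes "(\<alpha>, A, []) \<in> monomial_data" "a \<in> alphabet E lab"
  shows "monomial (\<alpha>, A, []) * edge a \<approx> monomial (\<alpha> @ [a], rel A [a], [])"
proof -
  have "monomial (\<alpha>, A, []) * edge a = edges \<alpha> * (proj A * edge a)"
    by (simp add: monomial_def mult.assoc)
  also have "\<dots> \<approx> edges \<alpha> * (edge a * proj (rel A [a]))"
    using assms by (intro cong_mult_left proj_edge) (auto simp: monomial_data_def)
  also have "\<dots> = monomial (\<alpha> @ [a], rel A [a], [])"
    by (simp add: monomial_def mult.assoc)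
  finally show ?thesis .
qed

lemma monomial_times_edge:
  assumes "m \<in> monomial_data" "a \<in> alphabet E lab"
  shows "\<exists>m' \<in> monomial_data. ghost_length m' \<le> ghost_length m - 1 \<and> monomial m * edge a \<approx> monomial m'"
proof -
  obtain \<alpha> A \<beta> where m: "m = (\<alpha>, A, \<beta>)"
    by (cases m)
  show ?thesis
  proof (cases \<beta>)
    case Nil
    then show ?thesis
      using assms monomial_times_edge_Nil[of \<alpha> A a]
      by (intro bexI[of _ "(\<alpha> @ [a], rel A [a], [])"]) (auto simp: m monomial_data_def)
  next
    case (Cons b \<delta>)
    show ?thesis
    proof (cases "a = b")
      case True
      then show ?thesis
        using assms monomial_times_edge_same[of \<alpha> A a \<delta>]
        by (intro bexI[of _ "(\<alpha>, A \<inter> rel (ran [a]) \<delta>, \<delta>)"]) (auto simp: m Cons monomial_data_def family_Int)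
    next
      case False
      then have "monomial m * edge a \<approx> monomial ([], {}, [])"
        using assms monomial_times_edge_diff[of \<alpha> A b \<delta> a] pres_cong_sym[OF monomial_zero(2)] pres_cong_trans
        unfolding m Cons by blast
      then show ?thesis
        using monomial_zero(1) by (intro bexI[of _ "([], {}, [])"]) auto
    qed
  qed
qed

text \<open>The idempotents \<open>s\<^sub>a s\<^sub>a\<^sup>*\<close> are orthogonal; their sum over \<open>F\<close> acts as a unit from the right on monomials
  whose ghost starts with a letter of \<open>F\<close>.\<close>

definition range_part :: "'l set \<Rightarrow> ('v, 'l) lpa_gen free_word \<Rightarrow>\<^sub>0 'k" where
  "range_part F = (\<Sum>a\<in>F. edge a * ghost a)"

lemma monomial_range_part:
  assumes "(\<alpha>, A, b # \<beta>) \<in> monomial_data" "b \<in> F" "finite F" "F \<subseteq> alphabet E lab"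
  shows "monomial (\<alpha>, A, b # \<beta>) * range_part F \<approx> monomial (\<alpha>, A, b # \<beta>)"
proof -
  have "monomial (\<alpha>, A, b # \<beta>) * (edge a * ghost a) \<approx> (if a = b then monomial (\<alpha>, A, b # \<beta>) else 0)"
    if "a \<in> F" for a
  proof (cases "a = b")
    case True
    have "monomial (\<alpha>, A, b # \<beta>) * (edge b * ghost b) = edges \<alpha> * proj A * ghosts \<beta> * (ghost b * edge b * ghost b)"
      by (simp add: monomial_def mult.assoc)
    also have "\<dots> \<approx> edges \<alpha> * proj A * ghosts \<beta> * ghost b"
      using assms by (intro cong_mult_left ghost_edge_ghost) auto
    finally show ?thesis
      using True by (simp add: monomial_def mult.assoc)
  next
    case False
    then have "monomial (\<alpha>, A, b # \<beta>) * edge a * ghost a \<approx> 0"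
      using assms that by (intro cong_mult_zero(1) monomial_times_edge_diff) auto
    then show ?thesis
      using False by (simp add: mult.assoc)
  qed
  then have "(\<Sum>a\<in>F. monomial (\<alpha>, A, b # \<beta>) * (edge a * ghost a)) \<approx>
      (\<Sum>a\<in>F. if a = b then monomial (\<alpha>, A, b # \<beta>) else 0)"
    by (rule pres_cong_sum)
  then show ?thesis
    using assms by (simp add: range_part_def sum_distrib_left)
qed

lemma range_part_proj:
  assumes "B \<in> \<B>" "F \<subseteq> alphabet E lab"
  shows "range_part F * proj B \<approx> proj B * range_part F"
proof -
  have "edge a * ghost a * proj B \<approx> proj B * (edge a * ghost a)" if "a \<in> F" for a
  proof -
    have "edge a * ghost a * proj B = edge a * (ghost a * proj B)"
      by (simp add: mult.assoc)
    also have "\<dots> \<approx> edge a * (proj (rel B [a]) * ghost a)"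
      using assms that by (intro cong_mult_left ghost_proj) auto
    also have "\<dots> = (edge a * proj (rel B [a])) * ghost a"
      by (simp add: mult.assoc)
    also have "\<dots> \<approx> (proj B * edge a) * ghost a"
      using assms that by (intro cong_mult_right pres_cong_sym[OF proj_edge]) auto
    finally show ?thesis
      by (simp add: mult.assoc)
  qed
  then show ?thesis
    unfolding range_part_def sum_distrib_left sum_distrib_right by (rule pres_cong_sum)
qed

lemma proj_edge_zero:
  assumes "B \<in> \<B>" "a \<in> alphabet E lab" "rel B [a] = {}"
  shows "proj B * edge a \<approx> 0"
  using proj_edge[OF assms(1,2)] cong_mult_zero(2)[OF proj_empty] pres_cong_trans unfolding assms(3) by blast

lemma proj_range_part_zero:
  assumes "B \<in> \<B>" "F \<subseteq> alphabet E lab" "\<And>a. a \<in> F \<Longrightarrow> rel B [a] = {}"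
  shows "proj B * range_part F \<approx> 0"
proof -
  have "(\<Sum>a\<in>F. proj B * edge a * ghost a) \<approx> (\<Sum>a\<in>F. 0)"
    using assms by (intro pres_cong_sum cong_mult_zero(1) proj_edge_zero) auto
  then show ?thesis
    by (simp add: range_part_def sum_distrib_left mult.assoc)
qed

text \<open>Here the last defining relation enters: it writes \<open>p\<^sub>B\<close> as a sum over the edges leaving \<open>B\<close>, and the
  letters of \<open>F\<close> that label no such edge contribute nothing.\<close>

lemma proj_range_part_regular:
  assumes "B \<in> regular_sets E lab \<B>" "finite F" "F \<subseteq> alphabet E lab" "out_labels E lab B \<subseteq> F"
  shows "proj B * range_part F \<approx> proj B"
proof -
  have B: "B \<in> \<B>"
    using assms(1) by (rule regular_sets_family)
  have "proj B * (edge a * ghost a) \<approx>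
      (if a \<in> out_labels E lab B then edge a * proj (rel B [a]) * ghost a else 0)" if "a \<in> F" for a
  proof (cases "a \<in> out_labels E lab B")
    case True
    then show ?thesis
      using B assms that cong_mult_right[OF proj_edge[of B a], of "ghost a"] by (auto simp: mult.assoc)
  next
    case False
    then show ?thesis
      using B assms that cong_mult_zero(1)[OF proj_edge_zero[of B a], of "ghost a"]
      by (auto simp: out_labels_iff mult.assoc)
  qed
  then have "(\<Sum>a\<in>F. proj B * (edge a * ghost a)) \<approx>
      (\<Sum>a\<in>F. if a \<in> out_labels E lab B then edge a * proj (rel B [a]) * ghost a else 0)"
    by (rule pres_cong_sum)
  also have "\<dots> = (\<Sum>a\<in>out_labels E lab B. edge a * proj (rel B [a]) * ghost a)"
    using assms(2,4) by (simp add: sum.inter_restrict[symmetric] Int_absorb1)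
  also have "\<dots> \<approx> proj B"
    by (rule pres_cong_sym[OF proj_regular[OF assms(1)]])
  finally show ?thesis
    by (simp add: range_part_def sum_distrib_left)
qed

lemma finite_Union_family: "finite I \<Longrightarrow> (\<And>i. i \<in> I \<Longrightarrow> A i \<in> \<B>) \<Longrightarrow> (\<Union>i\<in>I. A i) \<in> \<B>"
  by (induction I rule: finite_induct) (auto intro: family_Un)

text \<open>If \<open>r(B,a)\<close> were nonempty, \<open>\<Sum>\<^bsub>\<alpha>\<in>W\<^esub> \<kappa>\<^sub>\<alpha> s\<^bsub>\<alpha>a\<^esub> p\<^bsub>r(B,a)\<^esub>\<close> would be a ghost-free element of the
  nonzero kind.\<close>

lemma real_times_edge:
  assumes "real_data W \<kappa> B" "a \<in> alphabet E lab" "real_part W \<kappa> * proj B * edge a \<approx> 0"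
  shows "rel B [a] = {}"
proof (rule ccontr)
  assume ne: "rel B [a] \<noteq> {}"
  define W' where "W' = (\<lambda>\<alpha>. \<alpha> @ [a]) ` W"
  have B: "B \<in> \<B>" "B \<subseteq> verts E"
    using assms(1) family_subset by (auto simp: real_data_def)
  have "rel B [a] \<subseteq> ran (\<alpha> @ [a])" if "\<alpha> \<in> W" for \<alpha>
    unfolding ran_append using assms(1) that by (intro rel_mono) (simp add: real_data_def)
  then have "real_data W' (\<lambda>\<alpha>. \<kappa> (butlast \<alpha>)) (rel B [a])"
    using assms(1,2) ne B by (auto simp: real_data_def W'_def simp del: rel_Nil)
  then have "\<not> real_part W' (\<lambda>\<alpha>. \<kappa> (butlast \<alpha>)) * proj (rel B [a]) \<approx> 0"
    by (rule real_part_nonzero)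
  moreover have "real_part W' (\<lambda>\<alpha>. \<kappa> (butlast \<alpha>)) * proj (rel B [a]) =
      real_part W \<kappa> * (edge a * proj (rel B [a]))"
    unfolding real_part_def W'_def
    by (subst sum.reindex) (simp_all add: inj_on_def sum_distrib_right mult.assoc)
  moreover have "real_part W \<kappa> * (edge a * proj (rel B [a])) \<approx> 0"
  proof (rule pres_cong_trans)
    show "real_part W \<kappa> * (edge a * proj (rel B [a])) \<approx> real_part W \<kappa> * (proj B * edge a)"
      using B assms(2) by (intro cong_mult_left pres_cong_sym[OF proj_edge])
    show "real_part W \<kappa> * (proj B * edge a) \<approx> 0"
      using assms(3) by (simp add: mult.assoc)
  qed
  ultimately show False
    by simp
qed

text \<open>The end of the removal of ghosts: either there are none left, or every \<open>x s\<^sub>a\<close> is zero. In the second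
  case \<open>x = x\<^sub>0 e\<close> with \<open>x\<^sub>0\<close> free of ghosts and \<open>e = 1 - \<Sum>\<^bsub>a\<in>F\<^esub> s\<^sub>a s\<^sub>a\<^sup>*\<close>, and \<open>e\<close> commutes with
  projections. In the first case \<open>F\<close> is empty and \<open>e = 1\<close>, so most of the argument is shared.\<close>

lemma ghost_removal_step:
  assumes fin: "finite I" and m: "\<And>i. i \<in> I \<Longrightarrow> m i \<in> monomial_data"
    and x: "x \<approx> (\<Sum>i\<in>I. const_poly (k i) * monomial (m i))" and nz: "\<not> x \<approx> 0"
    and killed: "(\<forall>i\<in>I. ghost_length (m i) = 0) \<or> (\<forall>a\<in>alphabet E lab. x * edge a \<approx> 0)"
  shows "\<exists>B\<in>\<B>. \<exists>W \<kappa>. real_data W \<kappa> B \<and> x * proj B \<approx> real_part W \<kappa> * proj B"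
proof -
  define \<alpha> where "\<alpha> i = fst (m i)" for i
  define A where "A i = fst (snd (m i))" for i
  define \<beta> where "\<beta> i = snd (snd (m i))" for i
  have mi: "m i = (\<alpha> i, A i, \<beta> i)" for i
    by (simp add: \<alpha>_def A_def \<beta>_def)
  have valid: "over_alphabet (\<alpha> i)" "A i \<in> \<B>" "over_alphabet (\<beta> i)" if "i \<in> I" for i
    using m[OF that] by (auto simp: mi monomial_data_def)
  define I0 where "I0 = {i \<in> I. \<beta> i = []}"
  define I1 where "I1 = {i \<in> I. \<beta> i \<noteq> []}"
  define F where "F = (\<lambda>i. hd (\<beta> i)) ` I1"
  define x0 where "x0 = (\<Sum>i\<in>I0. const_poly (k i) * (edges (\<alpha> i) * proj (A i)))"
  define x1 where "x1 = (\<Sum>i\<in>I1. const_poly (k i) * monomial (m i))"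
  define e where "e = 1 - range_part F"
  have finI: "finite I0" "finite I1" "finite F" and I: "I = I0 \<union> I1" "I0 \<inter> I1 = {}"
    using fin by (auto simp: I0_def I1_def F_def)
  have FA: "F \<subseteq> alphabet E lab"
  proof
    fix a assume "a \<in> F"
    then obtain i where "i \<in> I" "\<beta> i \<noteq> []" "a = hd (\<beta> i)"
      by (auto simp: F_def I1_def)
    then show "a \<in> alphabet E lab"
      using valid(3)[of i] hd_in_set[of "\<beta> i"] by auto
  qed
  have xsplit: "x \<approx> x0 + x1"
  proof -
    have "(\<Sum>i\<in>I. const_poly (k i) * monomial (m i)) =
        (\<Sum>i\<in>I0. const_poly (k i) * monomial (m i)) + x1"
      unfolding I(1) x1_def by (rule sum.union_disjoint) (use finI I in auto)
    also have "(\<Sum>i\<in>I0. const_poly (k i) * monomial (m i)) = x0"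
      unfolding x0_def by (rule sum.cong) (auto simp: mi monomial_def I0_def)
    finally show ?thesis
      using x by simp
  qed
  have x1_range: "x1 * range_part F \<approx> x1"
  proof -
    have "monomial (m i) * range_part F \<approx> monomial (m i)" if "i \<in> I1" for i
    proof -
      obtain b \<delta> where "\<beta> i = b # \<delta>"
        using \<open>i \<in> I1\<close> by (cases "\<beta> i") (auto simp: I1_def)
      moreover have "hd (\<beta> i) \<in> F" "m i \<in> monomial_data"
        using that m by (auto simp: F_def I1_def)
      ultimately show ?thesis
        using monomial_range_part[of "\<alpha> i" "A i" b \<delta> F] finI FA by (simp add: mi)
    qed
    then have "(\<Sum>i\<in>I1. const_poly (k i) * (monomial (m i) * range_part F)) \<approx> x1"
      unfolding x1_def by (intro pres_cong_sum cong_mult_left)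
    then show ?thesis
      by (simp add: x1_def sum_distrib_right mult.assoc)
  qed
  have x1_edge: "x1 * edge a \<approx> 0" if "a \<in> alphabet E lab" "a \<notin> F" for a
  proof -
    have "monomial (m i) * edge a \<approx> 0" if "i \<in> I1" for i
    proof -
      obtain b \<delta> where "\<beta> i = b # \<delta>"
        using \<open>i \<in> I1\<close> by (cases "\<beta> i") (auto simp: I1_def)
      moreover have "hd (\<beta> i) \<in> F" "m i \<in> monomial_data"
        using that m by (auto simp: F_def I1_def)
      ultimately show ?thesis
        using monomial_times_edge_diff[of "\<alpha> i" "A i" b \<delta> a] \<open>a \<in> alphabet E lab\<close> \<open>a \<notin> F\<close> by (auto simp: mi)
    qed
    then have "const_poly (k i) * (monomial (m i) * edge a) \<approx> 0" if "i \<in> I1" for i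
      using that by (intro cong_mult_zero(2)[of "monomial (m i) * edge a"])
    then have "(\<Sum>i\<in>I1. const_poly (k i) * (monomial (m i) * edge a)) \<approx> (\<Sum>i\<in>I1. 0)"
      by (rule pres_cong_sum)
    then show ?thesis
      by (simp add: x1_def sum_distrib_right mult.assoc)
  qed
  \<comment> \<open>If there are ghosts, multiplying by the range part kills \<open>x\<close> and fixes \<open>x1\<close>, so \<open>x1\<close> is minus the product of \<open>x0\<close> with it.\<close>
  have x_e: "x \<approx> x0 * e"
  proof (cases "I1 = {}")
    case True
    then show ?thesis
      using xsplit by (simp add: x1_def e_def F_def range_part_def)
  next
    case False
    then have kill: "x * edge a \<approx> 0" if "a \<in> alphabet E lab" for a
      using killed that by (auto simp: I1_def \<beta>_def)
    have "(\<Sum>a\<in>F. x * edge a * ghost a) \<approx> (\<Sum>a\<in>F. 0)"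
      using FA by (intro pres_cong_sum cong_mult_zero(1) kill) auto
    then have xF: "x * range_part F \<approx> 0"
      by (simp add: range_part_def sum_distrib_left mult.assoc)
    have "(x0 + x1) * range_part F \<approx> x * range_part F"
      by (intro cong_mult_right pres_cong_sym[OF xsplit])
    also note xF
    finally have "x0 * range_part F + x1 * range_part F \<approx> 0"
      by (simp add: distrib_right)
    then have "x0 * range_part F + x1 \<approx> 0"
      by (rule pres_cong_trans[OF pres_cong_add[OF pres_cong_refl pres_cong_sym[OF x1_range]]])
    then have "(x0 + x1) - (x0 * range_part F + x1) \<approx> x - 0"
      by (intro pres_cong_diff pres_cong_sym[OF xsplit])
    moreover have "(x0 + x1) - (x0 * range_part F + x1) = x0 * e"
      by (simp add: e_def right_diff_distrib)
    ultimately show ?thesis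
      by (simp add: pres_cong_sym)
  qed
  have e_proj: "e * proj C \<approx> proj C * e" if "C \<in> \<B>" for C
    using range_part_proj[OF that FA] unfolding e_def
    by (simp add: left_diff_distrib right_diff_distrib pres_cong_diff)
  define \<A> where "\<A> i = A i \<inter> ran (\<alpha> i)" for i
  have \<A>: "\<A> i \<in> \<B>" if "i \<in> I0" for i
    using valid that by (simp add: \<A>_def I0_def)
  define U where "U = (\<Union>i\<in>I0. \<A> i)"
  have U: "U \<in> \<B>"
    unfolding U_def using finI \<A> by (intro finite_Union_family)
  have x0_U: "x0 * proj U \<approx> x0"
  proof -
    have "edges (\<alpha> i) * proj (A i) * proj U \<approx> edges (\<alpha> i) * proj (A i)" if "i \<in> I0" for i
    proof -
      have v: "over_alphabet (\<alpha> i)" "A i \<in> \<B>" and sub: "\<A> i \<subseteq> U"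
        using valid that by (auto simp: I0_def U_def)
      have "edges (\<alpha> i) * proj (A i) * proj U \<approx> edges (\<alpha> i) * proj (\<A> i) * proj U"
        unfolding \<A>_def using v by (intro cong_mult_right edges_proj_ran)
      also have "\<dots> = edges (\<alpha> i) * (proj (\<A> i) * proj U)"
        by (simp add: mult.assoc)
      also have "\<dots> \<approx> edges (\<alpha> i) * proj (\<A> i)"
        using \<A>[OF that] U sub by (intro cong_mult_left proj_absorb)
      also have "\<dots> \<approx> edges (\<alpha> i) * proj (A i)"
        unfolding \<A>_def using v by (intro pres_cong_sym[OF edges_proj_ran])
      finally show ?thesis .
    qed
    then have "(\<Sum>i\<in>I0. const_poly (k i) * (edges (\<alpha> i) * proj (A i) * proj U)) \<approx> x0"
      unfolding x0_def by (intro pres_cong_sum cong_mult_left)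
    then show ?thesis
      by (simp add: x0_def sum_distrib_right mult.assoc)
  qed
  have "x * proj U \<approx> x0 * e * proj U"
    by (intro cong_mult_right x_e)
  also have "\<dots> = x0 * (e * proj U)"
    by (simp add: mult.assoc)
  also have "\<dots> \<approx> x0 * (proj U * e)"
    by (intro cong_mult_left e_proj U)
  also have "\<dots> = (x0 * proj U) * e"
    by (simp add: mult.assoc)
  also have "\<dots> \<approx> x0 * e"
    by (intro cong_mult_right x0_U)
  also have "\<dots> \<approx> x"
    by (rule pres_cong_sym[OF x_e])
  finally have "\<not> x * proj U \<approx> 0"
    using nz pres_cong_sym pres_cong_trans by blast
  then obtain B where B: "B \<in> \<B>" "\<not> x * proj B \<approx> 0" "\<And>i. i \<in> I0 \<Longrightarrow> B \<subseteq> \<A> i \<or> B \<inter> \<A> i = {}"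
    using localise[of "\<A> ` I0" U x] finI \<A> U by (metis (no_types, lifting) finite_imageI image_eqI image_subsetI)
  obtain W \<kappa> where W: "finite W" "\<And>\<gamma>. \<gamma> \<in> W \<Longrightarrow> over_alphabet \<gamma> \<and> \<kappa> \<gamma> \<noteq> 0 \<and> B \<subseteq> ran \<gamma>"
    and x0_B: "x0 * proj B \<approx> real_part W \<kappa> * proj B"
  proof (rule real_sum_localised[of I0 B \<alpha> A k])
    show "over_alphabet (\<alpha> i) \<and> A i \<in> \<B>" if "i \<in> I0" for i
      using valid that by (simp add: I0_def)
    show "B \<subseteq> A i \<inter> ran (\<alpha> i) \<or> B \<inter> (A i \<inter> ran (\<alpha> i)) = {}" if "i \<in> I0" for i
      using B(3)[OF that] by (simp only: \<A>_def)
  qed (use finI B in simp_all, rule that[unfolded x0_def])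
  have x_B: "x * proj B \<approx> real_part W \<kappa> * proj B * e"
  proof -
    have "x * proj B \<approx> x0 * e * proj B"
      by (intro cong_mult_right x_e)
    also have "\<dots> = x0 * (e * proj B)"
      by (simp add: mult.assoc)
    also have "\<dots> \<approx> x0 * (proj B * e)"
      by (intro cong_mult_left e_proj B)
    also have "\<dots> = (x0 * proj B) * e"
      by (simp add: mult.assoc)
    also have "\<dots> \<approx> real_part W \<kappa> * proj B * e"
      by (intro cong_mult_right x0_B)
    finally show ?thesis .
  qed
  have "W \<noteq> {}"
    using x_B B(2) by (auto simp: real_part_def)
  moreover have "B \<noteq> {}"
    using B(2) cong_mult_zero(2)[OF proj_empty] by auto
  ultimately have real: "real_data W \<kappa> B"
    using W B(1) by (simp add: real_data_def)
  show ?thesis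
  proof (cases "I1 = {}")
    case True
    then have "x * proj B \<approx> real_part W \<kappa> * proj B"
      using x_B by (simp add: e_def F_def range_part_def)
    then show ?thesis
      using B(1) real by blast
  next
    case False
    then have kill: "x * edge a \<approx> 0" if "a \<in> alphabet E lab" for a
      using killed that by (auto simp: I1_def \<beta>_def)
    \<comment> \<open>A letter outside \<open>F\<close> is invisible to the ghosts, so \<open>x0\<close> alone must vanish on it.\<close>
    have dead: "rel B [a] = {}" if a: "a \<in> alphabet E lab" "a \<notin> F" for a
    proof (rule real_times_edge[OF real a(1)])
      have "x0 * edge a \<approx> (x0 * edge a + x1 * edge a) - x1 * edge a"
        by simp
      also have "\<dots> \<approx> x * edge a - 0"
      proof (intro pres_cong_diff x1_edge a)
        show "x0 * edge a + x1 * edge a \<approx> x * edge a"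
          using cong_mult_right[OF pres_cong_sym[OF xsplit], of "edge a"] by (simp add: distrib_right)
      qed
      also have "x * edge a - 0 \<approx> 0"
        using kill[OF a(1)] by simp
      finally have x0a: "x0 * edge a \<approx> 0" .
      have "real_part W \<kappa> * proj B * edge a \<approx> x0 * proj B * edge a"
        by (intro cong_mult_right pres_cong_sym[OF x0_B])
      also have "\<dots> = x0 * (proj B * edge a)"
        by (simp add: mult.assoc)
      also have "\<dots> \<approx> x0 * (edge a * proj (rel B [a]))"
        by (intro cong_mult_left proj_edge B a)
      also have "\<dots> = x0 * edge a * proj (rel B [a])"
        by (simp add: mult.assoc)
      also have "\<dots> \<approx> 0"
        by (intro cong_mult_zero(1) x0a)
      finally show "real_part W \<kappa> * proj B * edge a \<approx> 0" .
    qed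
    have outF: "out_labels E lab C \<subseteq> F" if "C \<subseteq> B" for C
    proof
      fix a assume "a \<in> out_labels E lab C"
      then have "a \<in> out_labels E lab B" "a \<in> alphabet E lab"
        using out_labels_mono[OF that] out_labels_subset_alphabet by blast+
      then show "a \<in> F"
        using dead unfolding out_labels_iff by blast
    qed
    \<comment> \<open>For a regular set, \<open>e\<close> would annihilate its projection.\<close>
    have "B \<notin> regular_sets E lab \<B>"
    proof
      assume "B \<in> regular_sets E lab \<B>"
      then have "proj B * range_part F \<approx> proj B"
        using finI FA outF by (intro proj_range_part_regular) auto
      then have "proj B - proj B * range_part F \<approx> proj B - proj B"
        by (intro pres_cong_diff pres_cong_refl)
      then have "proj B * e \<approx> 0"
        by (simp add: e_def right_diff_distrib)
      then have "real_part W \<kappa> * proj B * e \<approx> 0"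
        unfolding mult.assoc by (rule cong_mult_zero(2))
      then show False
        using x_B B(2) pres_cong_trans by blast
    qed
    then obtain C where C: "C \<in> \<B>" "C \<noteq> {}" "C \<subseteq> B"
        "\<not> (finite (out_labels E lab C) \<and> out_labels E lab C \<noteq> {})"
      using B(1) unfolding regular_sets_iff by blast
    then have "out_labels E lab C = {}"
      using outF[OF C(3)] finI finite_subset by blast
    then have "rel C [a] = {}" for a
      using out_labels_iff[of a C] by simp
    then have "proj C * range_part F \<approx> 0"
      using C FA by (intro proj_range_part_zero) simp_all
    then have "proj C - proj C * range_part F \<approx> proj C - 0"
      by (intro pres_cong_diff pres_cong_refl)
    then have Ce: "proj C * e \<approx> proj C"
      by (simp add: e_def right_diff_distrib)
    have "x * proj C \<approx> x * (proj B * proj C)"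
      using B C by (intro cong_mult_left pres_cong_sym[OF proj_absorb(2)])
    also have "\<dots> = x * proj B * proj C"
      by (simp add: mult.assoc)
    also have "\<dots> \<approx> real_part W \<kappa> * proj B * e * proj C"
      by (intro cong_mult_right x_B)
    also have "\<dots> = real_part W \<kappa> * proj B * (e * proj C)"
      by (simp add: mult.assoc)
    also have "\<dots> \<approx> real_part W \<kappa> * proj B * (proj C * e)"
      by (intro cong_mult_left e_proj C)
    also have "\<dots> \<approx> real_part W \<kappa> * proj B * proj C"
      by (intro cong_mult_left Ce)
    also have "\<dots> = real_part W \<kappa> * (proj B * proj C)"
      by (simp add: mult.assoc)
    also have "\<dots> \<approx> real_part W \<kappa> * proj C"
      using B C by (intro cong_mult_left proj_absorb(2))
    finally have "x * proj C \<approx> real_part W \<kappa> * proj C" .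
    moreover have "real_data W \<kappa> C"
      using real C by (auto simp: real_data_def)
    ultimately show ?thesis
      using C(1) by blast
  qed
qed

lemma ghost_removal:
  assumes "finite I" "\<And>i. i \<in> I \<Longrightarrow> m i \<in> monomial_data"
    and "x \<approx> (\<Sum>i\<in>I. const_poly (k i) * monomial (m i))" and "\<not> x \<approx> 0"
  shows "\<exists>b\<in>free_algebra gens. \<exists>W \<kappa> B. real_data W \<kappa> B \<and> x * b \<approx> real_part W \<kappa> * proj B"
proof -
  define N where "N = (\<Sum>i\<in>I. ghost_length (m i))"
  then have "\<And>i. i \<in> I \<Longrightarrow> ghost_length (m i) \<le> N"
    using assms(1) by (auto intro: member_le_sum)
  with assms(2-4) show ?thesis
  proof (induction N arbitrary: x m)
    case 0
    then show ?case
      using ghost_removal_step[of I m x k] assms(1) by fastforce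
  next
    case (Suc N)
    show ?case
    proof (cases "\<forall>a\<in>alphabet E lab. x * edge a \<approx> 0")
      case True
      then show ?thesis
        using ghost_removal_step[of I m x k] assms(1) Suc.prems by fastforce
    next
      case False
      then obtain a where a: "a \<in> alphabet E lab" "\<not> x * edge a \<approx> 0"
        by blast
      have "\<exists>m' \<in> monomial_data. ghost_length m' \<le> ghost_length (m i) - 1 \<and> monomial (m i) * edge a \<approx> monomial m'"
        if "i \<in> I" for i
        using monomial_times_edge[OF Suc.prems(1)[OF that] a(1)] .
      then obtain m' where m': "\<And>i. i \<in> I \<Longrightarrow> m' i \<in> monomial_data"
          "\<And>i. i \<in> I \<Longrightarrow> ghost_length (m' i) \<le> ghost_length (m i) - 1"
          "\<And>i. i \<in> I \<Longrightarrow> monomial (m i) * edge a \<approx> monomial (m' i)"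
        by metis
      have "x * edge a \<approx> (\<Sum>i\<in>I. const_poly (k i) * monomial (m i)) * edge a"
        by (intro cong_mult_right Suc.prems)
      also have "\<dots> = (\<Sum>i\<in>I. const_poly (k i) * (monomial (m i) * edge a))"
        by (simp add: sum_distrib_right mult.assoc)
      also have "\<dots> \<approx> (\<Sum>i\<in>I. const_poly (k i) * monomial (m' i))"
        by (intro pres_cong_sum cong_mult_left m')
      finally have "x * edge a \<approx> (\<Sum>i\<in>I. const_poly (k i) * monomial (m' i))" .
      moreover have "ghost_length (m' i) \<le> N" if "i \<in> I" for i
        using m'(2)[OF that] Suc.prems(4)[OF that] by simp
      ultimately obtain b W \<kappa> B where "b \<in> free_algebra gens" "real_data W \<kappa> B"
          "x * edge a * b \<approx> real_part W \<kappa> * proj B"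
        using Suc.IH[of m' "x * edge a"] m'(1) a(2) by blast
      then show ?thesis
        using a(1) by (intro bexI[of _ "edge a * b"] exI[of _ W] exI[of _ \<kappa>] exI[of _ B])
          (auto simp: mult.assoc intro: free_algebra_mult)
    qed
  qed
qed

text \<open>Reachability by two-sided multiplication, with both factors taken from the algebra without unit.\<close>

definition reaches ::
    "(('v, 'l) lpa_gen free_word \<Rightarrow>\<^sub>0 'k) \<Rightarrow> (('v, 'l) lpa_gen free_word \<Rightarrow>\<^sub>0 'k) \<Rightarrow> bool" where
  "reaches x y \<longleftrightarrow> (\<exists>a\<in>free_algebra gens. \<exists>b\<in>free_algebra gens. a * x * b \<approx> y)"

lemma reaches_step:
  assumes "reaches x y" "a \<in> free_algebra gens" "b \<in> free_algebra gens" "a * y * b \<approx> z"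
  shows "reaches x z"
proof -
  obtain c d where cd: "c \<in> free_algebra gens" "d \<in> free_algebra gens" "c * x * d \<approx> y"
    using assms(1) by (auto simp: reaches_def)
  have "(a * c) * x * (d * b) = a * (c * x * d) * b"
    by (simp add: mult.assoc)
  also have "\<dots> \<approx> a * y * b"
    by (intro cong_mult_mid cd)
  also note assms(4)
  finally show ?thesis
    unfolding reaches_def using cd assms(2,3) free_algebra_mult by blast
qed

lemma reaches_corner:
  assumes "x \<in> free_algebra gens" "\<not> x \<approx> 0"
  obtains W \<kappa> B where "corner_data W \<kappa> B" "reaches x (corner W \<kappa> B)"
proof -
  obtain k m where m: "\<And>w. w \<in> Poly_Mapping.keys x \<Longrightarrow> m w \<in> monomial_data"
      "x \<approx> (\<Sum>w\<in>Poly_Mapping.keys x. const_poly (k w) * monomial (m w))"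
    by (rule free_algebra_monomials[OF assms(1)]) (rule that)
  then obtain b W \<kappa> B where b: "b \<in> free_algebra gens" "real_data W \<kappa> B" "x * b \<approx> real_part W \<kappa> * proj B"
    using ghost_removal[OF finite_keys m assms(2)] by blast
  then obtain a W' \<kappa>' where a: "a \<in> free_algebra gens" "corner_data W' \<kappa>' B"
      "a * (real_part W \<kappa> * proj B) \<approx> corner W' \<kappa>' B"
    using real_data_to_corner by blast
  have "a * x * b = a * (x * b)"
    by (simp add: mult.assoc)
  also have "\<dots> \<approx> a * (real_part W \<kappa> * proj B)"
    by (intro cong_mult_left b)
  also note a(3)
  finally show thesis
    using that a b unfolding reaches_def by blast
qed

section \<open>Corners with few terms\<close>

text \<open>Compress by \<open>p\<^sub>C s\<^sub>u\<^sup>*\<close> and \<open>s\<^sub>u p\<^sub>C\<close>. The constant term survives, as \<open>C\<close> is nonempty, so the result is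
  again a corner within reach; by minimality it has as many terms, hence none has vanished.\<close>

lemma minimal_corner_rigid:
  assumes data: "corner_data W \<kappa> B" and reach: "reaches x (corner W \<kappa> B)"
    and minimal: "\<And>W' \<kappa>' B'. corner_data W' \<kappa>' B' \<Longrightarrow> reaches x (corner W' \<kappa>' B') \<Longrightarrow> card W \<le> card W'"
    and C: "C \<in> \<B>" "C \<noteq> {}" "C \<subseteq> rel B u" and \<beta>: "\<beta> \<in> W"
  shows "\<exists>\<beta>'. \<beta> @ u = u @ \<beta>' \<and> C \<inter> rel C \<beta>' \<noteq> {}"
proof (rule ccontr)
  assume none: "\<not> ?thesis"
  have u: "over_alphabet u"
    using C rel_nonempty_over[of B u] by blast
  have W: "finite W" "[] \<in> W" "\<kappa> [] \<noteq> 0" "B \<in> \<B>" "\<And>\<gamma>. \<gamma> \<in> W \<Longrightarrow> over_alphabet \<gamma>"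
    using data by (auto simp: corner_data_def)
  \<comment> \<open>The word \<open>h \<gamma>\<close> solves \<open>\<gamma> u = u (h \<gamma>)\<close> if there is a solution; it has the length of \<open>\<gamma>\<close>, so \<open>\<gamma>\<close> can be recovered from it.\<close>
  define h where "h \<gamma> = drop (length u) (\<gamma> @ u)" for \<gamma>
  define V where "V = {\<gamma> \<in> W. \<exists>\<gamma>'. \<gamma> @ u = u @ \<gamma>' \<and> C \<inter> rel C \<gamma>' \<noteq> {}}"
  define \<kappa>' where "\<kappa>' \<delta> = \<kappa> (take (length \<delta>) (u @ \<delta>))" for \<delta>
  have h: "\<gamma> @ u = u @ h \<gamma>" "C \<inter> rel C (h \<gamma>) \<noteq> {}" if "\<gamma> \<in> V" for \<gamma>
  proof -
    obtain \<gamma>' where \<gamma>': "\<gamma> @ u = u @ \<gamma>'" "C \<inter> rel C \<gamma>' \<noteq> {}"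
      using \<open>\<gamma> \<in> V\<close> unfolding V_def by blast
    then have "h \<gamma> = \<gamma>'"
      unfolding h_def \<gamma>'(1) by simp
    with \<gamma>' show "\<gamma> @ u = u @ h \<gamma>" and "C \<inter> rel C (h \<gamma>) \<noteq> {}"
      by simp_all
  qed
  have unshift: "take (length (h \<gamma>)) (u @ h \<gamma>) = \<gamma>" if "\<gamma> \<in> V" for \<gamma>
  proof -
    have "length (h \<gamma>) = length \<gamma>"
      by (simp add: h_def)
    then show ?thesis
      by (simp add: h(1)[OF that, symmetric])
  qed
  define a where "a = proj C * ghosts u"
  define b where "b = edges u * proj C"
  have eq: "a * corner W \<kappa> B * b = (\<Sum>\<gamma>\<in>W. const_poly (\<kappa> \<gamma>) * (a * (proj B * edges \<gamma> * proj B) * b))"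
    by (simp add: corner_def sum_distrib_left sum_distrib_right mult.assoc const_poly_left_commute)
  have "a * corner W \<kappa> B * b \<approx> (\<Sum>\<delta>\<in>h ` V. const_poly (\<kappa>' \<delta>) * (proj C * edges \<delta> * proj C))"
    unfolding eq
  proof (rule cong_sum_transport)
    show "inj_on h V"
      by (rule inj_on_inverseI[where g = "\<lambda>\<delta>. take (length \<delta>) (u @ \<delta>)"]) (rule unshift)
    show "const_poly (\<kappa> \<gamma>) * (a * (proj B * edges \<gamma> * proj B) * b) \<approx>
        const_poly (\<kappa>' (h \<gamma>)) * (proj C * edges (h \<gamma>) * proj C)" if "\<gamma> \<in> V" for \<gamma>
    proof -
      have "a * (proj B * edges \<gamma> * proj B) * b \<approx> proj C * edges (h \<gamma>) * proj C"
        unfolding a_def b_def using W C u h[OF that] that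
        by (intro compress_eq) (auto simp: V_def)
      then show ?thesis
        unfolding \<kappa>'_def unshift[OF that] by (rule cong_mult_left)
    qed
    show "const_poly (\<kappa> \<gamma>) * (a * (proj B * edges \<gamma> * proj B) * b) \<approx> 0" if "\<gamma> \<in> W - V" for \<gamma>
    proof (rule cong_mult_zero(2))
      show "a * (proj B * edges \<gamma> * proj B) * b \<approx> 0"
      proof (cases "\<exists>\<gamma>'. \<gamma> @ u = u @ \<gamma>'")
        case True
        then obtain \<gamma>' where \<gamma>': "\<gamma> @ u = u @ \<gamma>'"
          by blast
        have over: "over_alphabet \<gamma>"
          using W(5) that by blast
        then have over': "over_alphabet \<gamma>'"
          using arg_cong[OF \<gamma>', of set] u by auto
        have "C \<inter> rel C \<gamma>' = {}"
          using that \<gamma>' by (auto simp: V_def)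
        then have "proj C * edges \<gamma>' * proj C \<approx> 0"
          using C over' by (intro corner_term_zero)
        moreover have "a * (proj B * edges \<gamma> * proj B) * b \<approx> proj C * edges \<gamma>' * proj C"
          unfolding a_def b_def using W C u over \<gamma>' by (intro compress_eq)
        ultimately show ?thesis
          by (rule pres_cong_trans[rotated])
      next
        case False
        then show ?thesis
          unfolding a_def b_def using W C u that by (intro compress_zero) auto
      qed
    qed
  qed (use W in \<open>auto simp: V_def\<close>)
  then have "a * corner W \<kappa> B * b \<approx> corner (h ` V) \<kappa>' C"
    by (simp add: corner_def)
  moreover have "a \<in> free_algebra gens" "b \<in> free_algebra gens"
    unfolding a_def b_def using C u by (auto intro: free_mult_ghosts free_edges_mult)
  ultimately have "reaches x (corner (h ` V) \<kappa>' C)"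
    using reaches_step[OF reach] by blast
  moreover have "corner_data (h ` V) \<kappa>' C"
  proof -
    have "[] \<in> V"
      using W C by (simp add: V_def)
    moreover have "h [] = []"
      by (simp add: h_def)
    ultimately have "[] \<in> h ` V"
      by (metis image_eqI)
    moreover have "over_alphabet (h \<gamma>)" if "\<gamma> \<in> V" for \<gamma>
    proof -
      have "set (h \<gamma>) \<subseteq> set (\<gamma> @ u)"
        unfolding h_def by (rule set_drop_subset)
      then show ?thesis
        using W(5)[of \<gamma>] that u by (auto simp: V_def)
    qed
    ultimately show ?thesis
      using W C by (auto simp: corner_data_def V_def \<kappa>'_def)
  qed
  ultimately have "card W \<le> card (h ` V)"
    by (intro minimal)
  also have "\<dots> \<le> card V"
    using W by (intro card_image_le) (simp add: V_def)
  also have "\<dots> < card W"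
  proof (rule psubset_card_mono)
    have "\<beta> \<notin> V"
      using none unfolding V_def by blast
    then show "V \<subset> W"
      using \<beta> unfolding V_def by blast
  qed (rule W)
  finally show False
    by simp
qed

text \<open>What rigidity with an empty \<open>u\<close> says about the words of a minimal corner. It is a seemingly weaker form
  of the inclusion that defines cycles.\<close>

definition self_meeting :: "'v set \<Rightarrow> 'l list \<Rightarrow> bool" where
  "self_meeting B \<gamma> \<longleftrightarrow> (\<forall>C\<in>\<B>. C \<noteq> {} \<longrightarrow> C \<subseteq> B \<longrightarrow> C \<inter> rel C \<gamma> \<noteq> {})"

text \<open>The part of \<open>C\<close> outside \<open>r(C,\<gamma>)\<close> does not meet its own range along \<open>\<gamma>\<close>.\<close>

lemma self_meeting_subset:
  assumes "self_meeting B \<gamma>" "C \<in> \<B>" "C \<subseteq> B"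
  shows "C \<subseteq> rel C \<gamma>"
proof (rule ccontr)
  assume "\<not> C \<subseteq> rel C \<gamma>"
  moreover have "C - rel C \<gamma> \<in> \<B>"
    using assms(2) by (intro family_Diff) simp_all
  ultimately have "(C - rel C \<gamma>) \<inter> rel (C - rel C \<gamma>) \<gamma> \<noteq> {}"
    using assms(1,3) unfolding self_meeting_def by (meson Diff_eq_empty_iff Diff_subset order_trans)
  then show False
    using rel_mono[of "C - rel C \<gamma>" C \<gamma>] by blast
qed

text \<open>Since \<open>C\<close> lies in both \<open>r(C,\<gamma>)\<close> and \<open>r(C,\<delta>\<gamma>)\<close>, it lies in \<open>r(C \<inter> r(C,\<delta>), \<gamma>)\<close> by weak
  left-resolvingness. This is what makes a common root of several cycles a cycle: it is
  obtained from them by repeated cancellation.\<close>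

lemma self_meeting_cancel:
  assumes "self_meeting B (\<delta> @ \<gamma>)" "self_meeting B \<gamma>"
  shows "self_meeting B \<delta>"
  unfolding self_meeting_def
proof (intro ballI impI)
  fix C assume C: "C \<in> \<B>" "C \<noteq> {}" "C \<subseteq> B"
  have "C \<subseteq> rel C \<gamma> \<inter> rel C (\<delta> @ \<gamma>)"
    using self_meeting_subset[OF assms(1) C(1,3)] self_meeting_subset[OF assms(2) C(1,3)] by blast
  also have "\<dots> = rel (C \<inter> rel C \<delta>) \<gamma>"
    using C(1) by (simp add: rel_Int rel_append family_subset)
  finally show "C \<inter> rel C \<delta> \<noteq> {}"
    using C(2) by auto
qed

lemma self_meeting_power:
  assumes "self_meeting B \<gamma>" "B \<in> \<B>"
  shows "B \<subseteq> rel B (concat (replicate n \<gamma>))"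
proof (induction n)
  case (Suc n)
  have "rel B (concat (replicate (Suc n) \<gamma>)) = rel (rel B \<gamma>) (concat (replicate n \<gamma>))"
    using assms(2) by (simp add: rel_append family_subset)
  then show ?case
    using Suc rel_mono[OF self_meeting_subset[OF assms order_refl]] by blast
qed simp

lemma labelled_cycleI:
  assumes "self_meeting B c" "B \<in> \<B>" "B \<noteq> {}" "c \<noteq> []"
  shows "labelled_cycle E lab \<B> c B"
  unfolding labelled_cycle_def
proof (intro conjI ballI impI)
  have B: "B \<subseteq> rel B c"
    by (rule self_meeting_subset[OF assms(1,2) order_refl])
  then show "c \<in> labelled_words E lab"
    using assms(3,4) by (intro rel_nonempty_word) auto
  show "B \<in> family_below E lab \<B> c"
    using B rel_subset_ran[OF family_subset[OF assms(2)], of c] assms(2) by (auto simp: family_below_def)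
  show "C \<subseteq> rel C c" if "C \<in> family_below E lab \<B> c" "C \<subseteq> B" for C
    using that by (intro self_meeting_subset[OF assms(1)]) (auto simp: family_below_def)
qed

text \<open>The word \<open>c\<close> is a shortest one among the words that commute with \<open>\<beta>\<^sub>0\<close> and satisfy
  \<^const>\<open>self_meeting\<close>. This set is closed under cancelling \<open>c\<close> from the right, so it consists of powers of
  \<open>c\<close>. An exit of \<open>(c,B)\<close> after the prefix \<open>u\<close> of \<open>c\<close> contradicts rigidity for \<open>u\<close> extended by a
  letter \<open>b\<close> that leaves the cycle.\<close>

lemma rigid_family_cycle:
  assumes B: "B \<in> \<B>" "B \<noteq> {}" and \<beta>0: "\<beta>\<^sub>0 \<in> W" "\<beta>\<^sub>0 \<noteq> []"
    and rigid: "\<And>u C \<beta>. C \<in> \<B> \<Longrightarrow> C \<noteq> {} \<Longrightarrow> C \<subseteq> rel B u \<Longrightarrow> \<beta> \<in> W \<Longrightarrow>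
      \<exists>\<beta>'. \<beta> @ u = u @ \<beta>' \<and> C \<inter> rel C \<beta>' \<noteq> {}"
  obtains c where "c \<noteq> []" "self_meeting B c" "\<not> has_exit E lab \<B> c B"
    "\<And>\<beta>. \<beta> \<in> W \<Longrightarrow> \<exists>j. \<beta> = concat (replicate j c)"
proof -
  have meet: "self_meeting B \<beta>" if "\<beta> \<in> W" for \<beta>
    using rigid[of _ "[]", OF _ _ _ that] by (auto simp: self_meeting_def)
  have comm: "\<beta> @ \<beta>\<^sub>0 = \<beta>\<^sub>0 @ \<beta>" if "\<beta> \<in> W" for \<beta>
  proof (rule commute_if_shift_powers[OF _ \<beta>0(2)])
    show "\<exists>x'. \<beta> @ concat (replicate n \<beta>\<^sub>0) = concat (replicate n \<beta>\<^sub>0) @ x'" for n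
      using rigid[OF B self_meeting_power[OF meet[OF \<beta>0(1)] B(1)] that] by blast
  qed
  define Z where "Z = {\<gamma>. \<gamma> @ \<beta>\<^sub>0 = \<beta>\<^sub>0 @ \<gamma> \<and> self_meeting B \<gamma>}"
  have "\<beta>\<^sub>0 \<in> Z \<and> \<beta>\<^sub>0 \<noteq> []"
    using \<beta>0 meet by (simp add: Z_def)
  then obtain c where c: "c \<in> Z" "c \<noteq> []" and least: "\<And>\<gamma>. \<gamma> \<in> Z \<Longrightarrow> \<gamma> \<noteq> [] \<Longrightarrow> length c \<le> length \<gamma>"
    using ex_has_least_nat[of "\<lambda>\<gamma>. \<gamma> \<in> Z \<and> \<gamma> \<noteq> []" \<beta>\<^sub>0 length] by blast
  have power: "\<exists>j. \<gamma> = concat (replicate j c)" if "\<gamma> \<in> Z" for \<gamma>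
    using that
  proof (induction \<gamma> rule: length_induct)
    case (1 \<gamma>)
    show ?case
    proof (cases "\<gamma> = []")
      case True
      then show ?thesis
        by (intro exI[of _ 0]) simp
    next
      case False
      then obtain z where z: "\<gamma> = z @ c" "z @ \<beta>\<^sub>0 = \<beta>\<^sub>0 @ z"
        using commuting_suffix[of c \<beta>\<^sub>0 \<gamma>] 1(2) c(1) \<beta>0(2) least by (auto simp: Z_def)
      then have "z \<in> Z"
        using 1(2) c(1) self_meeting_cancel[of B z c] by (simp add: Z_def)
      then obtain j where "z = concat (replicate j c)"
        using 1(1)[rule_format, of z] z(1) c(2) by auto
      then have "\<gamma> = concat (replicate (Suc j) c)"
        using z(1) commute_power[of c c j] by simp
      then show ?thesis
        by blast
    qed
  qed
  have "\<not> has_exit E lab \<B> c B"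
  proof
    assume "has_exit E lab \<B> c B"
    then obtain k C where k: "k \<le> length c" and C: "C \<in> \<B>" "C \<noteq> {}" "C \<subseteq> rel B (take k c)"
        and exit: "out_labels E lab C \<noteq> {(c @ [hd c]) ! k}"
      unfolding has_exit_def by blast
    define u where "u = take k c"
    define d where "d = (c @ [hd c]) ! k"
    have lenu: "length u = k"
      using k by (simp add: u_def)
    obtain j where j: "\<beta>\<^sub>0 = concat (replicate j c)"
      using power[of \<beta>\<^sub>0] \<beta>0 meet by (auto simp: Z_def)
    then obtain i where "j = Suc i"
      using \<beta>0(2) by (cases j) auto
    then have i: "\<beta>\<^sub>0 = c @ concat (replicate i c)"
      by (simp add: j)
    have kl: "k < length (\<beta>\<^sub>0 @ u)"
      using k c(2) lenu by (simp add: i)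
    \<comment> \<open>Padding with the rest of \<open>c\<close> turns \<open>\<beta>\<^sub>0 u\<close> into a power of \<open>c\<close>, at least the second, which covers the case \<open>k = |c|\<close>.\<close>
    have letter: "(\<beta>\<^sub>0 @ u) ! k = d"
    proof -
      have "(\<beta>\<^sub>0 @ u) ! k = ((\<beta>\<^sub>0 @ u) @ drop k c) ! k"
        using kl by (simp only: nth_append if_True)
      also have "(\<beta>\<^sub>0 @ u) @ drop k c = c @ c @ concat (replicate i c)"
        using commute_power[of c c i] by (simp add: u_def i)
      also have "\<dots> ! k = d"
        using k c(2) by (cases "k < length c") (simp_all add: d_def nth_append hd_conv_nth)
      finally show ?thesis .
    qed
    obtain \<beta>' where \<beta>': "\<beta>\<^sub>0 @ u = u @ \<beta>'" "C \<inter> rel C \<beta>' \<noteq> {}"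
      using rigid[OF C \<beta>0(1)] by (auto simp: u_def)
    \<comment> \<open>Rigidity for \<open>u\<close> itself shows that the letter \<open>d\<close> of the cycle does leave \<open>C\<close>; hence an exit needs another letter.\<close>
    have "\<beta>' \<noteq> []"
      using \<beta>'(1) \<beta>0(2) by auto
    then obtain d' \<delta> where d': "\<beta>' = d' # \<delta>"
      by (cases \<beta>') auto
    have "d' = d"
      using letter unfolding \<beta>'(1) d' by (simp add: nth_append lenu)
    then have "rel (rel C [d]) \<delta> \<noteq> {}"
      using \<beta>'(2) rel_Cons[OF family_subset[OF C(1)], of d \<delta>] by (auto simp: d')
    then have "d \<in> out_labels E lab C"
      unfolding out_labels_iff by auto
    then obtain b where b: "b \<in> out_labels E lab C" "b \<noteq> d"
      using exit unfolding d_def by blast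
    have "rel C [b] \<noteq> {}"
      using b(1) by (simp add: out_labels_iff)
    moreover have "rel C [b] \<subseteq> rel B (u @ [b])"
      using rel_mono[OF C(3), of "[b]"] by (simp add: rel_append family_subset[OF B(1)] u_def)
    ultimately obtain \<beta>'' where "\<beta>\<^sub>0 @ u @ [b] = (u @ [b]) @ \<beta>''"
      using rigid[of "rel C [b]" "u @ [b]", OF _ _ _ \<beta>0(1)] C(1) by auto
    then have "((\<beta>\<^sub>0 @ u) @ [b]) ! k = (u @ b # \<beta>'') ! k"
      by simp
    also have "\<dots> = b"
      by (simp add: nth_append lenu)
    also have "((\<beta>\<^sub>0 @ u) @ [b]) ! k = d"
      using kl letter by (simp only: nth_append if_True)
    finally show False
      using b(2) by simp
  qed
  then show thesis
    using that[of c] c power comm meet by (auto simp: Z_def)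
qed

text \<open>Representatives of \<open>s\<^sub>c\<^sup>i\<close> with the convention \<open>s\<^sub>c\<^sup>0 = p\<^sub>B\<close>.\<close>

definition cycle_power :: "'l list \<Rightarrow> 'v set \<Rightarrow> nat \<Rightarrow> ('v, 'l) lpa_gen free_word \<Rightarrow>\<^sub>0 'k" where
  "cycle_power c B i = (if i = 0 then proj B else edges c ^ i)"

lemma edges_power: "edges (concat (replicate n c)) = edges c ^ n"
  by (induction n) simp_all

lemma inj_word_power: "c \<noteq> [] \<Longrightarrow> inj (\<lambda>i. concat (replicate i c))"
  by (rule injI) (metis length_concat_replicate length_0_conv mult_cancel2)

lemma corner_cycle_polynomial:
  assumes data: "corner_data W \<kappa> B" and c: "c \<noteq> []" "self_meeting B c" "over_alphabet c"
    and powers: "\<And>\<beta>. \<beta> \<in> W \<Longrightarrow> \<exists>j. \<beta> = concat (replicate j c)"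
  obtains n k where "corner W \<kappa> B \<approx> (\<Sum>i=0..n. const_poly (k i) * (cycle_power c B i * proj B))"
proof
  define p where "p i = concat (replicate i c)" for i
  define n where "n = Max (length ` W)"
  define k where "k i = (if p i \<in> W then \<kappa> (p i) else 0)" for i
  have W: "finite W" "B \<in> \<B>"
    using data by (auto simp: corner_data_def)
  have inj: "inj p"
    unfolding p_def by (rule inj_word_power[OF c(1)])
  have summand: "proj B * edges (p i) * proj B \<approx> cycle_power c B i * proj B" for i
  proof (cases "i = 0")
    case False
    have "over_alphabet (p i)"
      using c(3) by (auto simp: p_def)
    then have "proj B * edges (p i) * proj B \<approx> edges (p i) * proj (rel B (p i)) * proj B"
      using W by (intro cong_mult_right proj_edges)
    also have "\<dots> = edges (p i) * (proj (rel B (p i)) * proj B)"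
      by (simp add: mult.assoc)
    also have "\<dots> \<approx> edges (p i) * proj B"
      using W self_meeting_power[OF c(2) W(2), of i] by (intro cong_mult_left proj_absorb) (auto simp: p_def)
    finally show ?thesis
      using False by (simp add: cycle_power_def p_def edges_power)
  qed (simp add: cycle_power_def p_def)
  have W_eq: "W = p ` {i \<in> {0..n}. p i \<in> W}"
  proof (intro subset_antisym subsetI)
    fix \<beta> assume "\<beta> \<in> W"
    then obtain j where j: "\<beta> = p j"
      using powers by (auto simp: p_def)
    have "j * 1 \<le> j * length c"
      using c(1) by (intro mult_le_mono) (auto simp: Suc_le_eq)
    also have "\<dots> = length \<beta>"
      by (simp add: j p_def length_concat_replicate)
    also have "\<dots> \<le> n"
      unfolding n_def using W \<open>\<beta> \<in> W\<close> by simp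
    finally show "\<beta> \<in> p ` {i \<in> {0..n}. p i \<in> W}"
      using j \<open>\<beta> \<in> W\<close> by auto
  qed auto
  have "corner W \<kappa> B = (\<Sum>i\<in>{i \<in> {0..n}. p i \<in> W}. const_poly (\<kappa> (p i)) * (proj B * edges (p i) * proj B))"
    unfolding corner_def by (subst W_eq, subst sum.reindex) (use inj in \<open>auto intro: inj_on_subset\<close>)
  also have "\<dots> \<approx> (\<Sum>i\<in>{i \<in> {0..n}. p i \<in> W}. const_poly (k i) * (cycle_power c B i * proj B))"
  proof (rule pres_cong_sum)
    fix i assume "i \<in> {i \<in> {0..n}. p i \<in> W}"
    then show "const_poly (\<kappa> (p i)) * (proj B * edges (p i) * proj B) \<approx>
        const_poly (k i) * (cycle_power c B i * proj B)"
      using cong_mult_left[OF summand] by (simp add: k_def)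
  qed
  also have "\<dots> = (\<Sum>i=0..n. const_poly (k i) * (cycle_power c B i * proj B))"
    by (rule sum.mono_neutral_left) (auto simp: k_def)
  finally show "corner W \<kappa> B \<approx> (\<Sum>i=0..n. const_poly (k i) * (cycle_power c B i * proj B))" .
qed

text \<open>The reduction for representatives. If the empty word is the only one in a minimal corner, the corner is a
  multiple of \<open>p\<^sub>B\<close>; otherwise it is a polynomial in a cycle without exit.\<close>

lemma reduction_in_free_algebra:
  assumes "x \<in> free_algebra gens" "\<not> x \<approx> 0"
  shows "\<exists>a\<in>free_algebra gens. \<exists>b\<in>free_algebra gens. \<not> a * x * b \<approx> 0 \<and>
    ((\<exists>k A. k \<noteq> 0 \<and> A \<in> \<B> \<and> A \<noteq> {} \<and> a * x * b \<approx> const_poly k * proj A) \<or>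
     (\<exists>n k c A. labelled_cycle E lab \<B> c A \<and> \<not> has_exit E lab \<B> c A \<and>
        a * x * b \<approx> (\<Sum>i=0..n. const_poly (k i) * (cycle_power c A i * proj A))))"
proof -
  define P where "P = (\<lambda>(W, \<kappa>, B). corner_data W \<kappa> B \<and> reaches x (corner W \<kappa> B))"
  obtain W0 \<kappa>0 B0 where "corner_data W0 \<kappa>0 B0" "reaches x (corner W0 \<kappa>0 B0)"
    using reaches_corner[OF assms] by blast
  then have "P (W0, \<kappa>0, B0)"
    by (simp add: P_def)
  then obtain t where "P t" "\<And>t'. P t' \<Longrightarrow> card (fst t) \<le> card (fst t')"
    using ex_has_least_nat[of P _ "\<lambda>t. card (fst t)"] by blast
  then obtain W \<kappa> B where data: "corner_data W \<kappa> B" and reach: "reaches x (corner W \<kappa> B)"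
      and minimal: "\<And>W' \<kappa>' B'. corner_data W' \<kappa>' B' \<Longrightarrow> reaches x (corner W' \<kappa>' B') \<Longrightarrow> card W \<le> card W'"
    by (cases t) (fastforce simp: P_def)
  obtain a b where ab: "a \<in> free_algebra gens" "b \<in> free_algebra gens" "a * x * b \<approx> corner W \<kappa> B"
    using reach by (auto simp: reaches_def)
  have nonzero: "\<not> a * x * b \<approx> 0"
    using corner_nonzero[OF data] ab(3) pres_cong_sym pres_cong_trans by blast
  have B: "B \<in> \<B>" "B \<noteq> {}" and W: "[] \<in> W" "\<kappa> [] \<noteq> 0"
    using data by (auto simp: corner_data_def)
  show ?thesis
  proof (cases "W = {[]}")
    case True
    then have "corner W \<kappa> B \<approx> const_poly (\<kappa> []) * proj B"
      using proj_mult[OF B(1) B(1)] by (simp add: corner_def cong_mult_left)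
    then have "a * x * b \<approx> const_poly (\<kappa> []) * proj B"
      using ab(3) pres_cong_trans by blast
    then show ?thesis
      using ab nonzero B W(2) by blast
  next
    case False
    then obtain \<beta> where \<beta>: "\<beta> \<in> W" "\<beta> \<noteq> []"
      using W(1) by blast
    have rigid: "\<exists>\<beta>'. \<beta> @ u = u @ \<beta>' \<and> C \<inter> rel C \<beta>' \<noteq> {}"
      if "C \<in> \<B>" "C \<noteq> {}" "C \<subseteq> rel B u" "\<beta> \<in> W" for u C \<beta>
      using data reach minimal that by (rule minimal_corner_rigid)
    obtain c where c: "c \<noteq> []" "self_meeting B c" "\<not> has_exit E lab \<B> c B"
        "\<And>\<beta>. \<beta> \<in> W \<Longrightarrow> \<exists>j. \<beta> = concat (replicate j c)"
      by (rule rigid_family_cycle[OF B \<beta>], erule (3) rigid, rule that)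
    have "over_alphabet c"
      using self_meeting_subset[OF c(2) B(1) order_refl] B(2) by (intro rel_nonempty_over) auto
    then obtain n k where "corner W \<kappa> B \<approx> (\<Sum>i=0..n. const_poly (k i) * (cycle_power c B i * proj B))"
      using corner_cycle_polynomial[OF data c(1,2) _ c(4)] by blast
    then have "a * x * b \<approx> (\<Sum>i=0..n. const_poly (k i) * (cycle_power c B i * proj B))"
      using ab(3) pres_cong_trans by blast
    moreover have "labelled_cycle E lab \<B> c B"
      by (rule labelled_cycleI[OF c(2) B c(1)])
    ultimately show ?thesis
      using ab nonzero c(3) by blast
  qed
qed

section \<open>The reduction theorem\<close>

sublocale presentation gens relators
  by unfold_locales (rule relators_free)

lemma lpa_eq: "leavitt_labelled_path_algebra E lab \<B> = Q"
  by (simp add: leavitt_labelled_path_algebra_def)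

lemma lpa_elem_eq: "lpa_elem E lab \<B> g = cl (generator g)"
  by (simp add: lpa_elem_def)

lemma labelled_wordsD:
  assumes "\<alpha> \<in> labelled_words E lab"
  shows "\<alpha> \<noteq> []" "over_alphabet \<alpha>"
proof -
  obtain u p v where p: "awalk u p v" "p \<noteq> []" "\<alpha> = map lab p"
    using assms by (auto simp: labelled_words_def)
  then show "\<alpha> \<noteq> []"
    by simp
  have "set p \<subseteq> arcs E"
    using p(1) by (simp add: awalk_def)
  then show "over_alphabet \<alpha>"
    unfolding p(3) alphabet_def set_map by (rule image_mono)
qed

lemma edges_free: "c \<noteq> [] \<Longrightarrow> over_alphabet c \<Longrightarrow> edges c \<in> free_algebra gens"
proof (induction c rule: list_nonempty_induct)
  case (cons a c)
  then show ?case
    by (auto intro: free_algebra_mult)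
qed simp

lemma lpa_word_eq: "c \<noteq> [] \<Longrightarrow> over_alphabet c \<Longrightarrow> lpa_word E lab \<B> c = cl (edges c)"
proof (induction c rule: list_nonempty_induct)
  case (single a)
  then show ?case
    by (simp add: lpa_elem_eq)
next
  case (cons a c)
  then obtain b \<delta> where c: "c = b # \<delta>"
    by (cases c) auto
  have "lpa_word E lab \<B> (a # c) = cl (edge a) \<otimes>\<^bsub>Q\<^esub> cl (edges c)"
    using cons by (simp add: c lpa_eq lpa_elem_eq del: edges_simps)
  also have "\<dots> = cl (edges (a # c))"
    using cons.prems edges_free[OF cons.hyps(1)] by (subst mult_presented) auto
  finally show ?case .
qed

lemma cycle_power_free:
  assumes "c \<noteq> []" "over_alphabet c" "B \<in> \<B>"
  shows "cycle_power c B i \<in> free_algebra gens"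
proof (cases i)
  case (Suc n)
  have "edges c ^ Suc n \<in> free_algebra gens"
    using assms(1,2) by (induction n) (auto intro: free_algebra_mult edges_free)
  then show ?thesis
    by (simp add: cycle_power_def Suc)
qed (use assms in \<open>simp add: cycle_power_def\<close>)

lemma lpa_word_power_eq:
  assumes "c \<noteq> []" "over_alphabet c" "B \<in> \<B>"
  shows "lpa_word_power E lab \<B> c B i = cl (cycle_power c B i)"
proof (induction i rule: less_induct)
  case (less i)
  consider "i = 0" | "i = Suc 0" | n where "i = Suc (Suc n)"
    by (metis not0_implies_Suc)
  then show ?case
  proof cases
    case 1
    then show ?thesis
      by (simp add: lpa_elem_eq cycle_power_def)
  next
    case 2
    then show ?thesis
      using assms by (simp add: lpa_word_eq cycle_power_def)
  next
    case 3
    then have "lpa_word_power E lab \<B> c B i = cl (cycle_power c B (Suc n)) \<otimes>\<^bsub>Q\<^esub> cl (edges c)"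
      using less[of "Suc n"] assms by (simp add: lpa_eq lpa_word_eq)
    also have "\<dots> = cl (cycle_power c B (Suc n) * edges c)"
      using assms by (intro mult_presented cycle_power_free edges_free)
    also have "cycle_power c B (Suc n) * edges c = cycle_power c B i"
      by (simp add: 3 cycle_power_def power_commutes mult.assoc)
    finally show ?thesis .
  qed
qed

lemma cycle_polynomial_class:
  assumes "c \<noteq> []" "over_alphabet c" "B \<in> \<B>"
  shows "(\<Oplus>\<^bsub>Q\<^esub>i\<in>{0..n}. k i \<odot>\<^bsub>Q\<^esub> (lpa_word_power E lab \<B> c B i \<otimes>\<^bsub>Q\<^esub> lpa_proj E lab \<B> B)) =
    cl (\<Sum>i=0..n. const_poly (k i) * (cycle_power c B i * proj B))"
    and "(\<Sum>i=0..n. const_poly (k i) * (cycle_power c B i * proj B)) \<in> free_algebra gens"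
proof -
  have free: "cycle_power c B i * proj B \<in> free_algebra gens" for i
    using assms cycle_power_free by (auto intro: free_algebra_mult)
  then have free': "const_poly (k i) * (cycle_power c B i * proj B) \<in> free_algebra gens" for i
    by (rule free_const_mult)
  have "k i \<odot>\<^bsub>Q\<^esub> (lpa_word_power E lab \<B> c B i \<otimes>\<^bsub>Q\<^esub> lpa_proj E lab \<B> B) =
      cl (const_poly (k i) * (cycle_power c B i * proj B))" for i
    using assms cycle_power_free[OF assms] free
    by (simp add: lpa_word_power_eq lpa_elem_eq mult_presented smult_presented)
  then show "(\<Oplus>\<^bsub>Q\<^esub>i\<in>{0..n}. k i \<odot>\<^bsub>Q\<^esub> (lpa_word_power E lab \<B> c B i \<otimes>\<^bsub>Q\<^esub> lpa_proj E lab \<B> B)) =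
      cl (\<Sum>i=0..n. const_poly (k i) * (cycle_power c B i * proj B))"
    using finsum_presented[of "\<lambda>i. const_poly (k i) * (cycle_power c B i * proj B)" n] free' by simp
  show "(\<Sum>i=0..n. const_poly (k i) * (cycle_power c B i * proj B)) \<in> free_algebra gens"
    by (intro free_algebra_sum free')
qed

lemma reduction_in_quotient:
  assumes "X \<in> carrier Q" "X \<noteq> \<zero>\<^bsub>Q\<^esub>"
  shows "\<exists>a \<in> carrier Q. \<exists>b \<in> carrier Q. a \<otimes>\<^bsub>Q\<^esub> X \<otimes>\<^bsub>Q\<^esub> b \<noteq> \<zero>\<^bsub>Q\<^esub> \<and>
    ((\<exists>k A. k \<noteq> 0 \<and> A \<in> \<B> \<and> A \<noteq> {} \<and> a \<otimes>\<^bsub>Q\<^esub> X \<otimes>\<^bsub>Q\<^esub> b = k \<odot>\<^bsub>Q\<^esub> lpa_proj E lab \<B> A) \<or>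
     (\<exists>(n::nat) (k :: nat \<Rightarrow> 'k) c A.
        labelled_cycle E lab \<B> c A \<and> \<not> has_exit E lab \<B> c A \<and>
        a \<otimes>\<^bsub>Q\<^esub> X \<otimes>\<^bsub>Q\<^esub> b =
          (\<Oplus>\<^bsub>Q\<^esub>i\<in>{0..n}. k i \<odot>\<^bsub>Q\<^esub> (lpa_word_power E lab \<B> c A i \<otimes>\<^bsub>Q\<^esub> lpa_proj E lab \<B> A))))"
proof -
  obtain x where x: "x \<in> free_algebra gens" "X = cl x"
    using assms(1) by (auto simp: carrier_presented)
  then have "\<not> x \<approx> 0"
    using assms(2) by (simp add: zero_presented coset_eq_iff)
  then obtain a b where ab: "a \<in> free_algebra gens" "b \<in> free_algebra gens" "\<not> a * x * b \<approx> 0"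
    and cases: "(\<exists>k A. k \<noteq> 0 \<and> A \<in> \<B> \<and> A \<noteq> {} \<and> a * x * b \<approx> const_poly k * proj A) \<or>
     (\<exists>n k c A. labelled_cycle E lab \<B> c A \<and> \<not> has_exit E lab \<B> c A \<and>
        a * x * b \<approx> (\<Sum>i=0..n. const_poly (k i) * (cycle_power c A i * proj A)))"
    using reduction_in_free_algebra[OF x(1)] by blast
  have free: "a * x \<in> free_algebra gens" "a * x * b \<in> free_algebra gens"
    using ab x by (simp_all add: free_algebra_mult)
  have prod: "cl a \<otimes>\<^bsub>Q\<^esub> X \<otimes>\<^bsub>Q\<^esub> cl b = cl (a * x * b)"
    using ab x free by (simp add: mult_presented)
  have carr: "cl a \<in> carrier Q" "cl b \<in> carrier Q"
    using ab by (simp_all add: carrier_presented)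
  have nonzero: "cl (a * x * b) \<noteq> \<zero>\<^bsub>Q\<^esub>"
    using ab(3) free by (simp add: zero_presented coset_eq_iff)
  have transfer: "cl (a * x * b) = cl y" if "a * x * b \<approx> y" "y \<in> free_algebra gens" for y
    using that free by (simp add: coset_eq_iff)
  from cases show ?thesis
  proof (elim disjE exE conjE)
    fix k A assume A: "k \<noteq> 0" "A \<in> \<B>" "A \<noteq> {}" "a * x * b \<approx> const_poly k * proj A"
    have "cl (a * x * b) = k \<odot>\<^bsub>Q\<^esub> lpa_proj E lab \<B> A"
      using A transfer[OF A(4)] by (simp add: lpa_elem_eq smult_presented free_const_mult)
    then show ?thesis
      using A carr nonzero unfolding prod[symmetric] by blast
  next
    fix n :: nat and k c A
    assume c: "labelled_cycle E lab \<B> c A" "\<not> has_exit E lab \<B> c A"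
      and eq: "a * x * b \<approx> (\<Sum>i=0..n. const_poly (k i) * (cycle_power c A i * proj A))"
    have "c \<noteq> []" "over_alphabet c" "A \<in> \<B>"
      using c(1) labelled_wordsD[of c] by (auto simp: labelled_cycle_def family_below_def)
    note poly = cycle_polynomial_class[OF this, where n = n and k = k]
    have "cl (a * x * b) = (\<Oplus>\<^bsub>Q\<^esub>i\<in>{0..n}. k i \<odot>\<^bsub>Q\<^esub> (lpa_word_power E lab \<B> c A i \<otimes>\<^bsub>Q\<^esub> lpa_proj E lab \<B> A))"
      unfolding poly(1) by (rule transfer[OF eq poly(2)])
    then show ?thesis
      using c carr nonzero unfolding prod[symmetric] by blast
  qed
qed

end

theorem theorem3p8:
  fixes E :: "('v, 'e) pre_digraph" and lab :: "'e \<Rightarrow> 'l" and \<B> :: "'v set set"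
    and L :: "('k::field, (('v, 'l) lpa_gen free_word \<Rightarrow>\<^sub>0 'k) set) module"
  defines "L \<equiv> leavitt_labelled_path_algebra E lab \<B>"
  assumes "normal_labelled_space E lab \<B>"
    and "x \<in> carrier L" and "x \<noteq> \<zero>\<^bsub>L\<^esub>"
  shows "\<exists>a \<in> carrier L. \<exists>b \<in> carrier L. a \<otimes>\<^bsub>L\<^esub> x \<otimes>\<^bsub>L\<^esub> b \<noteq> \<zero>\<^bsub>L\<^esub> \<and>
    ((\<exists>k A. k \<noteq> 0 \<and> A \<in> \<B> \<and> A \<noteq> {} \<and>
        a \<otimes>\<^bsub>L\<^esub> x \<otimes>\<^bsub>L\<^esub> b = k \<odot>\<^bsub>L\<^esub> lpa_proj E lab \<B> A) \<or>
     (\<exists>(n::nat) (k :: nat \<Rightarrow> 'k) c A.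
        labelled_cycle E lab \<B> c A \<and> \<not> has_exit E lab \<B> c A \<and>
        a \<otimes>\<^bsub>L\<^esub> x \<otimes>\<^bsub>L\<^esub> b =
          (\<Oplus>\<^bsub>L\<^esub>i\<in>{0..n}. k i \<odot>\<^bsub>L\<^esub> (lpa_word_power E lab \<B> c A i \<otimes>\<^bsub>L\<^esub> lpa_proj E lab \<B> A))))"
proof -
  interpret normal_labelled_space E lab \<B>
    by (rule assms(2))
  interpret leavitt_calculus E lab \<B> "TYPE('k)"
    by unfold_locales
  show ?thesis
    using reduction_in_quotient[of x] assms(3,4) unfolding L_def lpa_eq .
qed

end
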